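(* Let $m\ge 1$ be a fixed integer. For any $0<\epsilon<1$ there are an integer $n_0>0$ and a constant $L=L(m,\epsilon)>0$ with the following property. Let $J$ be the set of all tuples $\tau\in\mathcal T_m$ such that $$T_1(G_\tau)\log_2 T_1(G_\tau)\ge L|\tau|.$$ Then for any even $n\ge n_0$ $$\frac{\gamma(n,J)}{\gamma(n,\mathcal T_m)}\ge 1-\epsilon.$$
   Context: $M=\langle a,b\mid a^2=b^3=1\rangle$ is the modular group. A word in the alphabet $\{a,b,b^{-1}\}$ is reduced if it contains no subword $aa, bb^{-1}, b^{-1}b, bb, b^{-1}b^{-1}$, and cyclically reduced if all its cyclic permutations are reduced. $\mathcal T_m$ is the set of all $m$-tuples $\tau=(r_1,\dots,r_m)$ of cyclically reduced words with $|r_1|=\dots=|r_m|$, and $|\tau|=\max_i|r_i|$ is this common length. $G_\tau=M/\langle\langle r_1,\dots,r_m\rangle\rangle$ (quotient by the normal closure). For a set $S$ of $m$-tuples, $\gamma(n,S)=\#\{\tau\in S:|\tau|=n\}$. For a finite group presentation $\Pi=\langle a_1,\dots,a_s\mid w_1,\dots,w_t\rangle$ put $\ell_1(\Pi)=\sum_{i=1}^t|w_i|$. For a finitely presentable group $G$, $T_1(G)$ is the minimum of $\ell_1(\Pi)$ over all finite presentations $\Pi$ of $G$. Convention: $0\log_2 0=0$. *)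

theory Defs
  imports Complex_Main "HOL-Algebra.Coset" "HOL-Library.Sublist"
begin

text \<open>A word in the letters $x^{\pm 1}$; the pair $(x, \mathit{True})$ stands for $x$
  and $(x, \mathit{False})$ for $x^{-1}$.\<close>

type_synonym 'a word = "('a \<times> bool) list"

definition inv_letter :: "'a \<times> bool \<Rightarrow> 'a \<times> bool" where
  "inv_letter p = (fst p, \<not> snd p)"

definition freely_reduced :: "'a word \<Rightarrow> bool" where
  "freely_reduced w \<longleftrightarrow> successively (\<lambda>p q. q \<noteq> inv_letter p) w"

definition push_letter :: "'a \<times> bool \<Rightarrow> 'a word \<Rightarrow> 'a word" where
  "push_letter p w =
     (case w of [] \<Rightarrow> [p] | q # v \<Rightarrow> if q = inv_letter p then v else p # w)"

definition free_reduce :: "'a word \<Rightarrow> 'a word" where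
  "free_reduce w = foldr push_letter w []"

definition words_over :: "'a set \<Rightarrow> 'a word set" where
  "words_over S = {w. fst ` set w \<subseteq> S}"

definition free_group :: "'a set \<Rightarrow> 'a word monoid" where
  "free_group S = \<lparr>carrier = {w \<in> words_over S. freely_reduced w},
                   mult = (\<lambda>u v. free_reduce (u @ v)), one = []\<rparr>"

definition normal_closure :: "('g, 'c) monoid_scheme \<Rightarrow> 'g set \<Rightarrow> 'g set" where
  "normal_closure G R = \<Inter>{N. N \<lhd> G \<and> R \<subseteq> N}"

definition presented_group :: "'a set \<Rightarrow> 'a word set \<Rightarrow> 'a word set monoid" where
  "presented_group S R =
     free_group S Mod normal_closure (free_group S) (free_reduce ` R)"

definition presented_elem :: "'a set \<Rightarrow> 'a word set \<Rightarrow> 'a word \<Rightarrow> 'a word set" where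
  "presented_elem S R w =
     normal_closure (free_group S) (free_reduce ` R) #>\<^bsub>free_group S\<^esub> free_reduce w"

lemma inv_letter_inv_letter [simp]: "inv_letter (inv_letter p) = p"
  by (simp add: inv_letter_def)

lemma fst_inv_letter [simp]: "fst (inv_letter p) = fst p"
  by (simp add: inv_letter_def)

lemma freely_reduced_Nil [simp]: "freely_reduced []"
  by (simp add: freely_reduced_def)

lemma freely_reduced_ConsD: "freely_reduced (p # w) \<Longrightarrow> freely_reduced w"
  by (cases w) (simp_all add: freely_reduced_def)

lemma freely_reduced_push_letter:
  "freely_reduced w \<Longrightarrow> freely_reduced (push_letter p w)"
  by (auto simp: push_letter_def freely_reduced_def split: list.split
      intro: freely_reduced_ConsD[unfolded freely_reduced_def])

lemma freely_reduced_foldr_push: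
  "freely_reduced w \<Longrightarrow> freely_reduced (foldr push_letter u w)"
  by (induction u) (simp_all add: freely_reduced_push_letter)

lemma freely_reduced_free_reduce [simp]: "freely_reduced (free_reduce w)"
  by (simp add: free_reduce_def freely_reduced_foldr_push)

lemma push_letter_cancel:
  assumes "freely_reduced w"
  shows "push_letter p (push_letter (inv_letter p) w) = w"
  using assms
  by (auto simp: push_letter_def freely_reduced_def split: list.splits)

lemma foldr_push_push_letter:
  assumes "freely_reduced w"
  shows "foldr push_letter (push_letter p u) w = push_letter p (foldr push_letter u w)"
  using assms
  by (auto simp: push_letter_def[of p u] push_letter_cancel freely_reduced_foldr_push
      split: list.split)

lemma foldr_push_free_reduce:
  assumes "freely_reduced w"
  shows "foldr push_letter (free_reduce u) w = foldr push_letter u w"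
proof (induction u)
  case Nil
  then show ?case by (simp add: free_reduce_def)
next
  case (Cons p u)
  have "free_reduce (p # u) = push_letter p (free_reduce u)"
    by (simp add: free_reduce_def)
  with Cons show ?case by (simp add: foldr_push_push_letter assms)
qed

lemma free_reduce_append:
  "free_reduce (u @ v) = foldr push_letter u (free_reduce v)"
  by (simp add: free_reduce_def)

lemma free_reduce_id: "freely_reduced w \<Longrightarrow> free_reduce w = w"
proof (induction w)
  case Nil
  then show ?case by (simp add: free_reduce_def)
next
  case (Cons p w)
  then have "free_reduce (p # w) = push_letter p w"
    using freely_reduced_ConsD[OF Cons.prems] by (simp add: free_reduce_def)
  with Cons.prems show ?case
    by (auto simp: push_letter_def freely_reduced_def split: list.split)
qed

lemma free_reduce_append_left:
  "free_reduce (free_reduce u @ v) = free_reduce (u @ v)"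
  by (simp add: free_reduce_append foldr_push_free_reduce)

lemma free_reduce_append_right:
  "free_reduce (u @ free_reduce v) = free_reduce (u @ v)"
  by (simp add: free_reduce_append free_reduce_id)

lemma push_letter_words_over:
  "w \<in> words_over S \<Longrightarrow> fst p \<in> S \<Longrightarrow> push_letter p w \<in> words_over S"
  by (cases w) (auto simp add: push_letter_def words_over_def image_subset_iff)

lemma free_reduce_words_over: "w \<in> words_over S \<Longrightarrow> free_reduce w \<in> words_over S"
proof (induction w)
  case Nil
  then show ?case by (simp add: free_reduce_def)
next
  case (Cons p w)
  then have "free_reduce w \<in> words_over S" "fst p \<in> S"
    by (auto simp: words_over_def)
  then show ?case
    using push_letter_words_over[of "free_reduce w" S p] by (simp add: free_reduce_def)
qed

lemma foldr_push_inverse: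
  assumes "freely_reduced w"
  shows "foldr push_letter (map inv_letter (rev u)) (foldr push_letter u w) = w"
proof (induction u)
  case (Cons p u)
  then show ?case
    using push_letter_cancel[of "foldr push_letter u w" "inv_letter p"]
      freely_reduced_foldr_push[OF assms] by simp
qed simp

lemma group_free_group: "group (free_group S)"
proof (rule groupI)
  fix x y assume "x \<in> carrier (free_group S)" "y \<in> carrier (free_group S)"
  then have "x @ y \<in> words_over S"
    by (auto simp: free_group_def words_over_def)
  then show "x \<otimes>\<^bsub>free_group S\<^esub> y \<in> carrier (free_group S)"
    by (simp add: free_group_def free_reduce_words_over)
next
  fix x assume x: "x \<in> carrier (free_group S)"
  let ?y = "free_reduce (map inv_letter (rev x))"
  have "?y \<in> carrier (free_group S)"
    using x by (auto simp: free_group_def intro!: free_reduce_words_over)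
      (auto simp: words_over_def)
  moreover have "?y \<otimes>\<^bsub>free_group S\<^esub> x = \<one>\<^bsub>free_group S\<^esub>"
    using foldr_push_inverse[of "[]" x]
    by (simp add: free_group_def free_reduce_append_left) (simp add: free_reduce_def)
  ultimately show "\<exists>y\<in>carrier (free_group S). y \<otimes>\<^bsub>free_group S\<^esub> x = \<one>\<^bsub>free_group S\<^esub>"
    by blast
qed (auto simp: free_group_def words_over_def free_reduce_id
    free_reduce_append_left free_reduce_append_right)

lemma (in group) normal_normal_closure:
  assumes "R \<subseteq> carrier G"
  shows "normal_closure G R \<lhd> G"
proof -
  have "carrier G \<lhd> G"
    by (rule normal_invI) (simp_all add: subgroup_self)
  then have ne: "{N. N \<lhd> G \<and> R \<subseteq> N} \<noteq> {}"
    using assms by auto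
  have "subgroup (normal_closure G R) G"
    unfolding normal_closure_def
    by (rule subgroups_Inter[OF _ ne]) (simp add: normal_imp_subgroup)
  then show ?thesis
  proof (rule normal_invI)
    fix x h assume "x \<in> carrier G" "h \<in> normal_closure G R"
    then show "x \<otimes> h \<otimes> inv x \<in> normal_closure G R"
      by (auto simp: normal_closure_def normal.inv_op_closed2)
  qed
qed

lemma group_presented_group:
  assumes "R \<subseteq> words_over S"
  shows "group (presented_group S R)"
proof -
  interpret group "free_group S" by (rule group_free_group)
  have "free_reduce ` R \<subseteq> carrier (free_group S)"
    using assms by (auto simp: free_group_def free_reduce_words_over)
  then show ?thesis
    unfolding presented_group_def by (intro normal.factorgroup_is_group normal_normal_closure)
qed

text \<open>$(s, [w_1, \dots, w_t])$ is the presentation on generators $0, \dots, s-1$ with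
  relators $w_1, \dots, w_t$.  Relators need not be reduced; this does not affect the minimum.\<close>

type_synonym fin_presentation = "nat \<times> nat word list"

definition fin_presentation :: "fin_presentation \<Rightarrow> bool" where
  "fin_presentation P \<longleftrightarrow> set (snd P) \<subseteq> words_over {..<fst P}"

definition presents :: "fin_presentation \<Rightarrow> ('g, 'c) monoid_scheme \<Rightarrow> bool" where
  "presents P G \<longleftrightarrow> fin_presentation P \<and> presented_group {..<fst P} (set (snd P)) \<cong> G"

definition ell1 :: "fin_presentation \<Rightarrow> nat" where
  "ell1 P = (\<Sum>w\<leftarrow>snd P. length w)"

definition T1 :: "('g, 'c) monoid_scheme \<Rightarrow> nat" where
  "T1 G = (LEAST k. \<exists>P. presents P G \<and> ell1 P = k)"

datatype modular_gen = gen_a | gen_b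

definition modular_relators :: "modular_gen word set" where
  "modular_relators = {replicate 2 (gen_a, True), replicate 3 (gen_b, True)}"

definition modular_group :: "modular_gen word set monoid" where
  "modular_group = presented_group UNIV modular_relators"

datatype modular_letter = let_a | let_b | let_b_inv

type_synonym mword = "modular_letter list"

fun letter_word :: "modular_letter \<Rightarrow> modular_gen \<times> bool" where
  "letter_word let_a = (gen_a, True)"
| "letter_word let_b = (gen_b, True)"
| "letter_word let_b_inv = (gen_b, False)"

definition modular_elem :: "mword \<Rightarrow> modular_gen word set" where
  "modular_elem r = presented_elem UNIV modular_relators (map letter_word r)"

definition mreduced :: "mword \<Rightarrow> bool" where
  "mreduced w \<longleftrightarrow>
     (\<forall>u \<in> {[let_a, let_a], [let_b, let_b_inv], [let_b_inv, let_b],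
            [let_b, let_b], [let_b_inv, let_b_inv]}. \<not> sublist u w)"

definition cyclically_mreduced :: "mword \<Rightarrow> bool" where
  "cyclically_mreduced w \<longleftrightarrow> (\<forall>k. mreduced (rotate k w))"

text \<open>Tuples are lists of length $m$.\<close>

definition tuples :: "nat \<Rightarrow> mword list set" where
  "tuples m = {\<tau>. length \<tau> = m \<and> (\<forall>r \<in> set \<tau>. cyclically_mreduced r)
                   \<and> (\<forall>r \<in> set \<tau>. \<forall>r' \<in> set \<tau>. length r = length r')}"

definition tuple_length :: "mword list \<Rightarrow> nat" where
  "tuple_length \<tau> = Max (length ` set \<tau>)"

definition quotient_group :: "mword list \<Rightarrow> modular_gen word set set monoid" where
  "quotient_group \<tau> =
     modular_group Mod normal_closure modular_group (modular_elem ` set \<tau>)"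

lemma group_modular_group: "group modular_group"
  unfolding modular_group_def
  by (rule group_presented_group) (simp add: words_over_def)

lemma modular_elem_in_carrier: "modular_elem r \<in> carrier modular_group"
proof -
  have "free_reduce (map letter_word r) \<in> carrier (free_group UNIV)"
    by (simp add: free_group_def words_over_def)
  then show ?thesis
    by (auto simp: modular_elem_def presented_elem_def modular_group_def
        presented_group_def FactGroup_def RCOSETS_def)
qed

lemma group_quotient_group: "group (quotient_group \<tau>)"
proof -
  interpret group modular_group by (rule group_modular_group)
  show ?thesis
    unfolding quotient_group_def
    by (intro normal.factorgroup_is_group normal_normal_closure)
      (auto simp: modular_elem_in_carrier)
qed

definition growth :: "nat \<Rightarrow> mword list set \<Rightarrow> nat" where
  "growth n S = card {\<tau> \<in> S. tuple_length \<tau> = n}"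

definition incompressible_tuples :: "nat \<Rightarrow> real \<Rightarrow> mword list set" where
  "incompressible_tuples m L =
     {\<tau> \<in> tuples m. real (T1 (quotient_group \<tau>)) * log 2 (real (T1 (quotient_group \<tau>)))
                      \<ge> L * real (tuple_length \<tau>)}"

end

(*
  Call a tuple of relators of length n = 2k generic if no subword of length D (of order k/100 in
  syllables) occurs twice in the cyclic relators and their inverses, and if no relator nearly
  consists of blocks F b^+-1 F^-1; all but an exponentially small proportion of tuples are generic.

  For generic relators one builds an action of the modular group by alternately hanging leaves on a
  graph of triangles and closing up the long relator paths.  On the limit the relators act
  trivially, and a word that fixes a triangle contains almost a full relator; hence the quotient has
  Dehn's algorithm.  It follows that torsion is conjugate to powers of a and b, so that an
  isomorphism between G_sigma and G_tau with tau generic is, up to conjugation and b -> b^-1, the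
  identity on generators.  Every relator of sigma then contains almost a full relator of tau, which
  leaves at most poly(k) * 2^(12 D m) tuples sigma in the isomorphism class of G_tau.

  On the other hand G_tau has no homomorphism onto Z, so each generator occurs in a relator and there
  are at most 2^(O(t log t)) presentations with ell_1 = t.  Hence only few generic tuples have
  T_1 log T_1 < n / 16.
*)
theory Submission
  imports Defs "HOL-Library.Countable" "HOL-Real_Asymp.Real_Asymp"
begin

section \<open>Relator paths in graphs of triangles\<close>

text \<open>The statement to be carried through the construction is that every closed path contains
  almost a relator. By itself it does not survive glueing: when a relator path is closed up by an
  arc, any old path parallel to its old part \<alpha> becomes part of a new closed path. Hence the
  invariant compares an arbitrary path with a relator segment \<alpha>, and \<alpha> must be allowed
  the length that an unclosed relator path can have. That length is controlled by a budget: right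
  after a glueing an unclosed relator path has fewer than \<open>4 * D\<close> consecutive edges,
  and each of the \<open>D\<close> sproutings before the next glueing adds 2, whence
  \<open>6 * D\<close>. A bigon on a new arc loses \<open>6 * D\<close> edges to the old part of the
  relator and \<open>6 * D\<close> to its short side, whence the \<open>12 * D\<close> in
  \<open>q\<close>. The same number returns in the count: a relator of an isomorphic quotient has
  about \<open>12 * D\<close> free letters. With \<open>D = k div 100\<close> an isomorphism class
  has at most about \<open>2^(12 * k * m / 100)\<close> tuples, and multiplied by the roughly
  \<open>2^(k / 2)\<close> short presentations this is far below \<open>2^(k * m)\<close>.\<close>

text \<open>Partial actions of the modular group are drawn as graphs of triangles.  A dart is a corner of a
  triangle, \<open>rot True\<close> is the action of \<open>b\<close>, and the action of \<open>a\<close> is an involution \<open>A\<close> of the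
  darts; a dart fixed by \<open>A\<close> is free, that is, \<open>a\<close> is not yet defined on it.\<close>

datatype dart = Dart (tri: "nat \<times> nat") (slot: "bool option")

fun rot :: "bool \<Rightarrow> dart \<Rightarrow> dart" where
  "rot True (Dart v None) = (Dart v (Some True))"
| "rot True (Dart v (Some True)) = (Dart v (Some False))"
| "rot True (Dart v (Some False)) = (Dart v None)"
| "rot False (Dart v None) = (Dart v (Some False))"
| "rot False (Dart v (Some False)) = (Dart v (Some True))"
| "rot False (Dart v (Some True)) = (Dart v None)"

text \<open>The slots are labelled so that a path entering a triangle at \<open>None\<close> leaves
  it at the slot named by its sign; the arcs glued in later are laid out in this way.\<close>

lemma rot_None: "rot e (Dart v None) = Dart v (Some e)"
  by (cases e) auto

lemma rot_cases: "(\<And>v. P True (Dart v None)) \<Longrightarrow> (\<And>v. P True (Dart v (Some True))) \<Longrightarrow> (\<And>v. P True (Dart v (Some False)))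
  \<Longrightarrow> (\<And>v. P False (Dart v None)) \<Longrightarrow> (\<And>v. P False (Dart v (Some True))) \<Longrightarrow> (\<And>v. P False (Dart v (Some False))) \<Longrightarrow> P e x"
  by (cases e; cases x; cases "slot x") (auto, (metis (full_types))+)

lemma rot_rot_not [simp]: "rot (\<not> e) (rot e x) = x" "rot e (rot (\<not> e) x) = x"
  by (induct e x rule: rot_cases; simp)+

lemma tri_rot [simp]: "tri (rot e x) = tri x"
  by (induct e x rule: rot_cases) auto

lemma rot_rot_rot [simp]: "rot e (rot e (rot e x)) = x"
  by (induct e x rule: rot_cases) auto

lemma rot_neq [simp]: "rot e x \<noteq> x" "x \<noteq> rot e x"
  by (induct e x rule: rot_cases; simp)+

lemma rot_inj [simp]: "rot e x = rot e y \<longleftrightarrow> x = y"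
  by (metis rot_rot_not(1))

lemma rot_sign_inj [simp]: "rot e x = rot f x \<longleftrightarrow> e = f"
  by (induct e x rule: rot_cases) (cases f; simp)+

text \<open>A bi-infinite sign sequence \<open>\<rho>\<close> stands for the word whose \<open>i\<close>-th syllable is \<open>a b\<close> or
  \<open>a b\<^sup>-\<^sup>1\<close> according to \<open>\<rho> i\<close>; \<open>rinv\<close> reads the inverse word.\<close>

definition rinv :: "(int \<Rightarrow> bool) \<Rightarrow> int \<Rightarrow> bool" where
  "rinv \<rho> = (\<lambda>i. \<not> \<rho> (- i - 1))"

definition rshift :: "int \<Rightarrow> (int \<Rightarrow> bool) \<Rightarrow> int \<Rightarrow> bool" where
  "rshift c \<rho> = (\<lambda>i. \<rho> (i + c))"

lemma rinv_rinv [simp]: "rinv (rinv \<rho>) = \<rho>"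
  by (simp add: rinv_def)

lemma rshift_rinv: "rshift c (rinv \<rho>) = rinv (rshift (- c) \<rho>)"
  by (rule ext) (simp add: rinv_def rshift_def algebra_simps)

lemma rshift_rshift [simp]: "rshift c (rshift d \<rho>) = rshift (c + d) \<rho>"
  by (rule ext) (simp add: rshift_def algebra_simps)

lemma rshift_0 [simp]: "rshift 0 \<rho> = \<rho>"
  by (simp add: rshift_def)

text \<open>The word \<open>\<rho>\<close> is read along \<open>X\<close>: at \<open>X i\<close> the path crosses the edge and then turns by \<open>\<rho> i\<close>.\<close>

definition orbit :: "(dart \<Rightarrow> dart) \<Rightarrow> (int \<Rightarrow> bool) \<Rightarrow> (int \<Rightarrow> dart) \<Rightarrow> bool" where
  "orbit A \<rho> X \<longleftrightarrow> (\<forall>i. X (i + 1) = rot (\<rho> i) (A (X i)))"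

definition invol :: "(dart \<Rightarrow> dart) \<Rightarrow> bool" where
  "invol A \<longleftrightarrow> (\<forall>x. A (A x) = x)"

lemma orbitD: "orbit A \<rho> X \<Longrightarrow> X (i + 1) = rot (\<rho> i) (A (X i))"
  by (simp add: orbit_def)

lemma orbit_back: "orbit A \<rho> X \<Longrightarrow> invol A \<Longrightarrow> X (i - 1) = A (rot (\<not> \<rho> (i - 1)) (X i))"
  using orbitD[of A \<rho> X "i - 1"] by (simp add: invol_def)

text \<open>Each step from \<open>x\<close> to \<open>rot e (A x)\<close> is a bijection of the
  darts, so a reading can be followed from any dart in both directions. Orbits also run on through
  free darts, where \<open>A\<close> is the identity; that an edge is really crossed is always a
  separate condition \<open>A (X i) \<noteq> X i\<close>.\<close>

lemma orbit_exists:
  assumes "invol A"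
  shows "\<exists>X. orbit A \<rho> X \<and> X c = x"
proof -
  define f where "f = rec_nat x (\<lambda>n. \<lambda>y. rot (\<rho> (c + int n)) (A y))"
  define g where "g = rec_nat x (\<lambda>n. \<lambda>y. A (rot (\<not> \<rho> (c - int n - 1)) y))"
  have f: "f 0 = x" "f (Suc n) = rot (\<rho> (c + int n)) (A (f n))" for n by (simp_all add: f_def)
  have g: "g 0 = x" "g (Suc n) = A (rot (\<not> \<rho> (c - int n - 1)) (g n))" for n by (simp_all add: g_def)
  define X where "X i = (if i \<ge> c then f (nat (i - c)) else g (nat (c - i)))" for i
  have "X (i + 1) = rot (\<rho> i) (A (X i))" for i
  proof (cases "i \<ge> c")
    case True
    then have "nat (i + 1 - c) = Suc (nat (i - c))" by simp
    with True show ?thesis by (simp add: X_def f)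
  next
    case False
    then have "nat (c - i) = Suc (nat (c - (i + 1)))" by simp
    then have Xi: "X i = A (rot (\<not> \<rho> i) (g (nat (c - (i + 1)))))"
      using False by (simp add: X_def g)
    have "X (i + 1) = g (nat (c - (i + 1)))"
      using False f g by (auto simp: X_def)
    then show ?thesis using assms by (simp add: Xi invol_def)
  qed
  moreover have "X c = x" by (simp add: X_def f)
  ultimately show ?thesis by (auto simp: orbit_def)
qed

lemma orbit_unique:
  assumes "orbit A \<rho> X" "orbit A \<rho> Y" "invol A" "X c = Y c"
  shows "X = Y"
proof
  fix i
  show "X i = Y i"
  proof (induction i rule: int_induct[where k = c])
    case base
    then show ?case by fact
  next
    case (step1 i)
    then show ?case using assms by (simp add: orbitD)
  next
    case (step2 i)
    then show ?case using assms by (metis orbit_back)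
  qed
qed

lemma orbit_shift: "orbit A \<rho> X \<Longrightarrow> orbit A (rshift c \<rho>) (\<lambda>i. X (i + c))"
  unfolding orbit_def rshift_def by (metis add.commute add.left_commute)

text \<open>The reversed path meets each edge at its other dart, hence \<open>A (X (c - j))\<close>,
  and takes each turn in the opposite sense, hence the negation in \<open>rinv\<close>.\<close>

lemma orbit_inv:
  assumes "orbit A \<rho> X" "invol A"
  shows "orbit A (rinv (rshift c \<rho>)) (\<lambda>j. A (X (c - j)))"
  unfolding orbit_def
proof
  fix j
  have "X (c - j) = rot (\<rho> (c - j - 1)) (A (X (c - j - 1)))"
    using orbitD[OF assms(1), of "c - j - 1"] by simp
  then have "A (X (c - (j + 1))) = rot (\<not> \<rho> (c - j - 1)) (X (c - j))"
    by (simp add: algebra_simps)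
  then show "A (X (c - (j + 1))) = rot (rinv (rshift c \<rho>) j) (A (A (X (c - j))))"
    using assms(2) by (simp add: rinv_def rshift_def invol_def algebra_simps)
qed

lemma orbit_transfer:
  assumes "orbit A \<rho> X" "orbit B \<rho> Y" "X c = Y c"
    and "\<And>i. c \<le> i \<Longrightarrow> i < d \<Longrightarrow> A (X i) = B (X i)" "c \<le> i" "i \<le> d"
  shows "X i = Y i"
  using assms(5,6)
proof (induction i rule: int_ge_induct)
  case base
  then show ?case by (simp add: assms)
next
  case (step i)
  then show ?case using assms(4)[of i] orbitD[OF assms(1), of i] orbitD[OF assms(2), of i] by simp
qed

text \<open>This turns coinciding stretches of two orbits into coinciding stretches of two readings,
  to which the small cancellation condition applies.\<close>

lemma orbit_turns:
  assumes "orbit A \<rho> X" "orbit A \<sigma> Y" "X i = Y j" "X (i + 1) = Y (j + 1)"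
  shows "\<rho> i = \<sigma> j"
  using assms by (simp add: orbitD)

section \<open>Paths without backtracking between triangles\<close>

definition path :: "(dart \<Rightarrow> dart) \<Rightarrow> dart list \<Rightarrow> bool" where
  "path A p \<longleftrightarrow> (\<forall>x\<in>set p. A x \<noteq> x) \<and> successively (\<lambda>x y. tri y = tri (A x) \<and> y \<noteq> A x) p"

text \<open>Endpoints are triangles, not darts: words are compared up to powers of \<open>b\<close>
  at both ends.\<close>

definition joins :: "(dart \<Rightarrow> dart) \<Rightarrow> dart list \<Rightarrow> nat \<times> nat \<Rightarrow> nat \<times> nat \<Rightarrow> bool" where
  "joins A p t t' \<longleftrightarrow> path A p \<and> (if p = [] then t = t' else tri (hd p) = t \<and> tri (A (last p)) = t')"

definition revp :: "(dart \<Rightarrow> dart) \<Rightarrow> dart list \<Rightarrow> dart list" where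
  "revp A p = map A (rev p)"

lemma path_Nil [simp]: "path A []" by (simp add: path_def)

lemma path_append:
  "path A (p @ r) \<longleftrightarrow> path A p \<and> path A r \<and>
     (p \<noteq> [] \<longrightarrow> r \<noteq> [] \<longrightarrow> tri (hd r) = tri (A (last p)) \<and> hd r \<noteq> A (last p))"
  by (auto simp: path_def successively_append_iff)

lemma path_nth:
  "path A p \<longleftrightarrow> (\<forall>i<length p. A (p ! i) \<noteq> p ! i) \<and>
     (\<forall>i. Suc i < length p \<longrightarrow> tri (p ! Suc i) = tri (A (p ! i)) \<and> p ! Suc i \<noteq> A (p ! i))"
  unfolding path_def successively_conv_nth all_set_conv_all_nth by auto

lemma path_revp:
  assumes "invol A" "path A p" shows "path A (revp A p)"
proof -
  have "successively (\<lambda>x y. tri y = tri (A x) \<and> y \<noteq> A x) (map A (rev p))"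
    unfolding successively_map successively_rev
    using assms(2) unfolding path_def
    using assms(1)[unfolded invol_def] by (auto elim!: successively_mono)
  then show ?thesis
    using assms unfolding path_def revp_def invol_def by auto
qed

lemma revp_revp: "invol A \<Longrightarrow> revp A (revp A p) = p"
  by (simp add: revp_def rev_map invol_def o_def)

lemma joins_revp:
  assumes "invol A" "joins A p t t'" shows "joins A (revp A p) t' t"
  using assms path_revp[OF assms(1)]
  by (auto simp: joins_def revp_def hd_map last_map hd_rev last_rev invol_def split: if_splits)

definition seg :: "(int \<Rightarrow> dart) \<Rightarrow> int \<Rightarrow> nat \<Rightarrow> dart list" where
  "seg Y a n = map (\<lambda>j. Y (a + int j)) [0..<n]"

lemma length_seg [simp]: "length (seg Y a n) = n" by (simp add: seg_def)
lemma nth_seg [simp]: "i < n \<Longrightarrow> seg Y a n ! i = Y (a + int i)" by (simp add: seg_def)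
lemma seg_append: "seg Y a n @ seg Y (a + int n) m = seg Y a (n + m)"
  by (rule nth_equalityI) (auto simp: nth_append)
lemma seg_0 [simp]: "seg Y a 0 = []" by (simp add: seg_def)
lemma seg_eq_Nil [simp]: "seg Y a n = [] \<longleftrightarrow> n = 0" by (simp add: seg_def)
lemma hd_seg [simp]: "n > 0 \<Longrightarrow> hd (seg Y a n) = Y a" by (simp add: hd_conv_nth flip: length_greater_0_conv)
lemma last_seg [simp]: "n > 0 \<Longrightarrow> last (seg Y a n) = Y (a + int n - 1)"
  by (simp add: last_conv_nth flip: length_greater_0_conv) (simp add: algebra_simps)

lemma joins_mid:
  assumes "joins A (a @ m @ b) t t'" "a \<noteq> []" "b \<noteq> []"
  shows "joins A m (tri (A (last a))) (tri (hd b))"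
  using assms by (auto simp: joins_def path_append split: if_splits)

text \<open>\<open>Rp\<close> stands for all cyclic shifts of the relators, read in one direction as
  \<open>k\<close>-periodic sequences. \<open>overlap\<close> is the small cancellation condition
  that pieces are shorter than \<open>D\<close>. By \<open>oriented\<close> no relator is a shift of
  an inverse one, so every relator path has one positive direction.\<close>

locale small_cancel =
  fixes Rp :: "(int \<Rightarrow> bool) set" and k D :: nat
  assumes rshift_Rp: "\<rho> \<in> Rp \<Longrightarrow> rshift c \<rho> \<in> Rp"
    and period: "\<rho> \<in> Rp \<Longrightarrow> \<rho> (i + int k) = \<rho> i"
    and overlap: "\<rho> \<in> Rp \<union> rinv ` Rp \<Longrightarrow> \<sigma> \<in> Rp \<union> rinv ` Rp \<Longrightarrow>
      (\<And>i. 0 \<le> i \<Longrightarrow> i < int D \<Longrightarrow> \<rho> i = \<sigma> i) \<Longrightarrow> \<rho> = \<sigma>"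
    and oriented: "\<rho> \<in> Rp \<Longrightarrow> rinv \<rho> \<notin> Rp"
    and nonempty: "Rp \<noteq> {}"
    and D_pos: "D \<ge> 1" and k_large: "k \<ge> 20 * D + 20"
begin

abbreviation "R \<equiv> Rp \<union> rinv ` Rp"

lemma rshift_R: "\<rho> \<in> R \<Longrightarrow> rshift c \<rho> \<in> R"
  using rshift_Rp by (auto simp: rshift_rinv)

lemma rinv_R: "\<rho> \<in> R \<Longrightarrow> rinv \<rho> \<in> R"
  by (metis UnE UnI1 UnI2 image_iff rinv_rinv)

lemma overlap_at:
  assumes "\<rho> \<in> R" "\<sigma> \<in> R" "\<And>s. 0 \<le> s \<Longrightarrow> s < int D \<Longrightarrow> \<rho> (s + i) = \<sigma> (s + j)"
  shows "rshift i \<rho> = rshift j \<sigma>"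
  by (rule overlap) (use assms rshift_R in \<open>auto simp: rshift_def\<close>)

text \<open>A path that spells \<open>q\<close> consecutive syllables of a relator contains all of the relator except
  \<open>12 D\<close> syllables.\<close>

definition q :: nat where "q = k - 12 * D"

text \<open>A list of \<open>n\<close> darts has \<open>n - 1\<close> turns, so a relator path with
  \<open>q\<close> darts shows only \<open>q - 1\<close> signs; this shift by one reappears in
  \<open>windmill\<close> and in the abbreviation \<open>N\<close>.\<close>

definition relp :: "(dart \<Rightarrow> dart) \<Rightarrow> dart list \<Rightarrow> bool" where
  "relp A p \<longleftrightarrow> path A p \<and> (\<exists>\<rho>\<in>R. \<forall>i. Suc i < length p \<longrightarrow> p ! Suc i = rot (\<rho> (int i)) (A (p ! i)))"

definition big :: "(dart \<Rightarrow> dart) \<Rightarrow> dart list \<Rightarrow> bool" where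
  "big A p \<longleftrightarrow> (\<exists>xs ys zs. p = xs @ ys @ zs \<and> length ys = q \<and> relp A ys)"

lemma relp_seg:
  assumes "orbit A \<rho> X" "\<rho> \<in> R" "\<And>i. a \<le> i \<Longrightarrow> i < a + int n \<Longrightarrow> A (X i) \<noteq> X i"
  shows "relp A (seg X a n)"
proof -
  have st: "seg X a n ! Suc i = rot (rshift a \<rho> (int i)) (A (seg X a n ! i))" if "Suc i < n" for i
    using that orbitD[OF assms(1), of "a + int i"] by (simp add: rshift_def algebra_simps)
  then have "path A (seg X a n)"
    unfolding path_nth using assms(3) by auto
  with st show ?thesis unfolding relp_def using rshift_R[OF assms(2)] by (metis length_seg)
qed

lemma relp_orbit:
  assumes "relp A p" "p \<noteq> []" "invol A"
  obtains \<rho> X where "\<rho> \<in> R" "orbit A \<rho> X" "p = seg X 0 (length p)"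
proof -
  obtain \<rho> where r: "\<rho> \<in> R" "\<And>i. Suc i < length p \<Longrightarrow> p ! Suc i = rot (\<rho> (int i)) (A (p ! i))"
    using assms by (auto simp: relp_def)
  obtain X where X: "orbit A \<rho> X" "X 0 = p ! 0" using orbit_exists[OF assms(3)] by blast
  have "i < length p \<longrightarrow> X (int i) = p ! i" for i
  proof (induction i)
    case (Suc i)
    then show ?case using orbitD[OF X(1), of "int i"] r(2)[of i] by (auto simp: algebra_simps)
  qed (use X in simp)
  then have "p = seg X 0 (length p)" by (intro nth_equalityI) auto
  with r X show ?thesis using that by blast
qed

lemma relp_Nil [simp]: "relp A []"
  using nonempty by (auto simp: relp_def)

lemma relp_sublist: "relp A (xs @ ys @ zs) \<Longrightarrow> relp A ys"
proof -
  assume a: "relp A (xs @ ys @ zs)"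
  then obtain \<rho> where \<rho>: "\<rho> \<in> R" "\<And>i. Suc i < length (xs @ ys @ zs) \<Longrightarrow>
      (xs @ ys @ zs) ! Suc i = rot (\<rho> (int i)) (A ((xs @ ys @ zs) ! i))" by (auto simp: relp_def)
  have "ys ! Suc i = rot (rshift (int (length xs)) \<rho> (int i)) (A (ys ! i))" if "Suc i < length ys" for i
    using that \<rho>(2)[of "length xs + i"] by (simp add: nth_append rshift_def add.commute)
  moreover have "path A ys" using a by (simp add: relp_def path_append)
  ultimately show ?thesis unfolding relp_def using rshift_R[OF \<rho>(1)] by blast
qed

lemma relp_revp:
  assumes "invol A" "relp A p" shows "relp A (revp A p)"
proof (cases "p = []")
  case True
  then show ?thesis using assms by (simp add: revp_def)
next
  case False
  from relp_orbit[OF assms(2) False assms(1)] obtain \<rho> X where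
    X: "\<rho> \<in> R" "orbit A \<rho> X" "p = seg X 0 (length p)" by blast
  let ?n = "length p"
  let ?Y = "\<lambda>j. A (X (int ?n - 1 - j))"
  have "revp A p ! i = ?Y (int i)" if "i < ?n" for i
  proof -
    have "revp A p ! i = A (p ! (?n - Suc i))" using that by (simp add: revp_def rev_nth)
    also have "p ! (?n - Suc i) = X (int (?n - Suc i))"
      by (subst X(3)) (use that in simp)
    finally show ?thesis using that by (simp add: of_nat_diff algebra_simps)
  qed
  then have eq: "revp A p = seg ?Y 0 ?n"
    by (intro nth_equalityI) (auto simp: revp_def)
  have mt: "A (X i) \<noteq> X i" if "0 \<le> i" "i < int ?n" for i
  proof -
    have "p ! nat i = X i" by (subst X(3)) (use that in simp)
    with assms(2) that show ?thesis unfolding relp_def path_nth by (metis nat_less_iff)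
  qed
  show ?thesis unfolding eq
    by (rule relp_seg[OF orbit_inv[OF X(2) assms(1)] rinv_R[OF rshift_R[OF X(1)]]])
      (use mt[of "int ?n - 1 - i" for i] assms(1) in \<open>simp add: invol_def eq_commute\<close>)
qed

lemma big_append: "big A p \<Longrightarrow> big A (xs @ p @ ys)"
  unfolding big_def by (metis append.assoc)

lemma big_Cons: "big A p \<Longrightarrow> big A (x # p)"
  using big_append[of A p "[x]" "[]"] by simp

lemma big_snoc: "big A p \<Longrightarrow> big A (p @ [x])"
  using big_append[of A p "[]" "[x]"] by simp

lemma big_length: "big A p \<Longrightarrow> q \<le> length p"
  unfolding big_def by auto

lemma big_revp: "invol A \<Longrightarrow> big A p \<Longrightarrow> big A (revp A p)"
proof -
  assume A: "invol A" "big A p"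
  then obtain xs ys zs where "p = xs @ ys @ zs" "length ys = q" "relp A ys" by (auto simp: big_def)
  then show ?thesis
    unfolding big_def
    by (intro exI[of _ "revp A zs"] exI[of _ "revp A ys"] exI[of _ "revp A xs"])
      (use relp_revp[OF A(1)] in \<open>auto simp: revp_def\<close>)
qed

lemma big_revp_iff: "invol A \<Longrightarrow> big A (revp A p) \<longleftrightarrow> big A p"
  using big_revp revp_revp by metis

lemma relp_big:
  assumes "relp A p" "q \<le> length p" shows "big A p"
  unfolding big_def
  by (rule exI[of _ "[]"], rule exI[of _ "take q p"], rule exI[of _ "drop q p"])
    (use assms relp_sublist[of A "[]" "take q p" "drop q p"] in auto)

lemma joins_Cons: "joins A (x # a) t t' \<Longrightarrow> joins A a (tri (A x)) t'"
  using path_append[of A "[x]" a] by (auto simp: joins_def split: if_splits)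

lemma joins_snoc: "joins A (a @ [x]) t t' \<Longrightarrow> joins A a t (tri x)"
  using path_append[of A a "[x]"] by (auto simp: joins_def split: if_splits)

lemma path_mono:
  assumes "\<And>x. A x \<noteq> x \<Longrightarrow> B x = A x" "path A p" shows "path B p"
  using assms unfolding path_nth by (metis Suc_lessD)

lemma relp_mono:
  assumes "\<And>x. A x \<noteq> x \<Longrightarrow> B x = A x" "relp A p" shows "relp B p"
proof -
  from assms(2) obtain \<rho> where r: "\<rho> \<in> R" "\<And>i. Suc i < length p \<Longrightarrow> p ! Suc i = rot (\<rho> (int i)) (A (p ! i))"
    and p: "path A p" by (auto simp: relp_def)
  have "B (p ! i) = A (p ! i)" if "i < length p" for i
    using p that assms(1) unfolding path_nth by blast
  then have "\<And>i. Suc i < length p \<Longrightarrow> p ! Suc i = rot (\<rho> (int i)) (B (p ! i))" using r(2) by simp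
  then show ?thesis unfolding relp_def using r(1) path_mono[OF assms(1) p] by blast
qed

lemma big_mono:
  assumes "\<And>x. A x \<noteq> x \<Longrightarrow> B x = A x" "big A p" shows "big B p"
proof -
  from assms(2) obtain xs ys zs where x: "p = xs @ ys @ zs" "length ys = q" "relp A ys" by (auto simp: big_def)
  have "relp B ys" by (rule relp_mono[OF _ x(3)]) (rule assms(1))
  with x show ?thesis unfolding big_def by blast
qed

lemma path_cut:
  assumes "\<And>x. A x \<noteq> x \<Longrightarrow> B x = A x" "path B p" "\<And>x. x \<in> set p \<Longrightarrow> A x \<noteq> x" shows "path A p"
proof -
  have "B (p ! i) = A (p ! i)" "A (p ! i) \<noteq> p ! i" if "i < length p" for i
    using that assms(1,3) nth_mem by blast+
  with assms(2) show ?thesis unfolding path_nth by simp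
qed

lemma joins_cut:
  assumes "\<And>x. A x \<noteq> x \<Longrightarrow> B x = A x" "joins B p t t'" "\<And>x. x \<in> set p \<Longrightarrow> A x \<noteq> x"
  shows "joins A p t t'"
proof -
  have "path A p" using path_cut[OF assms(1) _ assms(3)] assms(2) unfolding joins_def by blast
  moreover have "B (last p) = A (last p)" if "p \<noteq> []" using that assms(1,3) last_in_set by blast
  ultimately show ?thesis using assms(2) by (auto simp: joins_def)
qed

lemma relp_cut:
  assumes "\<And>x. A x \<noteq> x \<Longrightarrow> B x = A x" "relp B p" "\<And>x. x \<in> set p \<Longrightarrow> A x \<noteq> x" shows "relp A p"
proof -
  from assms(2) obtain \<rho> where r: "\<rho> \<in> R" "\<And>i. Suc i < length p \<Longrightarrow> p ! Suc i = rot (\<rho> (int i)) (B (p ! i))"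
    and p: "path B p" by (auto simp: relp_def)
  have "B (p ! i) = A (p ! i)" if "i < length p" for i
    using that assms(1,3) nth_mem by blast
  then have "\<And>i. Suc i < length p \<Longrightarrow> p ! Suc i = rot (\<rho> (int i)) (A (p ! i))" using r(2) by simp
  then show ?thesis unfolding relp_def using r(1) path_cut[OF assms(1) p assms(3)] by blast
qed

text \<open>The invariant behind Dehn's algorithm, in a form that survives the constructions below.\<close>

definition greendlinger :: "(dart \<Rightarrow> dart) \<Rightarrow> bool" where
  "greendlinger A \<longleftrightarrow> (\<forall>\<alpha> \<beta> t t'. relp A \<alpha> \<longrightarrow> length \<alpha> < 6 * D \<longrightarrow> joins A \<alpha> t t' \<longrightarrow> joins A \<beta> t t'
     \<longrightarrow> \<alpha> \<noteq> \<beta> \<longrightarrow> big A \<beta>)"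

lemma q_bounds: "q + 12 * D = k" "q \<ge> 8 * D + 20"
  using k_large by (auto simp: q_def)

text \<open>Common first or last darts are stripped from both paths, which shortens \<alpha>, until
  the two sides part at both ends. An empty \<alpha> is the case of closed paths. An empty \<beta>
  would make \<alpha> a nonempty closed path, hence \<open>big\<close>, which is impossible for
  fewer than \<open>6 * D\<close> darts.\<close>

lemma greendlingerI:
  assumes A: "invol A"
    and closed: "\<And>\<beta> t. joins A \<beta> t t \<Longrightarrow> \<beta> \<noteq> [] \<Longrightarrow> big A \<beta>"
    and bigon: "\<And>\<alpha> \<beta> t t'. relp A \<alpha> \<Longrightarrow> length \<alpha> < 6 * D \<Longrightarrow> joins A \<alpha> t t' \<Longrightarrow> joins A \<beta> t t'
      \<Longrightarrow> \<alpha> \<noteq> [] \<Longrightarrow> \<beta> \<noteq> [] \<Longrightarrow> hd \<alpha> \<noteq> hd \<beta> \<Longrightarrow> last \<alpha> \<noteq> last \<beta> \<Longrightarrow> big A \<beta>"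
  shows "greendlinger A"
proof -
  have "relp A \<alpha> \<Longrightarrow> length \<alpha> < 6 * D \<Longrightarrow> joins A \<alpha> t t' \<Longrightarrow> joins A \<beta> t t' \<Longrightarrow> \<alpha> \<noteq> \<beta> \<Longrightarrow> big A \<beta>" for \<alpha> \<beta> t t'
  proof (induction "length \<alpha>" arbitrary: \<alpha> \<beta> t t' rule: less_induct)
    case less
    consider "\<alpha> = []" | "\<alpha> \<noteq> []" "\<beta> = []" | "\<alpha> \<noteq> []" "\<beta> \<noteq> []" "hd \<alpha> = hd \<beta>" | "\<alpha> \<noteq> []" "\<beta> \<noteq> []" "last \<alpha> = last \<beta>"
      | "\<alpha> \<noteq> []" "\<beta> \<noteq> []" "hd \<alpha> \<noteq> hd \<beta>" "last \<alpha> \<noteq> last \<beta>" by blast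
    then show ?case
    proof cases
      case 1
      then have "joins A \<beta> t t" "\<beta> \<noteq> []" using less.prems by (auto simp: joins_def)
      then show ?thesis by (rule closed)
    next
      case 2
      then have "joins A \<alpha> t t" using less.prems by (auto simp: joins_def)
      then have "q \<le> length \<alpha>" using closed big_length 2 by blast
      then show ?thesis using less.prems q_bounds by simp
    next
      case 3
      then obtain x a b where x: "\<alpha> = [x] @ a" "\<beta> = [x] @ b" by (metis append_Cons append_Nil list.collapse)
      have ja: "joins A a (tri (A x)) t'" "joins A b (tri (A x)) t'"
        using less.prems(3,4) joins_Cons unfolding x by simp_all
      have "relp A a" using less.prems(1) relp_sublist[of A "[x]" a "[]"] x by simp
      then have "big A b" using less.hyps[of a "tri (A x)" t' b] less.prems ja x by auto
      then show ?thesis by (simp add: x big_Cons)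
    next
      case 4
      then obtain x a b where x: "\<alpha> = a @ [x]" "\<beta> = b @ [x]" by (metis append_butlast_last_id)
      have ja: "joins A a t (tri x)" "joins A b t (tri x)"
        using less.prems(3,4) joins_snoc unfolding x by auto
      have "relp A a" using less.prems(1) relp_sublist[of A "[]" a "[x]"] x by simp
      then have "big A b" using less.hyps[of a t "tri x" b] less.prems ja x by auto
      then show ?thesis by (simp add: x big_snoc)
    next
      case 5
      then show ?thesis using bigon less.prems by blast
    qed
  qed
  then show ?thesis unfolding greendlinger_def by blast
qed

definition closed_orbit :: "(dart \<Rightarrow> dart) \<Rightarrow> (int \<Rightarrow> dart) \<Rightarrow> bool" where
  "closed_orbit A X \<longleftrightarrow> (\<forall>i. A (X i) \<noteq> X i \<and> X (i + int k) = X i)"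

text \<open>Bounds the length of relator paths that are not closed yet. Glueing brings
  \<open>n\<close> down to \<open>4 * D\<close>, each sprouting raises it by 2, and glueing can
  start from \<open>6 * D\<close>.\<close>

definition persist :: "(dart \<Rightarrow> dart) \<Rightarrow> nat \<Rightarrow> bool" where
  "persist A n \<longleftrightarrow> (\<forall>\<rho>\<in>R. \<forall>X. orbit A \<rho> X \<longrightarrow> (\<forall>i. 0 \<le> i \<and> i < int n \<longrightarrow> A (X i) \<noteq> X i)
     \<longrightarrow> closed_orbit A X)"

lemma closed_orbit_shift: "closed_orbit A (\<lambda>i. X (i + c)) \<longleftrightarrow> closed_orbit A X"
  unfolding closed_orbit_def
proof safe
  fix i assume h: "\<forall>i. A (X (i + c)) \<noteq> X (i + c) \<and> X (i + int k + c) = X (i + c)"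
  show "A (X i) = X i \<Longrightarrow> False" "X (i + int k) = X i"
    using h[rule_format, of "i - c"] by (auto simp: algebra_simps)
next
  fix i assume h: "\<forall>i. A (X i) \<noteq> X i \<and> X (i + int k) = X i"
  show "X (i + int k + c) = X (i + c)"
    using h[rule_format, of "i + c"] by (simp add: algebra_simps)
qed blast

lemma persist_at:
  assumes "persist A n" "\<rho> \<in> R" "orbit A \<rho> X" "\<And>i. c \<le> i \<Longrightarrow> i < c + int n \<Longrightarrow> A (X i) \<noteq> X i"
  shows "closed_orbit A X"
proof -
  have "closed_orbit A (\<lambda>i. X (i + c))"
    using assms(1) rshift_R[OF assms(2), of c] orbit_shift[OF assms(3), of c] assms(4)
    unfolding persist_def by fastforce
  then show ?thesis by (simp add: closed_orbit_shift)
qed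

lemma orbit_ext:
  assumes "\<And>x. A x \<noteq> x \<Longrightarrow> B x = A x" "orbit A \<rho> X" "closed_orbit A X"
  shows "orbit B \<rho> X" "closed_orbit B X"
  using assms unfolding orbit_def closed_orbit_def by metis+

end

section \<open>Adjoining arcs\<close>

text \<open>\<open>A'\<close> arises from \<open>A\<close> by adjoining arcs that start and end in \<open>V\<close>; an arc with \<open>L\<close> inner
  triangles is given by the closed orbit \<open>Y\<close> of a relator, whose darts \<open>Y 0, \<dots>, Y L\<close> traverse it.\<close>

locale arc_extension = small_cancel Rp k D for Rp k D +
  fixes A A' :: "dart \<Rightarrow> dart" and V :: "(nat \<times> nat) set" and \<A> :: "((int \<Rightarrow> dart) \<times> nat) set"
  assumes inv: "invol A" "invol A'"
    and ext: "A x \<noteq> x \<Longrightarrow> A' x = A x"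
    and supp: "A x \<noteq> x \<Longrightarrow> tri x \<in> V"
    and new: "A' y \<noteq> y \<Longrightarrow> A y = y \<Longrightarrow> \<exists>Y L i. (Y, L) \<in> \<A> \<and> 0 \<le> i \<and> i \<le> int L \<and> y = Y i"
    and arc_orbit: "(Y, L) \<in> \<A> \<Longrightarrow> \<exists>\<rho>\<in>R. orbit A' \<rho> Y"
    and arc_period: "(Y, L) \<in> \<A> \<Longrightarrow> Y (i + int k) = Y i"
    and arc_matched: "(Y, L) \<in> \<A> \<Longrightarrow> A' (Y i) \<noteq> Y i"
    and arc_len: "(Y, L) \<in> \<A> \<Longrightarrow> L < k \<and> k < L + 1 + 6 * D"
    and arc_old: "(Y, L) \<in> \<A> \<Longrightarrow> int L < i \<Longrightarrow> i < int k \<Longrightarrow> A (Y i) \<noteq> Y i"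
    and arc_rev: "(Y, L) \<in> \<A> \<Longrightarrow> ((\<lambda>j. A' (Y (int L - j))), L) \<in> \<A>"
    and arc_next: "(Y, L) \<in> \<A> \<Longrightarrow> 0 \<le> i \<Longrightarrow> i < int L \<Longrightarrow> A' y \<noteq> y \<Longrightarrow> tri y = tri (A' (Y i)) \<Longrightarrow>
      y \<noteq> A' (Y i) \<Longrightarrow> y = Y (i + 1)"
    and arc_start: "(Y, L) \<in> \<A> \<Longrightarrow> tri (Y 0) \<in> V"
    and arc_new: "(Y, L) \<in> \<A> \<Longrightarrow> 0 < i \<Longrightarrow> i \<le> int L \<Longrightarrow> tri (Y i) \<notin> V"
    and arc_inj: "(Y, L) \<in> \<A> \<Longrightarrow> 0 < i \<Longrightarrow> i \<le> int L \<Longrightarrow> 0 < j \<Longrightarrow> j \<le> int L \<Longrightarrow> tri (Y i) = tri (Y j) \<Longrightarrow> i = j"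
begin

lemma A'A' [simp]: "A' (A' x) = x" using inv by (simp add: invol_def)

lemma A'_inj [simp]: "A' x = A' y \<longleftrightarrow> x = y" by (metis A'A')

lemma arc_tri: "(Y, L) \<in> \<A> \<Longrightarrow> tri (A' (Y i)) = tri (Y (i + 1))"
  using arc_orbit orbitD by (metis tri_rot)

lemma arc_prev:
  assumes "(Y, L) \<in> \<A>" "0 \<le> i" "i < int L" "A' y \<noteq> y" "tri (A' y) = tri (Y (i + 1))" "A' y \<noteq> Y (i + 1)"
  shows "y = Y i"
  using arc_next[OF arc_rev[OF assms(1)], of "int L - i - 1" "A' y"] assms by (simp add: algebra_simps)

lemma arc_at:
  assumes "(Y, L) \<in> \<A>" "0 < i" "i \<le> int L" "A' y \<noteq> y" "tri y = tri (Y i)"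
  shows "y = Y i \<or> y = A' (Y (i - 1))"
  using arc_next[OF assms(1), of "i - 1" y] assms arc_tri[OF assms(1), of "i - 1"] by auto

lemma start_new:
  assumes "A' y \<noteq> y" "tri y \<notin> V"
  obtains Y L i where "(Y, L) \<in> \<A>" "0 < i" "i \<le> int L" "y = Y i"
proof -
  have "A y = y" using supp assms by blast
  from new[OF assms(1) this] obtain Y L i where y: "(Y, L) \<in> \<A>" "0 \<le> i" "i \<le> int L" "y = Y i" by blast
  with arc_start[OF y(1)] assms(2) have "i \<noteq> 0" by auto
  with y(2) have "0 < i" by simp
  then show ?thesis using that y by blast
qed

lemma path_next: "path A' p \<Longrightarrow> Suc s < length p \<Longrightarrow> tri (p ! Suc s) = tri (A' (p ! s)) \<and> p ! Suc s \<noteq> A' (p ! s)"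
  unfolding path_nth by blast

lemma path_matched: "path A' p \<Longrightarrow> s < length p \<Longrightarrow> A' (p ! s) \<noteq> p ! s"
  unfolding path_nth by blast

text \<open>An inner triangle of an arc has only two matched darts, so a path that does not
  backtrack has no choice until the arc ends.\<close>

lemma run_fwd:
  assumes Y: "(Y, L) \<in> \<A>" and p: "path A' p" "p ! 0 = Y i" and i: "0 \<le> i"
  shows "s < length p \<Longrightarrow> i + int s \<le> int L \<Longrightarrow> p ! s = Y (i + int s)"
proof (induction s)
  case (Suc s)
  then have "p ! s = Y (i + int s)" by simp
  then show ?case
    using arc_next[OF Y, of "i + int s" "p ! Suc s"] Suc.prems path_next[OF p(1), of s] path_matched[OF p(1), of "Suc s"] i
    by (simp add: algebra_simps)
qed (use p in simp)

lemma run_back: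
  assumes Y: "(Y, L) \<in> \<A>" and p: "path A' p" "p \<noteq> []" "last p = Y i" and i: "i \<le> int L"
  shows "s < length p \<Longrightarrow> int s \<le> i \<Longrightarrow> p ! (length p - 1 - s) = Y (i - int s)"
proof (induction s)
  case (Suc s)
  let ?j = "length p - 1 - Suc s"
  have "p ! Suc ?j = Y (i - int s)" using Suc by (simp add: Suc_diff_Suc)
  moreover have "tri (p ! Suc ?j) = tri (A' (p ! ?j)) \<and> p ! Suc ?j \<noteq> A' (p ! ?j)"
    using path_next[OF p(1), of ?j] Suc.prems by simp
  ultimately have "tri (A' (p ! ?j)) = tri (Y (i - int s))" "A' (p ! ?j) \<noteq> Y (i - int s)" by auto
  then show ?case
    using arc_prev[OF Y, of "i - int s - 1" "p ! ?j"] Suc.prems path_matched[OF p(1), of ?j] i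
    by (simp add: algebra_simps)
qed (use p in \<open>simp add: last_conv_nth\<close>)

lemma run_split:
  assumes Y: "(Y, L) \<in> \<A>" and p: "path A' p" "p \<noteq> []" "hd p = Y i" and i: "0 \<le> i" "i \<le> int L"
  obtains (inside) "p = seg Y i (length p)" "i + int (length p) \<le> int L"
  | (exits) p' where "p = seg Y i (nat (int L - i) + 1) @ p'"
proof (cases "i + int (length p) \<le> int L")
  case True
  have "p = seg Y i (length p)"
    by (rule nth_equalityI) (use run_fwd[OF Y p(1) _ i(1)] True p in \<open>auto simp: hd_conv_nth\<close>)
  with True that show ?thesis by blast
next
  case False
  let ?n = "nat (int L - i) + 1"
  have n: "?n \<le> length p" using False i by simp
  have "take ?n p = seg Y i ?n"
    by (rule nth_equalityI) (use run_fwd[OF Y p(1) _ i(1)] n i p in \<open>auto simp: hd_conv_nth\<close>)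
  then have "p = seg Y i ?n @ drop ?n p" by (metis append_take_drop_id)
  with that show ?thesis by blast
qed

lemma run_split_back:
  assumes Y: "(Y, L) \<in> \<A>" and p: "path A' p" "p \<noteq> []" "last p = Y i" and i: "0 \<le> i" "i \<le> int L"
  obtains (inside) "p = seg Y (i + 1 - int (length p)) (length p)" "int (length p) \<le> i"
  | (enters) p' where "p = p' @ seg Y 0 (nat i + 1)"
proof (cases "int (length p) \<le> i")
  case True
  have "p ! j = Y (i + 1 - int (length p) + int j)" if "j < length p" for j
    using run_back[OF Y p i(2), of "length p - 1 - j"] that True by (simp add: of_nat_diff algebra_simps)
  then have "p = seg Y (i + 1 - int (length p)) (length p)"
    by (intro nth_equalityI) auto
  with True that show ?thesis by blast
next
  case False
  let ?n = "nat i + 1" let ?m = "length p - ?n"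
  have n: "?n \<le> length p" using False i by simp
  have "p ! (?m + j) = Y (int j)" if "j < ?n" for j
    using run_back[OF Y p i(2), of "nat i - j"] that n i by (simp add: of_nat_diff algebra_simps)
  then have "drop ?m p = seg Y 0 ?n"
    using n by (intro nth_equalityI) auto
  then have "p = take ?m p @ seg Y 0 ?n" by (metis append_take_drop_id)
  with that show ?thesis by blast
qed

lemma relp_arc: "(Y, L) \<in> \<A> \<Longrightarrow> relp A' (seg Y a n)"
  using arc_orbit relp_seg arc_matched by metis

lemma big_arc: "(Y, L) \<in> \<A> \<Longrightarrow> q \<le> n \<Longrightarrow> big A' (seg Y a n)"
  using relp_arc relp_big by simp

text \<open>A path with old endpoints that uses a new dart must traverse the whole arc, as it can
  neither begin, stop nor turn inside. The arc has \<open>L + 1 > k - 6 * D\<close> edges, which is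
  more than \<open>q\<close>, so such a path would be \<open>big\<close>.\<close>

lemma old_path:
  assumes p: "joins A' p t t'" "t \<in> V" "t' \<in> V" "\<not> big A' p"
  shows "joins A p t t'"
proof (rule joins_cut[of A A'])
  fix x assume "x \<in> set p"
  then obtain a b where ab: "p = a @ x # b" by (meson split_list)
  have pa: "path A' p" using p by (simp add: joins_def)
  then have px: "path A' (a @ [x])" "path A' (x # b)"
    unfolding ab using path_append[of A' "a @ [x]" b] path_append[of A' a "x # b"] by auto
  have mx: "A' x \<noteq> x" using px by (simp add: path_def)
  show "A x \<noteq> x"
  proof
    assume "A x = x"
    from new[OF mx this] obtain Y L i where Y: "(Y, L) \<in> \<A>" and i: "0 \<le> i" "i \<le> int L" and x: "x = Y i" by blast
    have snoc_ne: "a @ [x] \<noteq> []" and cons_ne: "x # b \<noteq> []" and lx: "last (a @ [x]) = Y i" and hx: "hd (x # b) = Y i"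
      using x by auto
    obtain a' where a': "a @ [x] = a' @ seg Y 0 (nat i + 1)"
    proof (cases rule: run_split_back[OF Y px(1) snoc_ne lx i])
      case 1
      have "hd p = hd (a @ [x])" by (cases a) (auto simp: ab)
      also have "\<dots> = Y (i + 1 - int (Suc (length a)))" using arg_cong[OF 1(1), of hd] by (simp add: x)
      finally have "hd p = Y (i - int (length a))" by simp
      then have "tri (hd p) \<notin> V" using arc_new[OF Y, of "i - int (length a)"] 1 i by simp
      then show thesis using p(1,2) ab by (auto simp: joins_def)
    qed (use that in simp)
    obtain b' where b': "x # b = seg Y i (nat (int L - i) + 1) @ b'"
    proof (cases rule: run_split[OF Y px(2) cons_ne hx i])
      case 1
      have "last p = last (x # b)" by (simp add: ab)
      also have "\<dots> = Y (i + int (Suc (length b)) - 1)" using arg_cong[OF 1(1), of last] by simp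
      finally have "last p = Y (i + int (length b))" by simp
      then have "tri (A' (last p)) \<notin> V" using arc_tri[OF Y, of "i + int (length b)"] arc_new[OF Y, of "i + int (length b) + 1"] 1 i by simp
      then show thesis using p(1,3) ab by (auto simp: joins_def)
    qed (use that in simp)
    have "a = a' @ seg Y 0 (nat i)"
      using a' seg_append[of Y 0 "nat i" 1] i by (simp add: seg_def x)
    then have "p = a' @ (seg Y 0 (nat i) @ seg Y i (nat (int L - i) + 1)) @ b'"
      using ab b' by simp
    also have "seg Y 0 (nat i) @ seg Y i (nat (int L - i) + 1) = seg Y 0 (L + 1)"
    proof -
      have "nat i + (nat (int L - i) + 1) = L + 1" using i by simp
      then show ?thesis using seg_append[of Y 0 "nat i" "nat (int L - i) + 1"] i by (simp only: int_nat_eq if_True add_0)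
    qed
    finally have "big A' p" using big_append[OF big_arc[OF Y, of "L + 1" 0]] arc_len[OF Y] q_bounds by simp
    with p show False by simp
  qed
qed (use ext p in auto)

text \<open>The two pieces cannot overlap: the darts of the first lie in new triangles, while the
  second begins in the old triangle of \<open>Z 0\<close>.\<close>

lemma arc_disjoint:
  assumes Y: "(Y, L) \<in> \<A>" and Z: "(Z, L') \<in> \<A>"
    and p: "p = seg Y a n @ p'" "p = p'' @ seg Z 0 n'" "0 < n'" and a: "0 < a" "a + int n \<le> int L + 1"
  obtains m where "p = seg Y a n @ m @ seg Z 0 n'"
proof -
  have "n \<le> length p''"
  proof (rule ccontr)
    assume "\<not> n \<le> length p''"
    then have "p ! length p'' = Y (a + int (length p''))" by (subst p(1)) (simp add: nth_append)
    moreover have "p ! length p'' = Z 0" by (subst p(2)) (use p(3) in \<open>simp add: nth_append\<close>)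
    ultimately show False
      using arc_start[OF Z] arc_new[OF Y, of "a + int (length p'')"] a \<open>\<not> n \<le> length p''\<close> by simp
  qed
  then have "take n p'' = seg Y a n"
    using p(1,2) by (metis append_eq_conv_conj length_seg take_append diff_is_0_eq take0 append_Nil2)
  then have "p = seg Y a n @ drop n p'' @ seg Z 0 n'"
    using p(2) by (metis append_assoc append_take_drop_id)
  with that show ?thesis by blast
qed

lemma not_big_mid: "\<not> big A' (a @ m @ b) \<Longrightarrow> \<not> big A' m"
  using big_append by blast

text \<open>The path leaves the arc at its far end and comes back at its start, so unless it is
  \<open>big\<close> its middle \<open>m\<close> is an old path parallel to the old remainder of the
  relator, which has \<open>k - 1 - L < 6 * D\<close> darts. The invariant of \<open>A\<close> makes
  \<open>m\<close> either \<open>big\<close> or equal to this remainder; in the latter case the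
  whole path follows the relator for \<open>k - i + n > k - 6 * D\<close> darts.\<close>

lemma exit_return:
  assumes G: "greendlinger A" and Y: "(Y, L) \<in> \<A>"
    and \<beta>: "joins A' (seg Y i (nat (int L - i) + 1) @ m @ seg Y 0 n) t t'"
    and i: "0 < i" "i \<le> int L" "0 < n" "i - int n < 6 * D"
  shows "big A' (seg Y i (nat (int L - i) + 1) @ m @ seg Y 0 n)" (is "big A' ?\<beta>")
proof (rule ccontr)
  assume nb: "\<not> big A' ?\<beta>"
  have Lk: "L < k" "k < L + 1 + 6 * D" using arc_len[OF Y] by auto
  have vt: "tri (A' (Y (int L))) \<in> V" using arc_start[OF arc_rev[OF Y]] by simp
  have "joins A' m (tri (A' (Y (int L)))) (tri (Y 0))"
    using joins_mid[OF \<beta>] i by simp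
  then have m: "joins A m (tri (A' (Y (int L)))) (tri (Y 0))"
    using old_path vt arc_start[OF Y] not_big_mid[OF nb] by blast
  let ?\<alpha> = "seg Y (int L + 1) (k - 1 - L)"
  have old: "A x \<noteq> x" if "x \<in> set ?\<alpha>" for x
    using that arc_old[OF Y] by (auto simp: seg_def)
  have r: "relp A ?\<alpha>" by (rule relp_cut[of A A']) (use ext old relp_arc[OF Y] in auto)
  have Yk: "Y (int k) = Y 0" using arc_period[OF Y, of 0] by simp
  have "joins A' ?\<alpha> (tri (A' (Y (int L)))) (tri (Y 0))"
  proof (cases "k - 1 - L = 0")
    case True
    then have "int k = int L + 1" using Lk by simp
    then show ?thesis using arc_tri[OF Y, of "int L"] Yk by (simp add: joins_def)
  next
    case False
    then have "int L + 1 + int (k - 1 - L) - 1 = int k - 1" using Lk by simp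
    then show ?thesis using False relp_arc[OF Y, of "int L + 1" "k - 1 - L"] arc_tri[OF Y, of "int L"] arc_tri[OF Y, of "int k - 1"] Yk
      by (simp add: joins_def relp_def)
  qed
  then have "joins A ?\<alpha> (tri (A' (Y (int L)))) (tri (Y 0))"
    by (rule joins_cut[of A A', rotated]) (use ext old in auto)
  then consider "m = ?\<alpha>" | "big A m"
    using G m r Lk unfolding greendlinger_def by (metis add.commute length_seg less_diff_conv2 less_imp_diff_less diff_less_mono2 less_diff_conv add_less_cancel_left nat_add_left_cancel_less diff_diff_left less_eq_Suc_le Suc_eq_plus1)
  then show False
  proof cases
    case 1
    have "seg Y 0 n = seg Y (int k) n"
      by (intro nth_equalityI) (use arc_period[OF Y, of "int j" for j] in \<open>auto simp: add.commute\<close>)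
    then have "?\<beta> = seg Y i (nat (int L - i) + 1 + (k - 1 - L) + n)"
      using 1 seg_append[of Y "int L + 1" "k - 1 - L" n] seg_append[of Y i "nat (int L - i) + 1" "k - 1 - L + n"] i Lk
      by (simp add: of_nat_diff algebra_simps)
    then show False using nb big_arc[OF Y] i Lk q_bounds by simp
  next
    case 2
    then have "big A' m" using big_mono ext by blast
    with nb show False using big_append by blast
  qed
qed

lemma seg_inside_tri:
  assumes "(Y, L) \<in> \<A>" "0 < n"
  shows "tri (A' (last (seg Y i n))) = tri (Y (i + int n))"
  using arc_tri[OF assms(1), of "i + int n - 1"] assms by simp

lemma arrive:
  assumes Y: "(Y, L) \<in> \<A>" and i: "0 < i" "i \<le> int L" and p: "path A' p" "p \<noteq> []" "tri (A' (last p)) = tri (Y i)"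
  shows "last p = Y (i - 1) \<or> last p = A' (Y i)"
proof -
  have "A' (A' (last p)) \<noteq> A' (last p)" using p unfolding path_def by (metis A'A' last_in_set)
  then show ?thesis using arc_at[OF Y i, of "A' (last p)"] p(3) by (metis A'A')
qed

text \<open>If the base triangle lies inside an arc, the path must leave the arc, since its
  triangles are distinct. It comes back either at the other end, where \<open>exit_return\<close>
  applies, or at the same end; then its middle is a closed old path, nonempty because there is no
  backtracking.\<close>

lemma big_closed:
  assumes G: "greendlinger A" and \<beta>: "joins A' \<beta> t t" "\<beta> \<noteq> []"
  shows "big A' \<beta>"
proof (rule ccontr)
  assume nb: "\<not> big A' \<beta>"
  have closed_old: "big A' m" if "joins A m s s" "m \<noteq> []" for m s
  proof -
    have "joins A [] s s" by (simp add: joins_def)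
    then have "big A m" using G[unfolded greendlinger_def, rule_format, of "[]" s s m] that D_pos by simp
    then show ?thesis using big_mono ext by blast
  qed
  have pb: "path A' \<beta>" using \<beta> by (simp add: joins_def)
  have th: "tri (hd \<beta>) = t" "tri (A' (last \<beta>)) = t" using \<beta> by (auto simp: joins_def)
  show False
  proof (cases "t \<in> V")
    case True
    then show False using old_path[OF \<beta>(1) True True nb] closed_old \<beta> nb by blast
  next
    case False
    have "A' (hd \<beta>) \<noteq> hd \<beta>" using pb \<beta> by (auto simp: path_def)
    then obtain Y L i where Y: "(Y, L) \<in> \<A>" and i: "0 < i" "i \<le> int L" and hi: "hd \<beta> = Y i"
      using start_new False th by metis
    define Z where "Z = (\<lambda>j. A' (Y (int L - j)))"
    have Z: "(Z, L) \<in> \<A>" unfolding Z_def by (rule arc_rev[OF Y])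
    have i0: "0 \<le> i" using i by simp
    show False
    proof (cases rule: run_split[OF Y pb \<beta>(2) hi i0 i(2)])
      case 1
      have "tri (Y (i + int (length \<beta>))) = tri (Y i)"
        using seg_inside_tri[OF Y, of "length \<beta>" i] 1(1) th hi \<beta>(2) by (metis length_greater_0_conv)
      then show False using arc_inj[OF Y, of "i + int (length \<beta>)" i] 1(2) i \<beta>(2) by simp
    next
      case (2 p')
      have "last \<beta> = Y (i - 1) \<or> last \<beta> = Z (int L - i)"
        using arrive[OF Y i pb \<beta>(2)] th hi by (simp add: Z_def)
      then show False
      proof
        assume l: "last \<beta> = Y (i - 1)"
        have i1: "0 \<le> i - 1" "i - 1 \<le> int L" using i by auto
        show False
        proof (cases rule: run_split_back[OF Y pb \<beta>(2) l i1])
          case 1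
          have "hd \<beta> = Y (i - int (length \<beta>))"
            using arg_cong[OF 1(1), of hd] \<beta>(2) by simp
          then have "tri (Y (i - int (length \<beta>))) = tri (Y i)" using hi by simp
          then show False using arc_inj[OF Y, of "i - int (length \<beta>)" i] 1(2) i \<beta>(2) by simp
        next
          case (2 p'')
          have n: "nat (i - 1) + 1 = nat i" using i by simp
          obtain m where m: "\<beta> = seg Y i (nat (int L - i) + 1) @ m @ seg Y 0 (nat i)"
            using arc_disjoint[OF Y Y \<open>\<beta> = seg Y i _ @ p'\<close> 2[unfolded n]] i by auto
          show False using exit_return[OF G Y \<beta>(1)[unfolded m] i] i D_pos nb m by simp
        qed
      next
        assume l: "last \<beta> = Z (int L - i)"
        have i1: "0 \<le> int L - i" "int L - i \<le> int L" using i by auto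
        show False
        proof (cases rule: run_split_back[OF Z pb \<beta>(2) l i1])
          case 1
          have "hd \<beta> = Z (int L - i + 1 - int (length \<beta>))"
            using arg_cong[OF 1(1), of hd] \<beta>(2) by simp
          then have "tri (Y i) = tri (A' (Y (i + int (length \<beta>) - 1)))" using hi by (simp add: Z_def algebra_simps)
          then have "tri (Y i) = tri (Y (i + int (length \<beta>)))" using arc_tri[OF Y, of "i + int (length \<beta>) - 1"] by simp
          then show False using arc_inj[OF Y, of "i + int (length \<beta>)" i] 1(2) i \<beta>(2) by simp
        next
          case (2 p'')
          obtain m where m: "\<beta> = seg Y i (nat (int L - i) + 1) @ m @ seg Z 0 (nat (int L - i) + 1)"
            using arc_disjoint[OF Y Z \<open>\<beta> = seg Y i _ @ p'\<close> 2] i by auto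
          have Z0: "Z 0 = A' (Y (int L))" by (simp add: Z_def)
          have "m \<noteq> []"
          proof
            assume "m = []"
            then show False using pb[unfolded m] i by (simp add: path_append Z0)
          qed
          moreover have jm: "joins A' m (tri (Z 0)) (tri (Z 0))"
            using joins_mid[OF \<beta>(1)[unfolded m]] i by (simp add: Z0)
          ultimately have "big A' m"
            using closed_old old_path[OF jm arc_start[OF Z] arc_start[OF Z]] by blast
          then show False using nb big_append unfolding m by blast
        qed
      qed
    qed
  qed
qed

text \<open>The sides start in opposite directions inside an arc \<open>Y\<close>. If \<alpha> stays
  in the arc, \<beta> goes round the other way and \<open>exit_return\<close> applies. If \<alpha>
  reaches the start of the arc, then \<open>i < 6 * D\<close> and \<beta> covers more than
  \<open>(k - 6 * D) - 6 * D = q\<close> edges of the arc: this case fixes the constant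
  \<open>12 * D\<close>.\<close>

lemma big_bigon:
  assumes G: "greendlinger A" and \<alpha>: "relp A' \<alpha>" "length \<alpha> < 6 * D" "joins A' \<alpha> t t'" "\<alpha> \<noteq> []"
    and \<beta>: "joins A' \<beta> t t'" "\<beta> \<noteq> []" and neq: "hd \<alpha> \<noteq> hd \<beta>" "last \<alpha> \<noteq> last \<beta>" and t: "t \<notin> V"
  shows "big A' \<beta>"
proof (rule ccontr)
  assume nb: "\<not> big A' \<beta>"
  have pb: "path A' \<beta>" and pa: "path A' \<alpha>" using \<alpha> \<beta> by (auto simp: joins_def)
  have th: "tri (hd \<beta>) = t" "tri (A' (last \<beta>)) = t'" "tri (hd \<alpha>) = t" "tri (A' (last \<alpha>)) = t'"
    using \<alpha> \<beta> by (auto simp: joins_def)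
  have "A' (hd \<beta>) \<noteq> hd \<beta>" using pb \<beta> by (auto simp: path_def)
  then obtain Y L i where Y: "(Y, L) \<in> \<A>" and i: "0 < i" "i \<le> int L" and hi: "hd \<beta> = Y i"
    using start_new t th by metis
  define Z where "Z = (\<lambda>j. A' (Y (int L - j)))"
  have Z: "(Z, L) \<in> \<A>" unfolding Z_def by (rule arc_rev[OF Y])
  have Lk: "L < k" "k < L + 1 + 6 * D" using arc_len[OF Y] by auto
  have "A' (hd \<alpha>) \<noteq> hd \<alpha>" using pa \<alpha> by (auto simp: path_def)
  then have "hd \<alpha> = A' (Y (i - 1))" using arc_at[OF Y i] th hi neq by metis
  then have ha: "hd \<alpha> = Z (int L - i + 1)" by (simp add: Z_def algebra_simps)
  have i0: "0 \<le> i" and j0: "0 \<le> int L - i + 1" "int L - i + 1 \<le> int L" using i by auto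
  have la: "0 < length \<alpha>" and lb: "0 < length \<beta>" using \<alpha> \<beta> by auto
  show False
  proof (cases rule: run_split[OF Z pa \<alpha>(4) ha j0])
    case 1
    define i' where "i' = i - int (length \<alpha>)"
    have i': "0 < i'" "i' < i" "i' \<le> int L" using 1(2) i la by (auto simp: i'_def)
    have "last \<alpha> = Z (int L - i + int (length \<alpha>))" using arg_cong[OF 1(1), of last] la by (simp add: algebra_simps)
    then have l\<alpha>: "last \<alpha> = A' (Y i')" by (simp add: Z_def i'_def algebra_simps)
    then have t': "t' = tri (Y i')" using th by simp
    show False
    proof (cases rule: run_split[OF Y pb \<beta>(2) hi i0 i(2)])
      case 1
      have "tri (Y (i + int (length \<beta>))) = tri (Y i')"
        using seg_inside_tri[OF Y lb, of i] 1(1) th t' by simp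
      then show False using arc_inj[OF Y, of "i + int (length \<beta>)" i'] 1(2) i i' by simp
    next
      case (2 p')
      have l: "last \<beta> = Y (i' - 1)"
        using arrive[OF Y i'(1,3) pb \<beta>(2)] th t' neq l\<alpha> by auto
      have i1: "0 \<le> i' - 1" "i' - 1 \<le> int L" using i' by auto
      show False
      proof (cases rule: run_split_back[OF Y pb \<beta>(2) l i1])
        case 1
        have "hd \<beta> = Y (i' - int (length \<beta>))" using arg_cong[OF 1(1), of hd] lb by simp
        then have "tri (Y (i' - int (length \<beta>))) = tri (Y i)" using hi by simp
        then show False using arc_inj[OF Y, of "i' - int (length \<beta>)" i] 1(2) i i' by simp
      next
        case (2 p'')
        have n: "nat (i' - 1) + 1 = nat i'" using i' by simp
        obtain m where m: "\<beta> = seg Y i (nat (int L - i) + 1) @ m @ seg Y 0 (nat i')"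
          using arc_disjoint[OF Y Y \<open>\<beta> = seg Y i _ @ p'\<close> 2[unfolded n]] i i' by auto
        show False using exit_return[OF G Y \<beta>(1)[unfolded m] i] i' \<alpha>(2) nb m by (simp add: i'_def)
      qed
    qed
  next
    case (2 p')
    have n: "nat (int L - (int L - i + 1)) + 1 = nat i" using i by simp
    note a = 2[unfolded n]
    have "nat i \<le> length \<alpha>" using arg_cong[OF a, of length] by simp
    then have i5: "i < 6 * int D" using \<alpha>(2) by simp
    show False
    proof (cases rule: run_split[OF Y pb \<beta>(2) hi i0 i(2)])
      case (2 r)
      have "big A' (seg Y i (nat (int L - i) + 1))"
        by (rule big_arc[OF Y]) (use i i5 Lk q_bounds in linarith)
      then show False using nb big_append[of A' _ "[]" r] 2 by simp
    next
      case 1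
      define j where "j = i + int (length \<beta>)"
      have j: "0 < j" "j \<le> int L" "i < j" using 1(2) i lb by (auto simp: j_def)
      have l\<beta>: "last \<beta> = Y (j - 1)" using arg_cong[OF 1(1), of last] lb by (simp add: j_def)
      have t': "t' = tri (Y j)" using seg_inside_tri[OF Y lb, of i] 1(1) th by (simp add: j_def)
      have l: "last \<alpha> = Z (int L - j)"
        using arrive[OF Y j(1,2) pa \<alpha>(4)] th t' neq l\<beta> by (auto simp: Z_def)
      have j1: "0 \<le> int L - j" "int L - j \<le> int L" using j by auto
      \<comment> \<open>Here \<beta> ends inside the arc, so \<alpha> leaves the arc at its start
        and re-enters at its end. The two pieces of \<alpha> on the arc and \<beta> together make up
        its \<open>L + 1\<close> edges.\<close>
      have "nat i + (nat (int L - j) + 1) \<le> length \<alpha>"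
      proof (cases rule: run_split_back[OF Z pa \<alpha>(4) l j1])
        case 1
        have "hd \<alpha> = Z (int L - j + 1 - int (length \<alpha>))" using arg_cong[OF 1(1), of hd] la by simp
        then have "tri (Z (int L - j + 1 - int (length \<alpha>))) = tri (Z (int L - i + 1))" using ha by simp
        then show ?thesis using arc_inj[OF Z, of "int L - j + 1 - int (length \<alpha>)" "int L - i + 1"] 1(2) i j by simp
      next
        case (2 p'')
        obtain m where "\<alpha> = seg Z (int L - i + 1) (nat i) @ m @ seg Z 0 (nat (int L - j) + 1)"
          using arc_disjoint[OF Z Z a 2] i j by auto
        from arg_cong[OF this, of length] show ?thesis by simp
      qed
      then have "q \<le> length \<beta>" using i j \<alpha>(2) Lk q_bounds unfolding j_def by linarith
      then have "big A' \<beta>" using big_arc[OF Y, of "length \<beta>" i] 1(1) by simp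
      with nb show False by simp
    qed
  qed
qed

lemma greendlinger_extension:
  assumes G: "greendlinger A"
  shows "greendlinger A'"
proof (rule greendlingerI[OF inv(2)])
  fix \<beta> t assume "joins A' \<beta> t t" "\<beta> \<noteq> []"
  then show "big A' \<beta>" using big_closed[OF G] by blast
next
  fix \<alpha> \<beta> t t'
  assume a: "relp A' \<alpha>" "length \<alpha> < 6 * D" "joins A' \<alpha> t t'" "joins A' \<beta> t t'" "\<alpha> \<noteq> []" "\<beta> \<noteq> []"
    "hd \<alpha> \<noteq> hd \<beta>" "last \<alpha> \<noteq> last \<beta>"
  consider "t \<notin> V" | "t' \<notin> V" | "t \<in> V" "t' \<in> V" by blast
  then show "big A' \<beta>"
  proof cases
    case 1
    then show ?thesis using big_bigon[OF G] a by blast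
  next
    case 2
    have "big A' (revp A' \<beta>)"
      by (rule big_bigon[OF G relp_revp[OF inv(2) a(1)] _ joins_revp[OF inv(2) a(3)] _ joins_revp[OF inv(2) a(4)]])
        (use a 2 in \<open>auto simp: revp_def hd_map last_map hd_rev last_rev\<close>)
    then show ?thesis by (simp add: big_revp_iff[OF inv(2)])
  next
    case 3
    show ?thesis
    proof (rule ccontr)
      assume nb: "\<not> big A' \<beta>"
      have "\<not> big A' \<alpha>" using big_length a(2) q_bounds by fastforce
      then have \<alpha>: "joins A \<alpha> t t'" using old_path a(3) 3 by blast
      have \<beta>: "joins A \<beta> t t'" using old_path a(4) 3 nb by blast
      have "A x \<noteq> x" if "x \<in> set \<alpha>" for x using \<alpha> that by (auto simp: joins_def path_def)
      then have "relp A \<alpha>" using relp_cut[OF ext a(1)] by blast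
      then have "big A \<beta>" using G \<alpha> \<beta> a unfolding greendlinger_def by blast
      then show False using big_mono ext nb by blast
    qed
  qed
qed

text \<open>Of the \<open>4 * D\<close> matched darts only the middle \<open>2 * D\<close> are
  examined. If one of them is new, the path follows its arc for \<open>D\<close> steps forward or
  backward, still within the matched range, and \<open>overlap_at\<close> identifies it with the
  closed orbit of the arc. If all are old, \<open>glued\<close> gives a closed orbit through one of
  them.\<close>

lemma persist_extension:
  assumes glued: "\<And>\<rho> X. \<rho> \<in> R \<Longrightarrow> orbit A \<rho> X \<Longrightarrow> (\<And>i. 0 \<le> i \<Longrightarrow> i < 2 * int D \<Longrightarrow> A (X i) \<noteq> X i) \<Longrightarrow>
      \<exists>Y i. orbit A' \<rho> Y \<and> 0 \<le> i \<and> i < 2 * int D \<and> Y i = X i \<and> closed_orbit A' Y"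
  shows "persist A' (4 * D)"
  unfolding persist_def
proof (intro ballI allI impI)
  fix \<rho> X
  assume \<rho>: "\<rho> \<in> R" and X: "orbit A' \<rho> X" and m: "\<forall>i. 0 \<le> i \<and> i < int (4 * D) \<longrightarrow> A' (X i) \<noteq> X i"
  show "closed_orbit A' X"
  proof (cases "\<exists>i. int D \<le> i \<and> i < 3 * int D \<and> A (X i) = X i")
    case True
    then obtain i where i: "int D \<le> i" "i < 3 * int D" "A (X i) = X i" by blast
    then obtain Y L j where Y: "(Y, L) \<in> \<A>" and j: "0 \<le> j" "j \<le> int L" "X i = Y j"
      using new[of "X i"] m by fastforce
    obtain \<sigma> where \<sigma>: "\<sigma> \<in> R" "orbit A' \<sigma> Y" using arc_orbit[OF Y] by blast
    have Xnext: "tri (X (c + 1)) = tri (A' (X c)) \<and> X (c + 1) \<noteq> A' (X c)" for c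
      using orbitD[OF X, of c] by simp
    have "\<exists>a b. X a = Y b \<and> (\<forall>s. 0 \<le> s \<longrightarrow> s < int D \<longrightarrow> \<rho> (s + a) = \<sigma> (s + b))"
    proof (cases "j + int D \<le> int L")
      case True
      have "s \<le> D \<Longrightarrow> X (i + int s) = Y (j + int s)" for s
      proof (induction s)
        case (Suc s)
        show ?case
          using arc_next[OF Y, of "j + int s" "X (i + int s + 1)"] Suc Xnext[of "i + int s"]
            m[rule_format, of "i + int s + 1"] i j True by (simp add: algebra_simps)
      qed (use j in simp)
      then have f: "X (i + s) = Y (j + s)" if "0 \<le> s" "s \<le> int D" for s
        using that by (metis nonneg_int_cases of_nat_le_iff)
      have "\<rho> (s + i) = \<sigma> (s + j)" if "0 \<le> s" "s < int D" for s
        using orbit_turns[OF X \<sigma>(2), of "i + s" "j + s"] f[of s] f[of "s + 1"] that by (simp add: algebra_simps)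
      with j show ?thesis by blast
    next
      case False
      \<comment> \<open>The arc has more than \<open>2 * D\<close> edges, so one of the two
        directions leaves room for \<open>D\<close> steps.\<close>
      have jD: "int D \<le> j" using False arc_len[OF Y] k_large j by linarith
      have "s \<le> D \<Longrightarrow> X (i - int s) = Y (j - int s)" for s
      proof (induction s)
        case (Suc s)
        have "tri (A' (X (i - int s - 1))) = tri (Y (j - int s)) \<and> A' (X (i - int s - 1)) \<noteq> Y (j - int s)"
          using Suc Xnext[of "i - int s - 1"] by (auto simp: algebra_simps)
        then show ?case
          using arc_prev[OF Y, of "j - int s - 1" "X (i - int s - 1)"] Suc.prems
            m[rule_format, of "i - int s - 1"] i j jD by (simp add: algebra_simps)
      qed (use j in simp)
      then have b: "X (i - s) = Y (j - s)" if "0 \<le> s" "s \<le> int D" for s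
        using that by (metis nonneg_int_cases of_nat_le_iff)
      have "\<rho> (s + (i - int D)) = \<sigma> (s + (j - int D))" if "0 \<le> s" "s < int D" for s
        using orbit_turns[OF X \<sigma>(2), of "i - (int D - s)" "j - (int D - s)"] b[of "int D - s"] b[of "int D - s - 1"] that
        by (simp add: algebra_simps)
      with b[of "int D"] show ?thesis by auto
    qed
    then obtain a b where ab: "X a = Y b" "\<And>s. 0 \<le> s \<Longrightarrow> s < int D \<Longrightarrow> \<rho> (s + a) = \<sigma> (s + b)" by blast
    have "rshift a \<rho> = rshift b \<sigma>" by (rule overlap_at[OF \<rho> \<sigma>(1) ab(2)])
    then have "(\<lambda>i. X (i + a)) = (\<lambda>i. Y (i + b))"
      using orbit_unique[OF orbit_shift[OF X, of a] _ inv(2), of "\<lambda>i. Y (i + b)" 0] orbit_shift[OF \<sigma>(2), of b] ab by simp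
    moreover have "closed_orbit A' Y" using arc_period[OF Y] arc_matched[OF Y] by (simp add: closed_orbit_def)
    ultimately show ?thesis using closed_orbit_shift[of A' X a] closed_orbit_shift[of A' Y b] by simp
  next
    case False
    obtain W where W: "orbit A \<rho> W" "W (int D) = X (int D)" using orbit_exists[OF inv(1)] by blast
    have eq: "X i = W i" if "int D \<le> i" "i \<le> 3 * int D" for i
      by (rule orbit_transfer[OF X W(1) W(2)[symmetric] _ that]) (use ext False in blast)
    have "\<exists>Y i. orbit A' (rshift (int D) \<rho>) Y \<and> 0 \<le> i \<and> i < 2 * int D \<and> Y i = W (i + int D) \<and> closed_orbit A' Y"
      by (rule glued[OF rshift_R[OF \<rho>] orbit_shift[OF W(1)]])
      (use eq False in auto)
    then obtain Y i where Y: "orbit A' (rshift (int D) \<rho>) Y" "0 \<le> i" "i < 2 * int D" "Y i = W (i + int D)" "closed_orbit A' Y"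
      by blast
    have "Y = (\<lambda>i. X (i + int D))"
      by (rule orbit_unique[OF Y(1) orbit_shift[OF X] inv(2), of i]) (use Y eq in simp)
    then show ?thesis using Y(5) by (simp add: closed_orbit_shift)
  qed
qed

end

section \<open>Sprouting and glueing\<close>

text \<open>Common form of sprouting and glueing, so that the laws of an involution extending
  \<open>A\<close> are checked only once; each index is an edge, and the flag selects one of its two
  ends.\<close>

definition attach :: "(dart \<Rightarrow> dart) \<Rightarrow> ('i \<times> bool \<Rightarrow> dart) \<Rightarrow> 'i set \<Rightarrow> dart \<Rightarrow> dart" where
  "attach A nd I d = (if d \<in> nd ` (I \<times> UNIV)
     then (let p = the_inv_into (I \<times> UNIV) nd d in nd (fst p, \<not> snd p)) else A d)"

lemma attach_new:
  assumes "inj_on nd (I \<times> UNIV)" "i \<in> I"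
  shows "attach A nd I (nd (i, b)) = nd (i, \<not> b)"
proof -
  have "the_inv_into (I \<times> UNIV) nd (nd (i, b)) = (i, b)"
    using assms by (intro the_inv_into_f_f) auto
  then show ?thesis using assms by (simp add: attach_def)
qed

lemma attach_old: "d \<notin> nd ` (I \<times> UNIV) \<Longrightarrow> attach A nd I d = A d"
  by (simp add: attach_def)

lemma attach_cases:
  obtains (new) i b where "i \<in> I" "d = nd (i, b)" | (old) "d \<notin> nd ` (I \<times> UNIV)"
  by auto

lemma attach_props:
  assumes inj: "inj_on nd (I \<times> UNIV)" and A: "invol A" and fr: "\<And>i b. i \<in> I \<Longrightarrow> A (nd (i, b)) = nd (i, b)"
  shows "invol (attach A nd I)" "A x \<noteq> x \<Longrightarrow> attach A nd I x = A x"
    "attach A nd I y \<noteq> y \<longleftrightarrow> A y \<noteq> y \<or> y \<in> nd ` (I \<times> UNIV)"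
proof -
  let ?B = "attach A nd I"
  have old: "A d \<notin> nd ` (I \<times> UNIV)" if "d \<notin> nd ` (I \<times> UNIV)" for d
  proof
    assume "A d \<in> nd ` (I \<times> UNIV)"
    then obtain i b where "i \<in> I" "A d = nd (i, b)" by blast
    then have "A d = d" using fr[of i b] A unfolding invol_def by metis
    then show False using that \<open>A d \<in> _\<close> by simp
  qed
  show "invol ?B" unfolding invol_def
  proof
    fix x show "?B (?B x) = x"
    proof (cases rule: attach_cases[of I x nd])
      case (new i b)
      then show ?thesis by (simp add: attach_new[OF inj])
    next
      case 2: old
      then show ?thesis using old[OF 2] A by (simp add: attach_old invol_def)
    qed
  qed
  show "A x \<noteq> x \<Longrightarrow> ?B x = A x"
    using fr attach_old[of x nd I A] by blast
  show "?B y \<noteq> y \<longleftrightarrow> A y \<noteq> y \<or> y \<in> nd ` (I \<times> UNIV)"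
  proof (cases rule: attach_cases[of I y nd])
    case (new i b)
    have "nd (i, \<not> b) \<noteq> nd (i, b)" using inj new unfolding inj_on_def by fastforce
    with new show ?thesis by (auto simp: attach_new[OF inj])
  next
    case old
    then show ?thesis by (simp add: attach_old)
  qed
qed

text \<open>The code \<open>s\<close> of a stage makes the triangles adjoined in it fresh.\<close>

definition name :: "nat \<Rightarrow> dart \<Rightarrow> nat \<Rightarrow> nat \<times> nat" where
  "name s w i = (s, to_nat (tri w, slot w, i))"

lemma name_inj [simp]: "name s w i = name s' w' i' \<longleftrightarrow> s = s' \<and> w = w' \<and> i = i'"
  by (auto simp: name_def dart.expand)

lemma fst_name [simp]: "fst (name s w i) = s" by (simp add: name_def)

definition free_darts :: "(dart \<Rightarrow> dart) \<Rightarrow> (nat \<times> nat) set \<Rightarrow> dart set" where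
  "free_darts A V = {w. tri w \<in> V \<and> A w = w}"

definition leaf :: "nat \<Rightarrow> dart \<times> bool \<Rightarrow> dart" where
  "leaf s p = (if snd p then fst p else Dart (name s (fst p) 0) None)"

definition sprout :: "(dart \<Rightarrow> dart) \<Rightarrow> (nat \<times> nat) set \<Rightarrow> nat \<Rightarrow> dart \<Rightarrow> dart" where
  "sprout A V s = attach A (leaf s) (free_darts A V)"

definition sprout_tris :: "(dart \<Rightarrow> dart) \<Rightarrow> (nat \<times> nat) set \<Rightarrow> nat \<Rightarrow> (nat \<times> nat) set" where
  "sprout_tris A V s = V \<union> (\<lambda>w. name s w 0) ` free_darts A V"

text \<open>Sprouting lengthens the common part by one, so that after \<open>D\<close> rounds a long relator path is
  determined by the free dart at which it ends.\<close>

definition tails :: "(dart \<Rightarrow> dart) \<Rightarrow> (nat \<times> nat) set \<Rightarrow> nat \<Rightarrow> bool" where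
  "tails A V h \<longleftrightarrow> (\<forall>\<rho> \<sigma> X Y. orbit A \<rho> X \<and> orbit A \<sigma> Y \<and> X 0 = Y 0 \<and> X 0 \<in> free_darts A V \<and>
     (\<forall>i. 1 \<le> i \<and> i \<le> 2 * int h \<longrightarrow> A (X (- i)) \<noteq> X (- i) \<and> A (Y (- i)) \<noteq> Y (- i))
     \<longrightarrow> (\<forall>i. 0 \<le> i \<and> i \<le> int h \<longrightarrow> X (- i) = Y (- i)))"

lemma orbit_transfer_back:
  assumes "orbit A \<rho> X" "orbit B \<rho> Y" "invol A" "invol B" "X c = Y c"
    and "\<And>i. d \<le> i \<Longrightarrow> i < c \<Longrightarrow> B (X i) = A (X i)" "d \<le> i" "i \<le> c"
  shows "X i = Y i"
  using assms(8,7)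
proof (induction i rule: int_le_induct)
  case (step i)
  then have "X i = Y i" by simp
  then have "A (X (i - 1)) = B (Y (i - 1))"
    using orbitD[OF assms(1), of "i - 1"] orbitD[OF assms(2), of "i - 1"] by simp
  moreover have "A (X (i - 1)) = B (X (i - 1))" using assms(6)[of "i - 1"] step by simp
  ultimately show ?case using assms(4) unfolding invol_def by metis
qed (use assms in simp)

context small_cancel
begin

definition stage :: "(dart \<Rightarrow> dart) \<Rightarrow> (nat \<times> nat) set \<Rightarrow> nat \<Rightarrow> bool" where
  "stage A V s \<longleftrightarrow> invol A \<and> (\<forall>x. A x \<noteq> x \<longrightarrow> tri x \<in> V) \<and> (\<forall>v\<in>V. fst v < s) \<and> greendlinger A"

lemma stageD:
  assumes "stage A V s"
  shows "invol A" "A x \<noteq> x \<Longrightarrow> tri x \<in> V" "v \<in> V \<Longrightarrow> fst v < s" "greendlinger A"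
    "name s w i \<notin> V"
  using assms by (fastforce simp: stage_def)+

section \<open>Hanging leaves on all free darts\<close>

context
  fixes A V s A' V'
  assumes st: "stage A V s"
    and A'_def: "A' = sprout A V s" and V'_def: "V' = sprout_tris A V s"
begin

lemma leaf_inj: "inj_on (leaf s) (free_darts A V \<times> UNIV)"
  using st by (auto simp: inj_on_def leaf_def stage_def free_darts_def split: if_splits)

lemma leaf_free: "w \<in> free_darts A V \<Longrightarrow> A (leaf s (w, b)) = leaf s (w, b)"
  using st by (fastforce simp: leaf_def stage_def free_darts_def)

lemmas sprout_props = attach_props[OF leaf_inj _ leaf_free, folded sprout_def, folded A'_def]

lemma invA': "invol A'" and extA': "A x \<noteq> x \<Longrightarrow> A' x = A x"
  using sprout_props stageD(1)[OF st] by blast+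

lemma A'_free: "w \<in> free_darts A V \<Longrightarrow> A' w = Dart (name s w 0) None"
  "w \<in> free_darts A V \<Longrightarrow> A' (Dart (name s w 0) None) = w"
  using attach_new[OF leaf_inj, of w A True] attach_new[OF leaf_inj, of w A False]
  by (simp_all add: leaf_def A'_def sprout_def)

lemma matched_cases:
  assumes "A' y \<noteq> y"
  obtains (old) "A y \<noteq> y" "A' y = A y"
  | (free) "y \<in> free_darts A V" "A' y = Dart (name s y 0) None"
  | (leaf) w where "w \<in> free_darts A V" "y = Dart (name s w 0) None" "A' y = w"
proof -
  have "A y \<noteq> y \<or> y \<in> leaf s ` (free_darts A V \<times> UNIV)"
    using sprout_props(3)[OF stageD(1)[OF st]] assms by blast
  then show ?thesis
    using that extA' A'_free by (auto simp: leaf_def split: if_splits)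
qed

text \<open>This is why no dart stays free in the limit.\<close>

lemma V_matched:
  assumes "tri x \<in> V" shows "A' x \<noteq> x"
proof (cases "A x = x")
  case True
  then have "A' x = Dart (name s x 0) None" using A'_free(1)[of x] assms by (simp add: free_darts_def)
  then show ?thesis using stageD(5)[OF st, of x 0] assms by (metis dart.sel(1))
next
  case False
  then show ?thesis using extA' by simp
qed

lemma leaf_tri: "A' y \<noteq> y \<Longrightarrow> tri y \<notin> V \<Longrightarrow> \<exists>w\<in>free_darts A V. y = Dart (name s w 0) None \<and> A' y = w"
  by (erule matched_cases) (auto dest: stageD(2)[OF st] simp: free_darts_def)

lemma leaf_matched: "A' y \<noteq> y \<Longrightarrow> tri y = name s w 0 \<Longrightarrow> w \<in> free_darts A V \<and> y = Dart (name s w 0) None \<and> A' y = w"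
  using leaf_tri[of y] stageD(5)[OF st] by fastforce

text \<open>A leaf has a single matched dart, so a path entering it could continue only by
  backtracking, which a turn rules out. Hence new edges occur only at the two ends of a
  path.\<close>

lemma inner_old:
  assumes "A' x \<noteq> x" "A' y \<noteq> y" "A' z \<noteq> z" "y = rot e (A' x)" "z = rot f (A' y)"
  shows "A y \<noteq> y"
  using assms(2)
proof (cases rule: matched_cases)
  case free
  then have "tri z = name s y 0" using assms by simp
  then have "z = A' y" using leaf_matched[OF assms(3)] free by simp
  then show ?thesis using assms by simp
next
  case (leaf w)
  have m: "A' (A' x) \<noteq> A' x" using assms(1) invA' by (auto simp: invol_def)
  have "tri (A' x) = name s w 0" using leaf assms(4) by (metis dart.sel(1) tri_rot)
  then have "A' x = y" using leaf_matched[OF m] leaf by simp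
  then show ?thesis using assms by simp
qed

lemma inner_old_orbit:
  assumes "orbit A' \<rho> X" "A' (X (i - 1)) \<noteq> X (i - 1)" "A' (X i) \<noteq> X i" "A' (X (i + 1)) \<noteq> X (i + 1)"
  shows "A (X i) \<noteq> X i"
  by (rule inner_old[OF assms(2-4), of "\<rho> (i - 1)" "\<rho> i"])
    (use orbitD[OF assms(1), of "i - 1"] orbitD[OF assms(1), of i] in auto)

lemma sprout_path_old:
  assumes "joins A' p t t'" "t \<in> V" "t' \<in> V"
  shows "joins A p t t'"
proof (rule joins_cut[of A A'])
  fix x assume "x \<in> set p"
  then obtain a b where ab: "p = a @ x # b" by (meson split_list)
  have pa: "path A' p" using assms by (simp add: joins_def)
  have mx: "A' x \<noteq> x" using pa ab by (auto simp: path_def)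
  then show "A x \<noteq> x"
  proof (cases rule: matched_cases)
    case free
    show ?thesis
    proof (cases b)
      case Nil
      then have "t' = name s x 0" using assms(1) ab free by (simp add: joins_def)
      then show ?thesis using assms stageD(5)[OF st] by simp
    next
      case (Cons z c)
      then have "tri z = tri (A' x) \<and> z \<noteq> A' x \<and> A' z \<noteq> z"
        using pa ab path_append[of A' "a @ [x]" "z # c"] by (auto simp: path_def)
      then show ?thesis using leaf_matched[of z x] free by simp
    qed
  next
    case (leaf w)
    show ?thesis
    proof (cases a rule: rev_cases)
      case Nil
      then have "t = name s w 0" using assms(1) ab leaf by (simp add: joins_def)
      then show ?thesis using assms stageD(5)[OF st] by simp
    next
      case (snoc c z)
      then have z: "tri x = tri (A' z) \<and> x \<noteq> A' z \<and> A' z \<noteq> z"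
        using pa ab path_append[of A' a "x # b"] by (auto simp: path_def)
      then have "A' (A' z) \<noteq> A' z" using invA' by (auto simp: invol_def)
      then have "A' z = x" using leaf_matched[of "A' z" w] leaf z by simp
      then show ?thesis using z by simp
    qed
  qed (use mx in auto)
qed (use assms extA' in auto)

text \<open>Leaves are dead ends. All paths from a leaf begin with the same dart, so a bigon whose
  sides part at both ends has no leaf as an endpoint; and a closed path based at a leaf is an old
  closed path conjugated by the edge to the leaf.\<close>

lemma greendlinger_sprout: "greendlinger A'"
proof (rule greendlingerI[OF invA'])
  have big_old: "big A' m" if "joins A m t t" "m \<noteq> []" for m t
  proof -
    have "joins A [] t t" by (simp add: joins_def)
    then have "big A m" using stageD(4)[OF st, unfolded greendlinger_def, rule_format, of "[]" t t m] that D_pos by simp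
    then show ?thesis using big_mono extA' by blast
  qed
  have start: "hd p = Dart (name s w 0) None \<and> A' (hd p) = w \<and> w \<in> free_darts A V"
    if "joins A' p (name s w 0) t'" "p \<noteq> []" for p w t'
    using that leaf_matched[of "hd p" w] by (auto simp: joins_def path_def)
  have finish: "last p = w \<and> w \<in> free_darts A V"
    if "joins A' p t (name s w 0)" "p \<noteq> []" for p w t
  proof -
    have "A' (A' (last p)) \<noteq> A' (last p)" "tri (A' (last p)) = name s w 0"
      using that invA' unfolding joins_def path_def invol_def by (auto, metis last_in_set)
    then show ?thesis using leaf_matched[of "A' (last p)" w] invA' by (simp add: invol_def)
  qed
  have newtri: "\<exists>w. t = name s w 0" if "joins A' p t t'" "p \<noteq> []" "t \<notin> V" for p t t'
  proof -
    have "A' (hd p) \<noteq> hd p" "tri (hd p) = t" using that by (auto simp: joins_def path_def)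
    then show ?thesis using leaf_tri[of "hd p"] that(3) by (metis dart.sel(1))
  qed
  fix \<beta> t assume b: "joins A' \<beta> t t" "\<beta> \<noteq> []"
  show "big A' \<beta>"
  proof (cases "t \<in> V")
    case True
    then show ?thesis using sprout_path_old[OF b(1)] big_old b by blast
  next
    case False
    then obtain w where w: "t = name s w 0" using newtri b by blast
    let ?x = "Dart (name s w 0) None"
    have h: "hd \<beta> = ?x" "A' ?x = w" "last \<beta> = w" "w \<in> free_darts A V"
      using start finish b unfolding w by metis+
    have "tri w \<in> V" using h by (simp add: free_darts_def)
    then have ne: "?x \<noteq> w" using stageD(5)[OF st] by (metis dart.sel(1))
    obtain c where c: "\<beta> = ?x # c" using b h by (metis list.collapse)
    have "c \<noteq> []" using c h ne by auto
    then obtain m where m: "\<beta> = [?x] @ m @ [w]" using c h by (metis append_Cons append_Nil append_butlast_last_id last_ConsR)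
    have jm: "joins A' m (tri w) (tri w)"
      using joins_mid[OF b(1)[unfolded m]] h(2) by simp
    have "m \<noteq> []" using b(1) h(2) unfolding m by (auto simp: joins_def path_def)
    moreover have "tri w \<in> V" using h by (simp add: free_darts_def)
    ultimately have "big A' m" using sprout_path_old[OF jm] big_old by blast
    then show ?thesis unfolding m by (rule big_append)
  qed
next
  fix \<alpha> \<beta> t t'
  assume a: "relp A' \<alpha>" "length \<alpha> < 6 * D" "joins A' \<alpha> t t'" "joins A' \<beta> t t'" "\<alpha> \<noteq> []" "\<beta> \<noteq> []"
    "hd \<alpha> \<noteq> hd \<beta>" "last \<alpha> \<noteq> last \<beta>"
  have t: "t \<in> V"
  proof (rule ccontr)
    assume "t \<notin> V"
    then have "hd p = Dart t None" if "joins A' p t t'" "p \<noteq> []" for p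
    proof -
      have "A' (hd p) \<noteq> hd p" "tri (hd p) = t" using that by (auto simp: joins_def path_def)
      then show ?thesis using leaf_tri[of "hd p"] \<open>t \<notin> V\<close> by (metis dart.sel(1))
    qed
    then show False using a by metis
  qed
  have t': "t' \<in> V"
  proof (rule ccontr)
    assume n: "t' \<notin> V"
    have l: "A' (A' (last p)) \<noteq> A' (last p) \<and> tri (A' (last p)) = t'" if "joins A' p t t'" "p \<noteq> []" for p
      using that invA' unfolding joins_def path_def invol_def by (auto, metis last_in_set)
    then have "A' (last p) = Dart t' None" if "joins A' p t t'" "p \<noteq> []" for p
      using leaf_tri[of "A' (last p)"] that n by (metis dart.sel(1))
    then have "A' (last \<beta>) = A' (last \<alpha>)" using a by metis
    then show False using a invA' by (metis invol_def)
  qed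
  have \<alpha>: "joins A \<alpha> t t'" and \<beta>: "joins A \<beta> t t'" using sprout_path_old t t' a by auto
  have "A x \<noteq> x" if "x \<in> set \<alpha>" for x using \<alpha> that by (auto simp: joins_def path_def)
  then have "relp A \<alpha>" using relp_cut[OF extA' a(1)] by blast
  then have "big A \<beta>" using stageD(4)[OF st] \<alpha> \<beta> a unfolding greendlinger_def by blast
  then show "big A' \<beta>" using big_mono extA' by blast
qed

lemma stage_sprout: "stage A' V' (Suc s)"
  unfolding stage_def
proof (intro conjI allI impI ballI)
  fix x assume "A' x \<noteq> x"
  then show "tri x \<in> V'"
    by (cases rule: matched_cases) (auto simp: V'_def sprout_tris_def free_darts_def dest: stageD(2)[OF st])
next
  fix v assume "v \<in> V'"
  then show "fst v < Suc s" using stageD(3)[OF st, of v] by (auto simp: V'_def sprout_tris_def)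
qed (use invA' greendlinger_sprout in auto)

text \<open>By \<open>inner_old_orbit\<close> only the first and the last dart of a matched run can
  be new, which costs 2.\<close>

lemma persist_sprout:
  assumes "persist A n"
  shows "persist A' (n + 2)"
  unfolding persist_def
proof (intro ballI allI impI)
  fix \<rho> X
  assume \<rho>: "\<rho> \<in> R" and X: "orbit A' \<rho> X" and m: "\<forall>i. 0 \<le> i \<and> i < int (n + 2) \<longrightarrow> A' (X i) \<noteq> X i"
  have old: "A (X i) \<noteq> X i" if "1 \<le> i" "i < 1 + int n" for i
    by (rule inner_old_orbit[OF X]) (use m that in auto)
  obtain W where W: "orbit A \<rho> W" "W 1 = X 1" using orbit_exists[OF stageD(1)[OF st]] by blast
  have eq: "X i = W i" if "1 \<le> i" "i \<le> 1 + int n" for i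
    by (rule orbit_transfer[OF X W(1) W(2)[symmetric] _ that]) (use extA' old in blast)
  have "closed_orbit A W" by (rule persist_at[OF assms \<rho> W(1), of 1]) (use eq old in auto)
  then have W': "orbit A' \<rho> W" "closed_orbit A' W" using orbit_ext[OF extA' W(1)] by auto
  then show "closed_orbit A' X" using orbit_unique[OF W'(1) X invA' W(2)] by simp
qed

text \<open>Two orbits ending at a free dart of a leaf both come through its parent dart
  \<open>w\<close>, which is free in \<open>A\<close>, so the old statement applies one step
  earlier. Of the \<open>2 * h + 2\<close> matched darts, \<open>w\<close> itself and the farthest
  one are lost; this is why \<open>tails\<close> assumes twice the length that it concludes.\<close>

lemma tails_sprout:
  assumes T: "tails A V h"
  shows "tails A' V' (Suc h)"
  unfolding tails_def
proof (intro allI impI, elim conjE)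
  fix \<rho> \<sigma> X Y and i :: int
  assume X: "orbit A' \<rho> X" and Y: "orbit A' \<sigma> Y" and eq0: "X 0 = Y 0" and u: "X 0 \<in> free_darts A' V'"
    and m: "\<forall>i. 1 \<le> i \<and> i \<le> 2 * int (Suc h) \<longrightarrow> A' (X (- i)) \<noteq> X (- i) \<and> A' (Y (- i)) \<noteq> Y (- i)"
    and i: "0 \<le> i" "i \<le> int (Suc h)"
  have "tri (X 0) \<notin> V" using u V_matched by (auto simp: free_darts_def)
  then obtain w where w: "w \<in> free_darts A V" "tri (X 0) = name s w 0"
    using u by (auto simp: free_darts_def V'_def sprout_tris_def)
  have step: "Z (- 1) = w \<and> (\<forall>i. 2 \<le> i \<and> i \<le> 2 * int h + 1 \<longrightarrow> A (Z (- i)) \<noteq> Z (- i))"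
    if Z: "orbit A' \<tau> Z" "Z 0 = X 0" and mZ: "\<And>i. 1 \<le> i \<Longrightarrow> i \<le> 2 * int (Suc h) \<Longrightarrow> A' (Z (- i)) \<noteq> Z (- i)" for Z \<tau>
  proof
    have "A' (A' (Z (- 1))) \<noteq> A' (Z (- 1))" using mZ[of 1] invA' by (auto simp: invol_def)
    moreover have "tri (A' (Z (- 1))) = name s w 0" using orbitD[OF Z(1), of "- 1"] Z(2) w by (metis add.left_inverse tri_rot)
    ultimately show "Z (- 1) = w" using leaf_matched[of "A' (Z (- 1))" w] invA' by (simp add: invol_def)
    show "\<forall>i. 2 \<le> i \<and> i \<le> 2 * int h + 1 \<longrightarrow> A (Z (- i)) \<noteq> Z (- i)"
    proof (intro allI impI)
      fix i assume i: "2 \<le> i \<and> i \<le> 2 * int h + 1"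
      have e: "- i - 1 = - (i + 1)" "- i + 1 = - (i - 1)" by simp_all
      show "A (Z (- i)) \<noteq> Z (- i)"
        by (rule inner_old_orbit[OF Z(1)]) (use mZ[of "i + 1", folded e] mZ[of i] mZ[of "i - 1", folded e] i in auto)
    qed
  qed
  have down: "\<exists>W. orbit A (rshift (- 1) \<tau>) W \<and> W 0 = w \<and> (\<forall>i. 1 \<le> i \<and> i \<le> 2 * int h \<longrightarrow> A (W (- i)) \<noteq> W (- i))
      \<and> (\<forall>i. 0 \<le> i \<and> i \<le> int h \<longrightarrow> W (- i) = Z (- i - 1))"
    if Z: "orbit A' \<tau> Z" "Z (- 1) = w" and old: "\<And>i. 2 \<le> i \<Longrightarrow> i \<le> 2 * int h + 1 \<Longrightarrow> A (Z (- i)) \<noteq> Z (- i)" for Z \<tau>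
  proof -
    obtain W where W: "orbit A (rshift (- 1) \<tau>) W" "W 0 = w" using orbit_exists[OF stageD(1)[OF st]] by blast
    have Z1: "orbit A' (rshift (- 1) \<tau>) (\<lambda>i. Z (i - 1))" using orbit_shift[OF Z(1), of "- 1"] by simp
    have eq: "Z (i - 1) = W i" if "- 2 * int h \<le> i" "i \<le> 0" for i
    proof (rule orbit_transfer_back[OF Z1 W(1) invA' stageD(1)[OF st] _ _ that])
      fix i assume "- 2 * int h \<le> i" "i < 0"
      then show "A (Z (i - 1)) = A' (Z (i - 1))" using old[of "1 - i"] extA' by simp
    qed (use W Z in simp)
    show ?thesis
      using W eq[of "- i" for i] old[of "i + 1" for i] by (intro exI[of _ W]) (auto simp: algebra_simps)
  qed
  have sX: "X (- 1) = w" "\<And>i. 2 \<le> i \<Longrightarrow> i \<le> 2 * int h + 1 \<Longrightarrow> A (X (- i)) \<noteq> X (- i)"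
    using step[OF X refl] m by blast+
  have sY: "Y (- 1) = w" "\<And>i. 2 \<le> i \<Longrightarrow> i \<le> 2 * int h + 1 \<Longrightarrow> A (Y (- i)) \<noteq> Y (- i)"
    using step[OF Y eq0[symmetric]] m by blast+
  obtain W1 where W1: "orbit A (rshift (- 1) \<rho>) W1" "W1 0 = w" "\<And>i. 1 \<le> i \<Longrightarrow> i \<le> 2 * int h \<Longrightarrow> A (W1 (- i)) \<noteq> W1 (- i)"
    "\<And>i. 0 \<le> i \<Longrightarrow> i \<le> int h \<Longrightarrow> W1 (- i) = X (- i - 1)" using down[OF X sX] by blast
  obtain W2 where W2: "orbit A (rshift (- 1) \<sigma>) W2" "W2 0 = w" "\<And>i. 1 \<le> i \<Longrightarrow> i \<le> 2 * int h \<Longrightarrow> A (W2 (- i)) \<noteq> W2 (- i)"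
    "\<And>i. 0 \<le> i \<Longrightarrow> i \<le> int h \<Longrightarrow> W2 (- i) = Y (- i - 1)" using down[OF Y sY] by blast
  have eq: "W1 (- i) = W2 (- i)" if "0 \<le> i" "i \<le> int h" for i
    using T W1(1-3) W2(1-3) w that unfolding tails_def by metis
  then show "X (- i) = Y (- i)"
    using W1(4)[of "i - 1"] W2(4)[of "i - 1"] eq[of "i - 1"] eq0 i by (cases "i = 0") auto
qed

end
end

lemma periodic_mod:
  fixes f :: "int \<Rightarrow> 'a"
  assumes "\<And>i. f (i + int k) = f i" "k > 0"
  shows "f i = f (c + (i - c) mod int k)"
proof -
  have "f (j + int k * int n) = f j" for j n
    by (induction n) (use assms(1)[of "j + int k * int n" for n] in \<open>auto simp: algebra_simps\<close>)
  then have *: "f (j + int k * m) = f j" for j m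
    by (cases "m \<ge> 0") (metis nonneg_int_cases, metis add_diff_cancel_right' diff_add_cancel linear minus_mult_right neg_0_le_iff_le nonneg_int_cases uminus_add_conv_diff diff_minus_eq_add)
  have "i = (c + (i - c) mod int k) + int k * ((i - c) div int k)"
    by (simp add: algebra_simps)
  then show ?thesis using * by metis
qed

context small_cancel
begin

section \<open>Closing up long relator paths by arcs\<close>

context
  fixes A V s
  assumes st: "stage A V s" and tl: "tails A V D" and ps: "persist A (6 * D)"
begin

lemmas invA = stageD(1)[OF st] and suppA = stageD(2)[OF st] and freshV = stageD(3)[OF st]
  and GA = stageD(4)[OF st]

lemma AA [simp]: "A (A x) = x" using invA by (simp add: invol_def)

lemmas name_fresh [simp] = stageD(5)[OF st]

text \<open>A maximal relator path that leaves the graph at \<open>u = X 0\<close> and at \<open>X (- l - 1)\<close>.\<close>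

definition hook :: "dart \<Rightarrow> (int \<Rightarrow> bool) \<Rightarrow> (int \<Rightarrow> dart) \<Rightarrow> nat \<Rightarrow> bool" where
  "hook u \<rho> X l \<longleftrightarrow> \<rho> \<in> R \<and> orbit A \<rho> X \<and> X 0 = u \<and> u \<in> free_darts A V \<and> A (X (- int l - 1)) = X (- int l - 1) \<and>
     (\<forall>i. 1 \<le> i \<and> i \<le> int l \<longrightarrow> A (X (- i)) \<noteq> X (- i)) \<and> 2 * D \<le> l"

text \<open>Both paths have at least \<open>2 * D\<close> matched darts before \<open>u\<close>, so
  \<open>tails\<close> makes their last \<open>D\<close> steps agree; then \<open>overlap_at\<close>
  makes the readings equal, and an orbit is determined by its reading and one dart.\<close>

lemma hook_unique:
  assumes "hook u \<rho> X l" "hook u \<sigma> Y l'"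
  shows "\<rho> = \<sigma>" "X = Y" "l = l'"
proof -
  have X: "\<rho> \<in> R" "orbit A \<rho> X" "X 0 = u" "u \<in> free_darts A V" "A (X (- int l - 1)) = X (- int l - 1)"
      "\<And>i. 1 \<le> i \<Longrightarrow> i \<le> int l \<Longrightarrow> A (X (- i)) \<noteq> X (- i)" "2 * D \<le> l"
    and Y: "\<sigma> \<in> R" "orbit A \<sigma> Y" "Y 0 = u" "A (Y (- int l' - 1)) = Y (- int l' - 1)"
      "\<And>i. 1 \<le> i \<Longrightarrow> i \<le> int l' \<Longrightarrow> A (Y (- i)) \<noteq> Y (- i)" "2 * D \<le> l'"
    using assms by (auto simp: hook_def)
  have eq: "X (- i) = Y (- i)" if "0 \<le> i" "i \<le> int D" for i
    using tl[unfolded tails_def, rule_format, of \<rho> X \<sigma> Y i] X Y that by simp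
  have "rshift (- int D) \<rho> = rshift (- int D) \<sigma>"
  proof (rule overlap_at[OF X(1) Y(1)])
    fix s assume "0 \<le> s" "s < int D"
    then show "\<rho> (s + - int D) = \<sigma> (s + - int D)"
      using orbit_turns[OF X(2) Y(2), of "s - int D" "s - int D"] eq[of "int D - s"] eq[of "int D - s - 1"]
      by (simp add: algebra_simps)
  qed
  then have "rshift (int D) (rshift (- int D) \<rho>) = rshift (int D) (rshift (- int D) \<sigma>)" by simp
  then show r: "\<rho> = \<sigma>" by simp
  show XY: "X = Y" using orbit_unique[OF X(2) _ invA, of Y 0] X Y r by simp
  have "- int l - 1 = - (int l + 1)" "- int l' - 1 = - (int l' + 1)" by simp_all
  then have "\<not> l < l'" "\<not> l' < l"
    using X(5) X(6)[of "int l' + 1"] Y(4) Y(5)[of "int l + 1"] unfolding XY by auto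
  then show "l = l'" by simp
qed

text \<open>A longer hook would be closed by \<open>persist\<close>, although it ends at a free
  dart. The bound ensures that the arc still to be added has more than \<open>k - 6 * D\<close>
  edges.\<close>

lemma hook_len: assumes "hook u \<rho> X l" shows "l < 6 * D"
proof (rule ccontr)
  assume "\<not> l < 6 * D"
  have m: "A (X (- i)) \<noteq> X (- i)" if "1 \<le> i" "i \<le> int l" for i
    using assms that by (simp add: hook_def)
  have "A (X i) \<noteq> X i" if "- int (6 * D) \<le> i" "i < - int (6 * D) + int (6 * D)" for i
    using m[of "- i"] that \<open>\<not> l < 6 * D\<close> by simp
  then have "closed_orbit A X"
    using persist_at[OF ps, of \<rho> X "- int (6 * D)"] assms unfolding hook_def by blast
  then have "A (X 0) \<noteq> X 0" by (simp add: closed_orbit_def)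
  then show False using assms by (auto simp: hook_def free_darts_def)
qed

lemma hook_rev:
  assumes "hook u \<rho> X l"
  shows "hook (X (- int l - 1)) (rinv (rshift (- int l - 1) \<rho>)) (\<lambda>j. A (X (- int l - 1 - j))) l"
proof -
  have X: "\<rho> \<in> R" "orbit A \<rho> X" "X 0 = u" "A u = u" "A (X (- int l - 1)) = X (- int l - 1)"
      "\<And>i. 1 \<le> i \<Longrightarrow> i \<le> int l \<Longrightarrow> A (X (- i)) \<noteq> X (- i)" "2 * D \<le> l"
    using assms by (auto simp: hook_def free_darts_def)
  have "tri (X (- int l)) = tri (X (- int l - 1))"
    using orbitD[OF X(2), of "- int l - 1"] X(5) by simp
  moreover have "tri (X (- int l)) \<in> V" using suppA X(6)[of "int l"] X(7) D_pos by simp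
  moreover have "A (A (X (- int l - 1 - - i))) \<noteq> A (X (- int l - 1 - - i))" if "1 \<le> i" "i \<le> int l" for i
    using X(6)[of "int l + 1 - i"] that by (simp add: algebra_simps)
  ultimately show ?thesis
    unfolding hook_def using X orbit_inv[OF X(2) invA] rinv_R[OF rshift_R[OF X(1)]]
    by (auto simp: free_darts_def)
qed

text \<open>Only positive readings are taken: by \<open>hook_rev\<close> a maximal relator path is a
  hook at both of its ends, but it must be closed by one arc, not by two.\<close>

definition hooks :: "dart set" where
  "hooks = {u. \<exists>\<rho> X l. \<rho> \<in> Rp \<and> hook u \<rho> X l}"

text \<open>By \<open>hook_unique\<close> the choices are unique: the hook that leaves at \<open>u\<close> has reading \<open>rr u\<close>, path
  \<open>xx u\<close> and length \<open>ll u\<close>, it enters at \<open>vv u\<close>, and \<open>LL u\<close> new triangles are needed to close it.\<close>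

definition rr :: "dart \<Rightarrow> int \<Rightarrow> bool" where "rr u = (SOME \<rho>. \<exists>X l. \<rho> \<in> Rp \<and> hook u \<rho> X l)"
definition xx :: "dart \<Rightarrow> int \<Rightarrow> dart" where "xx u = (SOME X. \<exists>\<rho> l. \<rho> \<in> Rp \<and> hook u \<rho> X l)"
definition ll :: "dart \<Rightarrow> nat" where "ll u = (SOME l. \<exists>\<rho> X. \<rho> \<in> Rp \<and> hook u \<rho> X l)"

definition vv :: "dart \<Rightarrow> dart" where "vv u = xx u (- int (ll u) - 1)"
definition LL :: "dart \<Rightarrow> nat" where "LL u = k - 1 - ll u"

lemma hooksI:
  assumes "\<rho> \<in> Rp" "hook u \<rho> X l"
  shows "u \<in> hooks" "rr u = \<rho>" "xx u = X" "ll u = l"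
proof -
  show "u \<in> hooks" using assms by (auto simp: hooks_def)
  have "\<exists>X l. rr u \<in> Rp \<and> hook u (rr u) X l" unfolding rr_def using someI_ex[of "\<lambda>\<rho>. \<exists>X l. \<rho> \<in> Rp \<and> hook u \<rho> X l"] assms by blast
  then show "rr u = \<rho>" using hook_unique(1) assms by blast
  have "\<exists>\<rho> l. \<rho> \<in> Rp \<and> hook u \<rho> (xx u) l" unfolding xx_def using someI_ex[of "\<lambda>X. \<exists>\<rho> l. \<rho> \<in> Rp \<and> hook u \<rho> X l"] assms by blast
  then show "xx u = X" using hook_unique(2) assms by blast
  have "\<exists>\<rho> X. \<rho> \<in> Rp \<and> hook u \<rho> X (ll u)" unfolding ll_def using someI_ex[of "\<lambda>l. \<exists>\<rho> X. \<rho> \<in> Rp \<and> hook u \<rho> X l"] assms by blast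
  then show "ll u = l" using hook_unique(3) assms by blast
qed

lemma hooksD: "u \<in> hooks \<Longrightarrow> rr u \<in> Rp \<and> hook u (rr u) (xx u) (ll u)"
  using hooksI unfolding hooks_def by auto

lemma vv_hook: "u \<in> hooks \<Longrightarrow> hook (vv u) (rinv (rshift (- int (ll u) - 1) (rr u))) (\<lambda>j. A (xx u (- int (ll u) - 1 - j))) (ll u)"
  unfolding vv_def using hook_rev hooksD by blast

text \<open>A positive hook at \<open>vv u\<close> would coincide with the reverse of the hook at
  \<open>u\<close>, against \<open>oriented\<close>. Together with \<open>vv_inj\<close> this keeps
  the ends of different arcs apart, so that \<open>attach\<close> is applicable.\<close>

lemma vv_not_hook: assumes "u \<in> hooks" shows "vv u \<notin> hooks"
proof
  assume "vv u \<in> hooks"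
  then have "rinv (rshift (- int (ll u) - 1) (rr u)) \<in> Rp"
    using hooksD hook_unique(1) vv_hook[OF assms] by metis
  then show False using oriented rshift_Rp hooksD[OF assms] by blast
qed

lemma vv_inj: assumes "u \<in> hooks" "w \<in> hooks" "vv u = vv w" shows "u = w"
proof -
  note h = hook_unique[OF vv_hook[OF assms(1)] vv_hook[OF assms(2), folded assms(3)]]
  have "A (xx u (- int (ll u) - 1 - (- int (ll u) - 1))) = A (xx w (- int (ll w) - 1 - (- int (ll w) - 1)))"
    using fun_cong[OF h(2), of "- int (ll u) - 1"] h(3) by simp
  then have "xx u 0 = xx w 0" using AA by (metis diff_self)
  then show ?thesis using hooksD assms unfolding hook_def by metis
qed

lemma LL_bounds: "u \<in> hooks \<Longrightarrow> 1 \<le> LL u \<and> LL u < k \<and> k < LL u + 1 + 6 * D \<and> int (LL u) + 1 = int k - int (ll u)"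
  using hook_len[of u] hooksD[of u] k_large D_pos unfolding LL_def by force

lemma free_hook: "u \<in> hooks \<Longrightarrow> tri u \<in> V \<and> A u = u \<and> tri (vv u) \<in> V \<and> A (vv u) = vv u"
  using hooksD vv_hook unfolding hook_def free_darts_def by blast

text \<open>The two values of \<open>b\<close> give the near and the far end of the
  \<open>i\<close>-th edge of the arc at \<open>u\<close>. There are \<open>LL u + 1\<close> edges
  and \<open>LL u\<close> new triangles; these are entered at slot \<open>None\<close> and left at
  the slot named by the sign read there, so that the reading turns correctly.\<close>

definition arcd :: "(dart \<times> nat) \<times> bool \<Rightarrow> dart" where
  "arcd p = (case p of ((u, i), b) \<Rightarrow>
     if b then (if i = 0 then u else Dart (name s u (i - 1)) (Some (rr u (int i - 1))))
     else if i = LL u then vv u else Dart (name s u i) None)"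

definition arc_index :: "(dart \<times> nat) set" where
  "arc_index = {(u, i). u \<in> hooks \<and> i \<le> LL u}"

definition glue :: "dart \<Rightarrow> dart" where
  "glue = attach A arcd arc_index"

definition glue_tris :: "(nat \<times> nat) set" where
  "glue_tris = V \<union> {name s u i | u i. u \<in> hooks \<and> i < LL u}"

lemma arcd_simps:
  "arcd ((u, 0), True) = u" "arcd ((u, Suc i), True) = Dart (name s u i) (Some (rr u (int i)))"
  "arcd ((u, LL u), False) = vv u" "i \<noteq> LL u \<Longrightarrow> arcd ((u, i), False) = Dart (name s u i) None"
  by (auto simp: arcd_def)

lemma tri_ne: "tri x \<in> V \<Longrightarrow> x \<noteq> Dart (name s w i) c" "tri x \<in> V \<Longrightarrow> Dart (name s w i) c \<noteq> x"
  using name_fresh by (metis dart.sel(1))+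

lemma arcd_inj: "inj_on arcd (arc_index \<times> UNIV)"
proof (rule inj_onI)
  fix p p' assume "p \<in> arc_index \<times> UNIV" "p' \<in> arc_index \<times> UNIV" and e: "arcd p = arcd p'"
  then obtain u i b w j c where p: "p = ((u, i), b)" "u \<in> hooks" "i \<le> LL u" and p': "p' = ((w, j), c)" "w \<in> hooks" "j \<le> LL w"
    by (auto simp: arc_index_def)
  have F: "tri u \<in> V" "tri (vv u) \<in> V" "tri w \<in> V" "tri (vv w) \<in> V" "u \<noteq> vv w" "vv u \<noteq> w"
    using free_hook p p' vv_not_hook by blast+
  show "p = p'"
    using e F vv_inj[OF p(2) p'(2)] unfolding p(1) p'(1)
    by (cases i; cases j) (auto simp: arcd_def tri_ne split: if_splits)
qed

lemma arcd_free: "i \<in> arc_index \<Longrightarrow> A (arcd (i, b)) = arcd (i, b)"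
proof -
  assume "i \<in> arc_index"
  then obtain u j where i: "i = (u, j)" "u \<in> hooks" by (auto simp: arc_index_def)
  have "A (Dart (name s u m) c) = Dart (name s u m) c" for m c using suppA name_fresh by (metis dart.sel(1))
  then show ?thesis using free_hook[OF i(2)] by (auto simp: i arcd_def)
qed

lemmas glue_props = attach_props[OF arcd_inj invA arcd_free, folded glue_def]

lemma inv_glue: "invol glue" and glue_old: "A x \<noteq> x \<Longrightarrow> glue x = A x"
  using glue_props by blast+

lemma gg [simp]: "glue (glue x) = x" using inv_glue by (simp add: invol_def)

lemma glue_arcd: "u \<in> hooks \<Longrightarrow> i \<le> LL u \<Longrightarrow> glue (arcd ((u, i), b)) = arcd ((u, i), \<not> b)"
  unfolding glue_def by (rule attach_new[OF arcd_inj]) (simp add: arc_index_def)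

lemma glue_matched: "glue y \<noteq> y \<longleftrightarrow> A y \<noteq> y \<or> (\<exists>u i b. u \<in> hooks \<and> i \<le> LL u \<and> y = arcd ((u, i), b))"
proof -
  have "y \<in> arcd ` (arc_index \<times> UNIV) \<longleftrightarrow> (\<exists>u i b. u \<in> hooks \<and> i \<le> LL u \<and> y = arcd ((u, i), b))"
    unfolding arc_index_def by blast
  then show ?thesis using glue_props(3)[of y] by simp
qed

lemma glue_tri_new:
  assumes "glue y \<noteq> y" "tri y = name s u i"
  shows "y = Dart (name s u i) None \<or> y = Dart (name s u i) (Some (rr u (int i)))"
proof -
  have "A y = y" using suppA name_fresh assms(2) by metis
  then obtain w j b where y: "w \<in> hooks" "j \<le> LL w" "y = arcd ((w, j), b)" using assms(1) glue_matched by blast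
  have F: "tri w \<in> V" "tri (vv w) \<in> V" using free_hook y by auto
  have "name s u i \<noteq> tri w" "name s u i \<noteq> tri (vv w)" using F name_fresh by metis+
  then show ?thesis using y assms(2)
    by (cases b; cases j) (auto simp: arcd_def split: if_splits)
qed

text \<open>The closed relator path: at the indices \<open>0\<close> to \<open>LL u\<close> it
  crosses the new edges, at \<open>- ll u\<close> to \<open>- 1\<close> the old edges of the
  hook.\<close>

definition yy :: "dart \<Rightarrow> int \<Rightarrow> dart" where
  "yy u = (SOME Y. orbit glue (rr u) Y \<and> Y 0 = u)"

lemma yy: "orbit glue (rr u) (yy u)" "yy u 0 = u"
  unfolding yy_def using someI_ex[OF orbit_exists[OF inv_glue, of "rr u" 0 u]] by auto

lemma yy_arc: assumes "u \<in> hooks" shows "i \<le> LL u \<Longrightarrow> yy u (int i) = arcd ((u, i), True)"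
proof (induction i)
  case (Suc i)
  then have "yy u (int i + 1) = rot (rr u (int i)) (arcd ((u, i), False))"
    using orbitD[OF yy(1)[of u], of "int i"] glue_arcd[OF assms, of i True] by simp
  then show ?case using Suc.prems by (simp add: arcd_simps rot_None add.commute)
qed (simp add: yy arcd_simps)

lemma yy_old: assumes u: "u \<in> hooks" and i: "0 \<le> i" "i \<le> int (ll u)" shows "yy u (- i) = xx u (- i)"
proof -
  have X: "orbit A (rr u) (xx u)" "xx u 0 = u" "\<And>i. 1 \<le> i \<Longrightarrow> i \<le> int (ll u) \<Longrightarrow> A (xx u (- i)) \<noteq> xx u (- i)"
    using hooksD[OF u] by (auto simp: hook_def)
  have "xx u (- i) = yy u (- i)"
  proof (rule orbit_transfer_back[OF X(1) yy(1) invA inv_glue, where c = 0 and d = "- int (ll u)"])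
    fix j assume "- int (ll u) \<le> j" "j < 0"
    then show "glue (xx u j) = A (xx u j)" using glue_old[OF X(3)[of "- j"]] by simp
  qed (use i X yy in auto)
  then show ?thesis by simp
qed

text \<open>On coming out of the arc the orbit reaches \<open>vv u\<close>, and by periodicity of
  the reading it turns there by the sign with which the hook begins. So it meets the hook again
  exactly \<open>k\<close> steps after the index \<open>- ll u\<close>.\<close>

lemma yy_period: assumes u: "u \<in> hooks" shows "yy u (i + int k) = yy u i"
proof -
  have H: "rr u \<in> Rp" "orbit A (rr u) (xx u)" "A (vv u) = vv u"
    using hooksD[OF u] free_hook[OF u] by (auto simp: hook_def)
  have L: "int (LL u) = - int (ll u) - 1 + int k" using LL_bounds[OF u] by simp
  have "yy u (int (LL u) + 1) = rot (rr u (int (LL u))) (vv u)"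
    using orbitD[OF yy(1)[of u], of "int (LL u)"] yy_arc[OF u, of "LL u"] glue_arcd[OF u, of "LL u" True]
    by (simp add: arcd_simps)
  also have "rr u (int (LL u)) = rr u (- int (ll u) - 1)"
    unfolding L by (rule period[OF H(1)])
  also have "rot (rr u (- int (ll u) - 1)) (vv u) = xx u (- int (ll u))"
    using orbitD[OF H(2), of "- int (ll u) - 1"] H(3) by (simp add: vv_def)
  also have "\<dots> = yy u (- int (ll u))" using yy_old[OF u] by simp
  finally have e: "yy u (- int (ll u) + int k) = yy u (- int (ll u))" using L by (simp add: algebra_simps)
  have "rshift (int k) (rr u) = rr u" using period[OF H(1)] by (auto simp: rshift_def)
  then have "orbit glue (rr u) (\<lambda>i. yy u (i + int k))" using orbit_shift[OF yy(1)[of u], of "int k"] by simp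
  from orbit_unique[OF this yy(1) inv_glue, of "- int (ll u)"] e show ?thesis by metis
qed

lemma yy_matched_old: assumes u: "u \<in> hooks" and i: "- int (ll u) \<le> i" "i < 0" shows "A (yy u i) \<noteq> yy u i"
  using hooksD[OF u] yy_old[OF u, of "- i"] i by (auto simp: hook_def dest: spec[of _ "- i"])

lemma yy_matched: assumes u: "u \<in> hooks" shows "glue (yy u i) \<noteq> yy u i"
proof -
  let ?j = "- int (ll u) + (i - - int (ll u)) mod int k"
  have k: "k > 0" using k_large by simp
  have "0 \<le> (i - - int (ll u)) mod int k" "(i - - int (ll u)) mod int k < int k" using k by auto
  then have j: "- int (ll u) \<le> ?j" "?j \<le> int (LL u)" using LL_bounds[OF u] by linarith+
  have "glue (yy u ?j) \<noteq> yy u ?j"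
  proof (cases "?j < 0")
    case True
    then show ?thesis using yy_matched_old[OF u j(1)] glue_matched by blast
  next
    case False
    then have "yy u ?j = arcd ((u, nat ?j), True)" using yy_arc[OF u, of "nat ?j"] j by simp
    moreover have "nat ?j \<le> LL u" using False j by linarith
    ultimately show ?thesis using glue_matched u by blast
  qed
  then show ?thesis using periodic_mod[where f = "yy u", OF yy_period[OF u] k, of i "- int (ll u)"] by simp
qed

lemma closed_yy: "u \<in> hooks \<Longrightarrow> closed_orbit glue (yy u)"
  using yy_period yy_matched by (simp add: closed_orbit_def)

text \<open>The same arc in the other direction; \<open>arc_rev\<close> asks for both.\<close>

definition zz :: "dart \<Rightarrow> int \<Rightarrow> dart" where
  "zz u = (\<lambda>j. glue (yy u (int (LL u) - j)))"

definition arc_set :: "((int \<Rightarrow> dart) \<times> nat) set" where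
  "arc_set = (\<lambda>u. (yy u, LL u)) ` hooks \<union> (\<lambda>u. (zz u, LL u)) ` hooks"

lemma zz_arc: "u \<in> hooks \<Longrightarrow> j \<le> LL u \<Longrightarrow> zz u (int j) = arcd ((u, LL u - j), False)"
  using yy_arc[of u "LL u - j"] glue_arcd[of u "LL u - j" True] by (simp add: zz_def of_nat_diff)

lemma zz_zz: "(\<lambda>j. glue (zz u (int (LL u) - j))) = yy u"
  by (simp add: zz_def)

lemma yy_tri: "u \<in> hooks \<Longrightarrow> 0 < i \<Longrightarrow> i \<le> int (LL u) \<Longrightarrow> yy u i = Dart (name s u (nat (i - 1))) (Some (rr u (i - 1)))"
proof -
  assume u: "u \<in> hooks" and i: "0 < i" "i \<le> int (LL u)"
  obtain n where "i = int (Suc n)" using i by (metis zero_less_imp_eq_int gr0_implies_Suc)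
  then show ?thesis using yy_arc[OF u, of "Suc n"] i by (simp add: arcd_simps)
qed

lemma zz_tri: "u \<in> hooks \<Longrightarrow> 0 < i \<Longrightarrow> i \<le> int (LL u) \<Longrightarrow> zz u i = Dart (name s u (nat (int (LL u) - i))) None"
  using zz_arc[of u "nat i"] by (auto simp: arcd_def nat_diff_distrib)

lemma arc_extension_glue: "arc_extension Rp k D A glue V arc_set"
proof unfold_locales
  show "invol A" "invol glue" by (fact invA inv_glue)+
  show "A x \<noteq> x \<Longrightarrow> glue x = A x" "A x \<noteq> x \<Longrightarrow> tri x \<in> V" for x using glue_old suppA by blast+
next
  fix y assume "glue y \<noteq> y" "A y = y"
  then obtain u i b where y: "u \<in> hooks" "i \<le> LL u" "y = arcd ((u, i), b)" using glue_matched by blast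
  show "\<exists>Y L i. (Y, L) \<in> arc_set \<and> 0 \<le> i \<and> i \<le> int L \<and> y = Y i"
  proof (cases b)
    case True
    then have "y = yy u (int i)" using yy_arc y by simp
    then show ?thesis using y by (intro exI[of _ "yy u"] exI[of _ "LL u"] exI[of _ "int i"]) (auto simp: arc_set_def)
  next
    case False
    then have "y = zz u (int (LL u - i))" using zz_arc[of u "LL u - i"] y by simp
    then show ?thesis using y by (intro exI[of _ "zz u"] exI[of _ "LL u"] exI[of _ "int (LL u - i)"]) (auto simp: arc_set_def)
  qed
next
  fix Y L assume "(Y, L) \<in> arc_set"
  then obtain u where u: "u \<in> hooks" "L = LL u" and Y: "Y = yy u \<or> Y = zz u" by (auto simp: arc_set_def)
  note b = LL_bounds[OF u(1)]
  have r: "rr u \<in> R" using hooksD[OF u(1)] by blast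
  show "\<exists>\<rho>\<in>R. orbit glue \<rho> Y"
    using Y yy(1)[of u] r orbit_inv[OF yy(1)[of u] inv_glue, of "int (LL u)"] rinv_R[OF rshift_R[OF r]]
    unfolding zz_def by blast
  show "Y (i + int k) = Y i" for i
    using Y yy_period[OF u(1), of i] yy_period[OF u(1), of "int (LL u) - i - int k"]
    by (auto simp: zz_def algebra_simps)
  show "glue (Y i) \<noteq> Y i" for i
    using Y yy_matched[OF u(1), of i] yy_matched[OF u(1), of "int (LL u) - i"] by (auto simp: zz_def eq_commute)
  show "L < k \<and> k < L + 1 + 6 * D" using b u by simp
  show "A (Y i) \<noteq> Y i" if i: "int L < i" "i < int k" for i
  proof (cases "Y = yy u")
    case True
    have "yy u i = yy u (i - int k)" using yy_period[OF u(1), of "i - int k"] by simp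
    then show ?thesis using yy_matched_old[OF u(1), of "i - int k"] i b u True by simp
  next
    case False
    have "A (yy u (int L - i)) \<noteq> yy u (int L - i)"
      using yy_matched_old[OF u(1), of "int L - i"] i b u by simp
    then show ?thesis using False Y glue_old u by (simp add: zz_def)
  qed
  show "(\<lambda>j. glue (Y (int L - j)), L) \<in> arc_set"
    using Y u zz_zz[of u] by (auto simp: arc_set_def zz_def)
  show "tri (Y 0) \<in> V"
    using Y free_hook[OF u(1)] yy(2)[of u] zz_arc[OF u(1), of 0] by (auto simp: arcd_simps)
  show "tri (Y i) \<notin> V" if "0 < i" "i \<le> int L" for i
    using Y yy_tri[OF u(1), of i] zz_tri[OF u(1), of i] that u by auto
  show "i = j" if "0 < i" "i \<le> int L" "0 < j" "j \<le> int L" "tri (Y i) = tri (Y j)" for i j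
    using Y yy_tri[OF u(1), of i] zz_tri[OF u(1), of i] yy_tri[OF u(1), of j] zz_tri[OF u(1), of j] that u by auto
  show "y = Y (i + 1)" if i: "0 \<le> i" "i < int L" and y: "glue y \<noteq> y" "tri y = tri (glue (Y i))" "y \<noteq> glue (Y i)" for i y
  proof (cases "Y = yy u")
    case True
    have g: "glue (Y i) = Dart (name s u (nat i)) None"
      using True yy_arc[OF u(1), of "nat i"] glue_arcd[OF u(1), of "nat i" True] i u by (auto simp: arcd_simps)
    have "Y (i + 1) = Dart (name s u (nat i)) (Some (rr u i))"
      using True yy_tri[OF u(1), of "i + 1"] i u by simp
    then show ?thesis using glue_tri_new[OF y(1), of u "nat i"] y g i by auto
  next
    case False
    let ?n = "nat (int L - i - 1)"
    have g: "glue (Y i) = Dart (name s u ?n) (Some (rr u (int ?n)))"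
      using False Y yy_tri[OF u(1), of "int L - i"] i u by (simp add: zz_def)
    have "Y (i + 1) = Dart (name s u ?n) None"
      using False Y zz_tri[OF u(1), of "i + 1"] i u by (simp add: algebra_simps)
    then show ?thesis using glue_tri_new[OF y(1), of u ?n] y g i by auto
  qed
qed

text \<open>Unless the orbit is already closed, \<open>persist\<close> bounds the matched run around
  0 on both sides. The maximal run ends at the free darts at \<open>f\<close> and
  \<open>f - 1 - l\<close>, so it is a hook at \<open>X (int f)\<close>, and the orbit that closes
  this hook passes through \<open>X 0\<close>.\<close>

lemma glued_positive:
  assumes \<rho>: "\<rho> \<in> Rp" and X: "orbit A \<rho> X" and m: "\<And>i. 0 \<le> i \<Longrightarrow> i < 2 * int D \<Longrightarrow> A (X i) \<noteq> X i"
  shows "\<exists>Y. orbit glue \<rho> Y \<and> Y 0 = X 0 \<and> closed_orbit glue Y"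
proof (cases "closed_orbit A X")
  case True
  then show ?thesis using orbit_ext[OF glue_old X] by blast
next
  case False
  have \<rho>R: "\<rho> \<in> R" using \<rho> by blast
  define f where "f = (LEAST n. A (X (int n)) = X (int n))"
  have "\<exists>n. A (X (int n)) = X (int n)"
    using persist_at[OF ps \<rho>R X, of 0] False by (metis nonneg_int_cases)
  then have f: "A (X (int f)) = X (int f)" unfolding f_def by (rule LeastI_ex)
  have fm: "A (X i) \<noteq> X i" if "0 \<le> i" "i < int f" for i
    using not_less_Least[of "nat i" "\<lambda>n. A (X (int n)) = X (int n)"] that unfolding f_def by auto
  have fD: "2 * D \<le> f" using f m[of "int f"] by (cases "2 * D \<le> f") auto
  define l where "l = (LEAST n. A (X (int f - 1 - int n)) = X (int f - 1 - int n))"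
  have "\<exists>n. A (X (int f - 1 - int n)) = X (int f - 1 - int n)"
  proof (rule ccontr)
    assume n: "\<not> ?thesis"
    have "A (X i) \<noteq> X i" if "i < int f" for i
      using n[simplified, rule_format, of "nat (int f - 1 - i)"] that by simp
    then show False using persist_at[OF ps \<rho>R X, of "int f - int (6 * D)"] False by simp
  qed
  then have l: "A (X (int f - 1 - int l)) = X (int f - 1 - int l)" unfolding l_def by (rule LeastI_ex)
  have lm: "A (X (int f - i)) \<noteq> X (int f - i)" if "1 \<le> i" "i \<le> int l" for i
    using not_less_Least[of "nat (i - 1)" "\<lambda>n. A (X (int f - 1 - int n)) = X (int f - 1 - int n)"] that unfolding l_def by auto
  have fl: "f \<le> l" using fm[of "int f - 1 - int l"] l by (cases "f \<le> l") auto
  have "A (A (X (int f - 1))) \<noteq> A (X (int f - 1))" using fm[of "int f - 1"] fD D_pos by auto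
  then have "tri (A (X (int f - 1))) \<in> V" using suppA by blast
  then have "tri (X (int f)) \<in> V" using orbitD[OF X, of "int f - 1"] by simp
  then have free: "X (int f) \<in> free_darts A V" using f by (simp add: free_darts_def)
  have e: "- int l - 1 + int f = int f - 1 - int l" "\<And>i. - i + int f = int f - i" by simp_all
  have "hook (X (int f)) (rshift (int f) \<rho>) (\<lambda>i. X (i + int f)) l"
    unfolding hook_def e using rshift_R[OF \<rho>R] orbit_shift[OF X] free l lm fl fD by simp
  note h = hooksI[OF rshift_Rp[OF \<rho>] this]
  let ?Y = "\<lambda>i. yy (X (int f)) (i + - int f)"
  have "orbit glue (rshift (- int f) (rshift (int f) \<rho>)) ?Y"
    using orbit_shift[OF yy(1)[of "X (int f)"]] h by metis
  moreover have "?Y 0 = X 0" using yy_old[OF h(1), of "int f"] h fl by simp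
  moreover have "closed_orbit glue ?Y" using closed_yy[OF h(1)] by (simp only: closed_orbit_shift)
  ultimately show ?thesis by auto
qed

text \<open>A negative reading becomes positive in reverse; reversing around
  \<open>?c = 2 * int D - 1\<close> maps the window of \<open>2 * D\<close> darts to itself.\<close>

lemma glued:
  assumes \<rho>: "\<rho> \<in> R" and X: "orbit A \<rho> X" and m: "\<And>i. 0 \<le> i \<Longrightarrow> i < 2 * int D \<Longrightarrow> A (X i) \<noteq> X i"
  shows "\<exists>Y i. orbit glue \<rho> Y \<and> 0 \<le> i \<and> i < 2 * int D \<and> Y i = X i \<and> closed_orbit glue Y"
proof (cases "\<rho> \<in> Rp")
  case True
  then show ?thesis using glued_positive[OF True X m] D_pos by fastforce
next
  case False
  then have r: "rinv \<rho> \<in> Rp" using \<rho> by auto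
  let ?c = "2 * int D - 1"
  let ?\<sigma> = "rinv (rshift ?c \<rho>)"
  have s: "?\<sigma> \<in> Rp" using rshift_Rp[OF r, of "- ?c"] by (simp add: rshift_rinv)
  have "A (A (X (?c - i))) \<noteq> A (X (?c - i))" if "0 \<le> i" "i < 2 * int D" for i
    using m[of "?c - i"] that by auto
  then obtain Y where Y: "orbit glue ?\<sigma> Y" "Y 0 = A (X ?c)" "closed_orbit glue Y"
    using glued_positive[OF s orbit_inv[OF X invA]] by force
  have "orbit glue (rinv (rshift ?c ?\<sigma>)) (\<lambda>j. glue (Y (?c - j)))" by (rule orbit_inv[OF Y(1) inv_glue])
  moreover have "rinv (rshift ?c ?\<sigma>) = \<rho>" by (simp add: rshift_rinv)
  moreover have "glue (Y (?c - ?c)) = X ?c"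
    using Y(2) glue_old[of "A (X ?c)"] m[of ?c] D_pos by simp
  moreover have "closed_orbit glue (\<lambda>j. glue (Y (?c - j)))"
    unfolding closed_orbit_def
  proof safe
    fix i
    show "glue (glue (Y (?c - i))) = glue (Y (?c - i)) \<Longrightarrow> False"
      using Y(3) by (simp add: closed_orbit_def) metis
    show "glue (Y (?c - (i + int k))) = glue (Y (?c - i))"
      using Y(3)[unfolded closed_orbit_def, rule_format, of "?c - i - int k"] by (simp add: algebra_simps)
  qed
  ultimately show ?thesis using D_pos
    by (intro exI[of _ "\<lambda>j. glue (Y (?c - j))"] exI[of _ ?c]) simp
qed

interpretation arc_extension Rp k D A glue V arc_set
  by (rule arc_extension_glue)

lemma persist_glue: "persist glue (4 * D)"
  by (rule persist_extension) (rule glued)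

lemma stage_glue: "stage glue glue_tris (Suc s)"
  unfolding stage_def
proof (intro conjI allI impI ballI)
  fix x assume "glue x \<noteq> x"
  then consider "A x \<noteq> x" | u i b where "u \<in> hooks" "i \<le> LL u" "x = arcd ((u, i), b)" using glue_matched by blast
  then show "tri x \<in> glue_tris"
  proof cases
    case 2
    then show ?thesis using free_hook[of u] by (cases b; cases i) (auto simp: arcd_def glue_tris_def)
  qed (auto simp: glue_tris_def dest: suppA)
next
  fix v assume "v \<in> glue_tris"
  then show "fst v < Suc s" using freshV[of v] by (auto simp: glue_tris_def)
qed (auto intro: inv_glue greendlinger_extension GA)

end
end

section \<open>The limit graph\<close>

fun walk :: "(dart \<Rightarrow> dart) \<Rightarrow> dart \<Rightarrow> bool list \<Rightarrow> dart" where
  "walk A x [] = x"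
| "walk A x (e # es) = walk A (rot e (A x)) es"

fun darts :: "(dart \<Rightarrow> dart) \<Rightarrow> dart \<Rightarrow> bool list \<Rightarrow> dart list" where
  "darts A x [] = []"
| "darts A x (e # es) = x # darts A (rot e (A x)) es"

lemma walk_append: "walk A x (e @ f) = walk A (walk A x e) f"
  by (induction e arbitrary: x) auto

lemma length_darts [simp]: "length (darts A x e) = length e"
  by (induction e arbitrary: x) auto

lemma nth_darts: "i < length e \<Longrightarrow> darts A x e ! i = walk A x (take i e)"
  by (induction e arbitrary: x i) (auto simp: nth_Cons take_Cons split: nat.split)

lemma walk_take_Suc: "i < length e \<Longrightarrow> walk A x (take (Suc i) e) = rot (e ! i) (A (walk A x (take i e)))"
  by (simp add: take_Suc_conv_app_nth walk_append)

lemma walk_orbit: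
  assumes "orbit A \<rho> X"
  shows "walk A (X c) (map (\<lambda>i. \<rho> (c + int i)) [0..<n]) = X (c + int n)"
proof (induction n)
  case (Suc n)
  then show ?case using orbitD[OF assms, of "c + int n"] by (simp add: walk_append algebra_simps)
qed simp

context small_cancel
begin

text \<open>The \<open>D\<close> sproutings that precede a glueing separate the free darts, which makes hooks unique and
  keeps the glued arcs apart.\<close>

primrec tower :: "nat \<Rightarrow> (dart \<Rightarrow> dart) \<times> (nat \<times> nat) set" where
  "tower 0 = (id, {(0, 0)})"
| "tower (Suc n) = (let (A, V) = tower n in
     if n mod (D + 1) = D then (glue A V (Suc n), glue_tris A V (Suc n))
     else (sprout A V (Suc n), sprout_tris A V (Suc n)))"

abbreviation "T n \<equiv> fst (tower n)"
abbreviation "U n \<equiv> snd (tower n)"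

lemma persist_mono: "persist A n \<Longrightarrow> n \<le> n' \<Longrightarrow> persist A n'"
  unfolding persist_def by fastforce

lemma tails_0: "tails A V 0"
  unfolding tails_def by (metis neg_0_equal_iff_equal of_nat_0 order_antisym)

text \<open>A period consists of \<open>D\<close> sproutings and one glueing. After the sproutings
  \<open>tails\<close> has reached \<open>D\<close> and \<open>persist\<close> has grown to
  \<open>4 * D + 2 * D\<close>, just what the glueing requires; it resets both counters.\<close>

lemma tower_invariant:
  "stage (T n) (U n) (Suc n) \<and> tails (T n) (U n) (n mod (D + 1)) \<and> persist (T n) (4 * D + 2 * (n mod (D + 1)))"
proof (induction n)
  case 0
  have e: "path id p \<longleftrightarrow> p = []" for p by (auto simp: path_def)
  have "greendlinger id" unfolding greendlinger_def joins_def e by auto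
  then have "stage id {(0, 0)} (Suc 0)" by (simp add: stage_def invol_def)
  \<comment> \<open>Nothing is matched by \<open>id\<close>, and the window is nonempty because
    \<open>D\<close> is positive.\<close>
  moreover have "persist id (4 * D)" using D_pos by (auto simp: persist_def intro!: exI[of _ 0])
  moreover have "tower 0 = (id, {(0, 0)})" "0 mod (D + 1) = 0" by simp_all
  ultimately show ?case using tails_0 by (simp only: fst_conv snd_conv mult_0_right add_0_right)
next
  case (Suc n)
  obtain A V where AV: "tower n = (A, V)" by (cases "tower n")
  have IH: "stage A V (Suc n)" "tails A V (n mod (D + 1))" "persist A (4 * D + 2 * (n mod (D + 1)))"
    using Suc by (simp_all add: AV)
  show ?case
  proof (cases "n mod (D + 1) = D")
    case True
    then have m: "Suc n mod (D + 1) = 0" by (simp add: mod_Suc)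
    have p: "persist A (6 * D)" using IH(3) True by simp
    have t: "tails A V D" using IH(2) True by simp
    then show ?thesis
      using stage_glue[OF IH(1) t p] persist_glue[OF IH(1) t p] tails_0 True unfolding m by (simp add: AV)
  next
    case False
    then have m: "Suc n mod (D + 1) = Suc (n mod (D + 1))" by (simp add: mod_Suc)
    show ?thesis
      using stage_sprout[OF IH(1) refl refl] persist_sprout[OF IH(1) refl refl IH(3)] tails_sprout[OF IH(1) refl refl IH(2)] False
      unfolding m by (simp add: AV)
  qed
qed

lemma tower_stage: "stage (T n) (U n) (Suc n)"
  and tower_tails: "n mod (D + 1) = D \<Longrightarrow> tails (T n) (U n) D"
  and tower_persist: "persist (T n) (6 * D)"
proof -
  have "n mod (D + 1) \<le> D" using mod_less_divisor[of "D + 1" n] by linarith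
  then show "persist (T n) (6 * D)" using tower_invariant[of n] persist_mono by force
qed (use tower_invariant[of n] in auto)

lemma tower_step: "T n x \<noteq> x \<Longrightarrow> T (Suc n) x = T n x"
  using glue_old[OF tower_stage[of n] tower_tails tower_persist, where x = x] extA'[OF tower_stage[of n] refl refl, where x = x]
  by (auto simp: case_prod_unfold Let_def)

lemma tower_tris: "U n \<subseteq> U (Suc n)"
  using glue_tris_def[OF tower_stage tower_tails tower_persist, of n]
  by (auto simp: case_prod_unfold Let_def sprout_tris_def)

lemma tower_mono: assumes "T n x \<noteq> x" "n \<le> m" shows "T m x = T n x"
  using assms(2)
proof (induction m rule: dec_induct)
  case (step m)
  then show ?case using tower_step[of m x] assms(1) by simp
qed simp

lemma tower_tris_mono: "n \<le> m \<Longrightarrow> U n \<subseteq> U m"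
  by (rule lift_Suc_mono_le) (rule tower_tris)

lemma tower_complete: assumes "tri x \<in> U n" shows "\<exists>m. T m x \<noteq> x"
proof -
  obtain m where m: "n \<le> m" "m mod (D + 1) \<noteq> D"
  proof (cases "n mod (D + 1) = D")
    case True
    then have "Suc n mod (D + 1) \<noteq> D" using D_pos by (simp add: mod_Suc)
    then show ?thesis using that[of "Suc n"] by simp
  qed (use that in blast)
  have "tri x \<in> U m" using assms tower_tris_mono m by blast
  then have "sprout (T m) (U m) (Suc m) x \<noteq> x" using V_matched[OF tower_stage refl refl] by blast
  then have "T (Suc m) x \<noteq> x" using m by (simp add: case_prod_unfold Let_def)
  then show ?thesis by blast
qed

definition limA :: "dart \<Rightarrow> dart" where
  "limA x = (if \<exists>n. T n x \<noteq> x then T (SOME n. T n x \<noteq> x) x else x)"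

lemma limA: assumes "T n x \<noteq> x" shows "limA x = T n x"
proof -
  have "T (SOME n. T n x \<noteq> x) x \<noteq> x" by (rule someI) (rule assms)
  then have "T (SOME n. T n x \<noteq> x) x = T n x"
    using tower_mono[OF assms] tower_mono[of "SOME n. T n x \<noteq> x" x n] by (metis nle_le)
  then show ?thesis using assms by (auto simp: limA_def)
qed

lemma limA_matched: "limA x \<noteq> x \<longleftrightarrow> (\<exists>n. T n x \<noteq> x)"
  using limA by (metis limA_def)

lemma finite_stage:
  assumes "finite S" "\<And>x. x \<in> S \<Longrightarrow> limA x \<noteq> x"
  shows "\<exists>n. \<forall>x\<in>S. T n x \<noteq> x"
  using assms
proof (induction S rule: finite_induct)
  case (insert x S)
  then obtain n where n: "\<forall>x\<in>S. T n x \<noteq> x" by auto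
  obtain m where m: "T m x \<noteq> x" using insert.prems limA_matched by auto
  have "T (max n m) y \<noteq> y" if "y \<in> insert x S" for y
  proof (cases "y = x")
    case True
    then show ?thesis using tower_mono[OF m, of "max n m"] m by simp
  next
    case False
    then have "T n y \<noteq> y" using n that by blast
    then show ?thesis using tower_mono[of n y "max n m"] by simp
  qed
  then show ?case by blast
qed simp

lemma invol_limA: "invol limA"
  unfolding invol_def
proof
  fix x show "limA (limA x) = x"
  proof (cases "limA x = x")
    case False
    then obtain n where n: "T n x \<noteq> x" using limA_matched by blast
    have "T n (T n x) = x" using tower_stage[of n] by (simp add: stage_def invol_def)
    then show ?thesis using limA[OF n] limA[of n "T n x"] n by simp
  qed simp
qed

definition limV :: "(nat \<times> nat) set" where "limV = (\<Union>n. U n)"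

lemma limV_matched: "tri x \<in> limV \<Longrightarrow> limA x \<noteq> x"
  using tower_complete limA_matched unfolding limV_def by blast

lemma limV_closed: assumes "tri x \<in> limV" shows "tri (limA x) \<in> limV"
proof -
  obtain n where n: "T n x \<noteq> x" using limV_matched[OF assms] limA_matched by blast
  have "T n (T n x) \<noteq> T n x" using n tower_stage[of n] by (metis stage_def invol_def)
  then have "tri (T n x) \<in> U n" using tower_stage[of n] by (simp add: stage_def)
  then show ?thesis unfolding limA[OF n] limV_def by blast
qed

lemma greendlinger_limA: "greendlinger limA"
  unfolding greendlinger_def
proof (intro allI impI)
  fix \<alpha> \<beta> t t'
  assume a: "relp limA \<alpha>" "length \<alpha> < 6 * D" "joins limA \<alpha> t t'" "joins limA \<beta> t t'" "\<alpha> \<noteq> \<beta>"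
  have "limA x \<noteq> x" if "x \<in> set \<alpha> \<union> set \<beta>" for x using a that by (auto simp: joins_def path_def)
  then obtain n where n: "\<And>x. x \<in> set \<alpha> \<union> set \<beta> \<Longrightarrow> T n x \<noteq> x"
    using finite_stage[of "set \<alpha> \<union> set \<beta>"] by blast
  have "relp (T n) \<alpha>" by (rule relp_cut[OF limA a(1)]) (use n in auto)
  moreover have "joins (T n) \<alpha> t t'" by (rule joins_cut[OF limA a(3)]) (use n in auto)
  moreover have "joins (T n) \<beta> t t'" by (rule joins_cut[OF limA a(4)]) (use n in auto)
  ultimately have "big (T n) \<beta>"
    using tower_stage[of n] a(2,5) unfolding stage_def greendlinger_def by blast
  then show "big limA \<beta>" using big_mono[where A = "T n" and B = limA] limA by blast
qed

lemma orbit_limV: assumes "orbit limA \<rho> X" "tri (X 0) \<in> limV" shows "tri (X (int i)) \<in> limV"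
proof (induction i)
  case (Suc i)
  then show ?case using orbitD[OF assms(1), of "int i"] limV_closed by (simp add: add.commute)
qed (use assms in simp)

text \<open>In the limit every dart is matched, so the first \<open>k + 1\<close> darts of the orbit
  are matched at some finite stage; as \<open>k\<close> exceeds \<open>6 * D\<close>,
  \<open>persist\<close> closes the orbit already there.\<close>

lemma relator_closes:
  assumes \<rho>: "\<rho> \<in> R" and X: "orbit limA \<rho> X" "tri (X 0) \<in> limV"
  shows "X (int k) = X 0"
proof -
  let ?S = "(\<lambda>i. X (int i)) ` {..k}"
  have "limA x \<noteq> x" if "x \<in> ?S" for x using that orbit_limV[OF X] limV_matched by auto
  then obtain n where n: "\<forall>x\<in>?S. T n x \<noteq> x" using finite_stage[of ?S] by blast
  have inv: "invol (T n)" using tower_stage by (simp add: stage_def)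
  obtain W where W: "orbit (T n) \<rho> W" "W 0 = X 0" using orbit_exists[OF inv] by blast
  have nm: "T n (X i) \<noteq> X i" if "0 \<le> i" "i \<le> int k" for i
    using n[rule_format, of "X i"] that image_eqI[of "X i" "\<lambda>i. X (int i)" "nat i" "{..k}"] by simp
  have eq: "X i = W i" if "0 \<le> i" "i \<le> int k" for i
    by (rule orbit_transfer[OF X(1) W(1) W(2)[symmetric], of "int k"]) (use that nm limA in auto)
  have "closed_orbit (T n) W"
    by (rule persist_at[OF tower_persist \<rho> W(1), of 0]) (use eq nm k_large in auto)
  then show ?thesis using eq[of 0] eq[of "int k"] by (simp add: closed_orbit_def) (metis add_0)
qed

lemma darts_path:
  assumes "tri x \<in> limV"
  shows "joins limA (darts limA x e) (tri x) (tri (walk limA x e))"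
proof -
  have w: "tri (walk limA x (take i e)) \<in> limV" for i
  proof (induction i)
    case (Suc i)
    then show ?case using walk_take_Suc[of i e limA x] limV_closed by (cases "i < length e") auto
  qed (use assms in simp)
  have "path limA (darts limA x e)"
    unfolding path_nth using w limV_matched by (auto simp: nth_darts walk_take_Suc)
  moreover have "tri (limA (last (darts limA x e))) = tri (walk limA x e)" if "e \<noteq> []"
  proof -
    have "last (darts limA x e) = walk limA x (take (length e - 1) e)"
      using that by (simp add: last_conv_nth nth_darts flip: length_greater_0_conv)
    moreover have "walk limA x e = rot (e ! (length e - 1)) (limA (walk limA x (take (length e - 1) e)))"
      using walk_take_Suc[of "length e - 1" e limA x] that by simp
    ultimately show ?thesis by simp
  qed
  moreover have "tri (hd (darts limA x e)) = tri x" "darts limA x e = [] \<longleftrightarrow> e = []" if "e \<noteq> []"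
    using that by (cases e; simp)+
  ultimately show ?thesis unfolding joins_def by (cases "e = []") auto
qed

text \<open>The only fact about the construction that the algebra below uses. The last clause starts
  from a return to the triangle, not to the dart, which later permits a trailing power of
  \<open>b\<close>; it is the invariant with an empty \<alpha>.\<close>

theorem windmill:
  "\<exists>A x V. invol A \<and> tri x \<in> V \<and> (\<forall>y. tri y \<in> V \<longrightarrow> tri (A y) \<in> V) \<and>
     (\<forall>\<rho>\<in>R. \<forall>y. tri y \<in> V \<longrightarrow> walk A y (map (\<lambda>i. \<rho> (int i)) [0..<k]) = y) \<and>
     (\<forall>y e. tri y \<in> V \<longrightarrow> e \<noteq> [] \<longrightarrow> tri (walk A y e) = tri y \<longrightarrow>
        (\<exists>j. \<exists>\<rho>\<in>R. j + q \<le> length e \<and> (\<forall>i<q - 1. e ! (j + i) = \<rho> (int i))))"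
proof (rule exI[of _ limA], rule exI[of _ "Dart (0, 0) None"], rule exI[of _ limV], intro conjI ballI allI impI)
  show "invol limA" by (rule invol_limA)
  show "tri (Dart (0, 0) None) \<in> limV" unfolding limV_def by (rule UN_I[of 0]) auto
  show "tri y \<in> limV \<Longrightarrow> tri (limA y) \<in> limV" for y by (rule limV_closed)
next
  fix \<rho> y assume "\<rho> \<in> R" "tri y \<in> limV"
  then obtain X where X: "orbit limA \<rho> X" "X 0 = y" using orbit_exists[OF invol_limA] by blast
  show "walk limA y (map (\<lambda>i. \<rho> (int i)) [0..<k]) = y"
    using walk_orbit[OF X(1), of 0 k] relator_closes[OF \<open>\<rho> \<in> R\<close> X(1)] X(2) \<open>tri y \<in> limV\<close> by simp
next
  fix y e assume y: "tri y \<in> limV" "e \<noteq> []" "tri (walk limA y e) = tri y"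
  let ?p = "darts limA y e"
  have "?p \<noteq> []" using y by (cases e) auto
  moreover have "joins limA [] (tri y) (tri y)" by (simp add: joins_def)
  moreover have "joins limA ?p (tri y) (tri y)" using darts_path[OF y(1), of e] y by simp
  ultimately have "big limA ?p"
    using greendlinger_limA[unfolded greendlinger_def, rule_format, of "[]" "tri y" "tri y" ?p] D_pos by simp
  then obtain xs ys zs where p: "?p = xs @ ys @ zs" "length ys = q" "relp limA ys" by (auto simp: big_def)
  then obtain \<rho> where \<rho>: "\<rho> \<in> R" "\<And>i. Suc i < q \<Longrightarrow> ys ! Suc i = rot (\<rho> (int i)) (limA (ys ! i))"
    by (auto simp: relp_def)
  have len: "length xs + q + length zs = length e" using arg_cong[OF p(1), of length] p(2) by simp
  have ys: "ys ! i = walk limA y (take (length xs + i) e)" if "i < q" for i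
    using nth_darts[of "length xs + i" e limA y] that len p(2) by (simp add: p(1) nth_append)
  have "e ! (length xs + i) = \<rho> (int i)" if "i < q - 1" for i
    using \<rho>(2)[of i] ys[of i] ys[of "Suc i"] walk_take_Suc[of "length xs + i" e limA y] that len by simp
  then show "\<exists>j. \<exists>\<rho>\<in>R. j + q \<le> length e \<and> (\<forall>i<q - 1. e ! (j + i) = \<rho> (int i))"
    using \<rho>(1) len by (intro exI[of _ "length xs"] bexI[of _ \<rho>]) auto
qed

end

section \<open>Words in quotients of the modular group\<close>

abbreviation "FM \<equiv> free_group (UNIV :: modular_gen set)"
abbreviation "N0 \<equiv> normal_closure FM (free_reduce ` modular_relators)"

lemma FM_carrier: "free_reduce w \<in> carrier FM"
  by (simp add: free_group_def words_over_def)

lemma FM_mult: "free_reduce u \<otimes>\<^bsub>FM\<^esub> free_reduce v = free_reduce (u @ v)"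
  by (simp add: free_group_def free_reduce_append_left free_reduce_append_right)

lemma FM_one: "\<one>\<^bsub>FM\<^esub> = []" by (simp add: free_group_def)

lemma FM_repr: "x \<in> carrier FM \<Longrightarrow> free_reduce x = x"
  by (simp add: free_group_def free_reduce_id)

lemma normal_closure_subset: "R \<subseteq> normal_closure G R"
  by (auto simp: normal_closure_def)

lemma normal_closure_minimal: "K \<lhd> G \<Longrightarrow> R \<subseteq> K \<Longrightarrow> normal_closure G R \<subseteq> K"
  by (auto simp: normal_closure_def)

lemma N0_normal: "N0 \<lhd> FM"
  by (rule group.normal_normal_closure[OF group_free_group]) (auto simp: FM_carrier)

abbreviation "N1 \<tau> \<equiv> normal_closure modular_group (modular_elem ` set \<tau>)"

lemma N1_normal: "N1 \<tau> \<lhd> modular_group"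
  by (rule group.normal_normal_closure[OF group_modular_group]) (auto simp: modular_elem_in_carrier)

lemma modular_group_eq: "modular_group = FM Mod N0"
  by (simp add: modular_group_def presented_group_def)

lemma image_normal:
  assumes "group_hom G H h" "h ` carrier G = carrier H" "K \<lhd> G"
  shows "h ` K \<lhd> H"
proof -
  interpret group_hom G H h by fact
  have K: "subgroup K G" using assms(3) by (rule normal_imp_subgroup)
  then have "subgroup (h ` K) H" by (rule subgroup_img_is_subgroup)
  then show ?thesis
  proof (rule H.normal_invI)
    fix x y assume "x \<in> carrier H" "y \<in> h ` K"
    then obtain g c where g: "g \<in> carrier G" "x = h g" and c: "c \<in> K" "y = h c" using assms(2) by blast
    have cG: "c \<in> carrier G" by (rule subgroup.mem_carrier[OF K c(1)])
    have "x \<otimes>\<^bsub>H\<^esub> y \<otimes>\<^bsub>H\<^esub> inv\<^bsub>H\<^esub> x = h (g \<otimes>\<^bsub>G\<^esub> c \<otimes>\<^bsub>G\<^esub> inv\<^bsub>G\<^esub> g)"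
      unfolding g(2) c(2) using g(1) cG by (simp only: hom_mult hom_inv G.m_closed G.inv_closed)
    then show "x \<otimes>\<^bsub>H\<^esub> y \<otimes>\<^bsub>H\<^esub> inv\<^bsub>H\<^esub> x \<in> h ` K"
      using normal.inv_op_closed2[OF assms(3) g(1) c(1)] by (rule image_eqI)
  qed
qed

lemma coset_hom: "N \<lhd> G \<Longrightarrow> group_hom G (G Mod N) (\<lambda>a. N #>\<^bsub>G\<^esub> a)"
  by (intro group_hom.intro group_hom_axioms.intro normal.factorgroup_is_group normal.r_coset_hom_Mod)
    (auto simp: normal_def)

text \<open>The group is a quotient of a quotient, so its elements are cosets of cosets; evaluating
  free words directly hides both levels.\<close>

definition gev :: "mword list \<Rightarrow> modular_gen word \<Rightarrow> modular_gen word set set" where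
  "gev \<tau> w = N1 \<tau> #>\<^bsub>modular_group\<^esub> (N0 #>\<^bsub>FM\<^esub> free_reduce w)"

lemma quotient_hom: "group_hom FM (quotient_group \<tau>) (\<lambda>x. N1 \<tau> #>\<^bsub>modular_group\<^esub> (N0 #>\<^bsub>FM\<^esub> x))"
proof -
  interpret f: group_hom FM modular_group "\<lambda>x. N0 #>\<^bsub>FM\<^esub> x"
    unfolding modular_group_eq by (rule coset_hom[OF N0_normal])
  interpret g: group_hom modular_group "quotient_group \<tau>" "\<lambda>x. N1 \<tau> #>\<^bsub>modular_group\<^esub> x"
    unfolding quotient_group_def by (rule coset_hom[OF N1_normal])
  show ?thesis by unfold_locales (auto simp: hom_def)
qed

lemma quotient_onto: "(\<lambda>x. N1 \<tau> #>\<^bsub>modular_group\<^esub> (N0 #>\<^bsub>FM\<^esub> x)) ` carrier FM = carrier (quotient_group \<tau>)"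
  unfolding quotient_group_def carrier_FactGroup[of modular_group] image_image[symmetric]
  by (simp add: modular_group_eq carrier_FactGroup)

lemma gev_append: "gev \<tau> (u @ v) = gev \<tau> u \<otimes>\<^bsub>quotient_group \<tau>\<^esub> gev \<tau> v"
proof -
  interpret group_hom FM "quotient_group \<tau>" "\<lambda>x. N1 \<tau> #>\<^bsub>modular_group\<^esub> (N0 #>\<^bsub>FM\<^esub> x)"
    by (rule quotient_hom)
  show ?thesis unfolding gev_def FM_mult[symmetric] by (rule hom_mult) (rule FM_carrier)+
qed

lemma gev_Nil [simp]: "gev \<tau> [] = \<one>\<^bsub>quotient_group \<tau>\<^esub>"
proof -
  interpret group_hom FM "quotient_group \<tau>" "\<lambda>x. N1 \<tau> #>\<^bsub>modular_group\<^esub> (N0 #>\<^bsub>FM\<^esub> x)"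
    by (rule quotient_hom)
  show ?thesis using hom_one by (simp add: gev_def FM_one free_reduce_def)
qed

lemma gev_closed: "gev \<tau> w \<in> carrier (quotient_group \<tau>)"
  unfolding gev_def quotient_onto[symmetric] by (rule imageI) (rule FM_carrier)

lemma gev_onto: "g \<in> carrier (quotient_group \<tau>) \<Longrightarrow> \<exists>w. g = gev \<tau> w"
proof -
  assume "g \<in> carrier (quotient_group \<tau>)"
  then obtain x where "x \<in> carrier FM" "g = N1 \<tau> #>\<^bsub>modular_group\<^esub> (N0 #>\<^bsub>FM\<^esub> x)"
    unfolding quotient_onto[symmetric] by (rule imageE)
  then have "g = gev \<tau> x" unfolding gev_def by (simp only: FM_repr)
  then show ?thesis by (rule exI)
qed

lemma gev_reduce: "gev \<tau> (free_reduce w) = gev \<tau> w"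
  by (simp add: gev_def free_reduce_id)

text \<open>The image of \<open>K\<close> in the modular group is normal and contains the relators,
  hence also \<open>N1 \<tau>\<close>. As \<open>K\<close> contains \<open>N0\<close>, pulling this
  image back to the free group gives nothing outside \<open>K\<close>.\<close>

lemma gev_trivial_imp:
  assumes "gev \<tau> w = \<one>\<^bsub>quotient_group \<tau>\<^esub>" "K \<lhd> FM" "free_reduce ` modular_relators \<subseteq> K"
    "\<And>r. r \<in> set \<tau> \<Longrightarrow> free_reduce (map letter_word r) \<in> K"
  shows "free_reduce w \<in> K"
proof -
  let ?h = "\<lambda>x. N0 #>\<^bsub>FM\<^esub> x"
  have hom: "group_hom FM modular_group ?h" unfolding modular_group_eq by (rule coset_hom[OF N0_normal])
  have onto: "?h ` carrier FM = carrier modular_group" by (simp add: modular_group_eq carrier_FactGroup)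
  have "?h ` K \<lhd> modular_group" by (rule image_normal[OF hom onto assms(2)])
  moreover have "modular_elem ` set \<tau> \<subseteq> ?h ` K"
    using assms(4) by (auto simp: modular_elem_def presented_elem_def)
  ultimately have N1K: "N1 \<tau> \<subseteq> ?h ` K" by (rule normal_closure_minimal)
  have hw: "?h (free_reduce w) \<in> carrier modular_group" using onto FM_carrier by blast
  have "N1 \<tau> #>\<^bsub>modular_group\<^esub> ?h (free_reduce w) = N1 \<tau>"
    using assms(1) by (simp add: gev_def quotient_group_def)
  then have "?h (free_reduce w) \<in> N1 \<tau>"
    by (rule group.coset_join1[OF group_modular_group _ hw normal_imp_subgroup[OF N1_normal]])
  then obtain x where x: "x \<in> K" "?h (free_reduce w) = ?h x" using N1K by blast
  have "free_reduce w \<in> ?h (free_reduce w)"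
    using group.rcos_self[OF group_free_group FM_carrier[of w] normal_imp_subgroup[OF N0_normal]] by (simp only:)
  then have "free_reduce w \<in> N0 #>\<^bsub>FM\<^esub> x" by (simp only: x(2))
  then obtain y where y: "y \<in> N0" "free_reduce w = y \<otimes>\<^bsub>FM\<^esub> x" unfolding r_coset_def by auto
  have "y \<in> K" by (rule subsetD[OF normal_closure_minimal[OF assms(2,3)] y(1)])
  then show ?thesis using y(2) x(1) subgroup.m_closed[OF normal_imp_subgroup[OF assms(2)]] by metis
qed

lemma gev_relator:
  assumes "r \<in> set \<tau>"
  shows "gev \<tau> (map letter_word r) = \<one>\<^bsub>quotient_group \<tau>\<^esub>"
proof -
  have "modular_elem r \<in> N1 \<tau>" by (rule subsetD[OF normal_closure_subset imageI[OF assms]])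
  then have "N1 \<tau> #>\<^bsub>modular_group\<^esub> modular_elem r = N1 \<tau>"
    by (rule group.coset_join2[OF group_modular_group modular_elem_in_carrier normal_imp_subgroup[OF N1_normal]])
  then show ?thesis by (simp add: gev_def quotient_group_def modular_elem_def presented_elem_def)
qed

lemma gev_modular:
  assumes "r \<in> modular_relators"
  shows "gev \<tau> r = \<one>\<^bsub>quotient_group \<tau>\<^esub>"
proof -
  have "free_reduce r \<in> N0" by (rule subsetD[OF normal_closure_subset imageI[OF assms]])
  then have "N0 #>\<^bsub>FM\<^esub> free_reduce r = N0"
    by (rule group.coset_join2[OF group_free_group FM_carrier normal_imp_subgroup[OF N0_normal]])
  then have "gev \<tau> r = N1 \<tau> #>\<^bsub>modular_group\<^esub> \<one>\<^bsub>modular_group\<^esub>"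
    by (simp add: gev_def modular_group_eq)
  also have "\<dots> = N1 \<tau>"
    by (rule group.coset_join2[OF group_modular_group monoid.one_closed[OF group.is_monoid[OF group_modular_group]]
      normal_imp_subgroup[OF N1_normal] subgroup.one_closed[OF normal_imp_subgroup[OF N1_normal]]])
  finally show ?thesis by (simp add: quotient_group_def)
qed

definition ev :: "mword list \<Rightarrow> mword \<Rightarrow> modular_gen word set set" where
  "ev \<tau> w = gev \<tau> (map letter_word w)"

fun linv :: "modular_letter \<Rightarrow> modular_letter" where
  "linv let_a = let_a" | "linv let_b = let_b_inv" | "linv let_b_inv = let_b"

definition winv :: "mword \<Rightarrow> mword" where "winv w = map linv (rev w)"

lemma linv_linv [simp]: "linv (linv x) = x" by (cases x) auto
lemma winv_winv [simp]: "winv (winv w) = w" by (simp add: winv_def rev_map o_def)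
lemma winv_append [simp]: "winv (u @ v) = winv v @ winv u" by (simp add: winv_def)
lemma winv_Nil [simp]: "winv [] = []" by (simp add: winv_def)
lemma winv_single [simp]: "winv [x] = [linv x]" by (simp add: winv_def)

context
  fixes \<tau> :: "mword list"
begin

interpretation Q: group "quotient_group \<tau>" by (rule group_quotient_group)

lemma ev_append: "ev \<tau> (u @ v) = ev \<tau> u \<otimes>\<^bsub>quotient_group \<tau>\<^esub> ev \<tau> v"
  by (simp add: ev_def gev_append)

lemma ev_closed [simp]: "ev \<tau> w \<in> carrier (quotient_group \<tau>)"
  by (simp add: ev_def gev_closed)

lemma ev_Nil [simp]: "ev \<tau> [] = \<one>\<^bsub>quotient_group \<tau>\<^esub>" by (simp add: ev_def)

lemma ev_cong: "ev \<tau> u = ev \<tau> u' \<Longrightarrow> ev \<tau> v = ev \<tau> v' \<Longrightarrow> ev \<tau> (u @ v) = ev \<tau> (u' @ v')"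
  by (simp add: ev_append)

lemma ev_mid: "ev \<tau> v = ev \<tau> v' \<Longrightarrow> ev \<tau> (u @ v @ w) = ev \<tau> (u @ v' @ w)"
  by (simp add: ev_append)

lemma ev_relator: "r \<in> set \<tau> \<Longrightarrow> ev \<tau> r = \<one>\<^bsub>quotient_group \<tau>\<^esub>"
  by (simp add: ev_def gev_relator)

lemma ev_aa: "ev \<tau> [let_a, let_a] = ev \<tau> []"
  using gev_modular[of "replicate 2 (gen_a, True)" \<tau>] by (simp add: ev_def modular_relators_def numeral_2_eq_2)

lemma ev_bbb: "ev \<tau> [let_b, let_b, let_b] = ev \<tau> []"
  using gev_modular[of "replicate 3 (gen_b, True)" \<tau>] by (simp add: ev_def modular_relators_def numeral_3_eq_3)

lemma ev_bB: "ev \<tau> [let_b, let_b_inv] = ev \<tau> []" "ev \<tau> [let_b_inv, let_b] = ev \<tau> []"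
proof -
  have "free_reduce [(gen_b, True), (gen_b, False)] = []" "free_reduce [(gen_b, False), (gen_b, True)] = []"
    by (auto simp: free_reduce_def push_letter_def inv_letter_def)
  then show "ev \<tau> [let_b, let_b_inv] = ev \<tau> []" "ev \<tau> [let_b_inv, let_b] = ev \<tau> []"
    using gev_reduce[of \<tau> "[(gen_b, True), (gen_b, False)]"] gev_reduce[of \<tau> "[(gen_b, False), (gen_b, True)]"]
    by (simp_all add: ev_def)
qed

lemma ev_bb: "ev \<tau> [let_b, let_b] = ev \<tau> [let_b_inv]" "ev \<tau> [let_b_inv, let_b_inv] = ev \<tau> [let_b]"
proof -
  have "ev \<tau> ([let_b, let_b] @ [let_b, let_b_inv]) = ev \<tau> ([let_b, let_b] @ [])" by (rule ev_cong[OF refl]) (rule ev_bB)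
  moreover have "ev \<tau> ([let_b, let_b, let_b] @ [let_b_inv]) = ev \<tau> ([] @ [let_b_inv])" by (rule ev_cong[OF ev_bbb refl])
  ultimately show 1: "ev \<tau> [let_b, let_b] = ev \<tau> [let_b_inv]" by simp
  have "ev \<tau> ([let_b_inv] @ [let_b_inv]) = ev \<tau> ([let_b_inv] @ [let_b, let_b])" by (rule ev_cong[OF refl]) (simp add: 1)
  also have "\<dots> = ev \<tau> ([let_b_inv, let_b] @ [let_b])" by simp
  also have "\<dots> = ev \<tau> ([] @ [let_b])" by (rule ev_cong[OF ev_bB(2) refl])
  finally show "ev \<tau> [let_b_inv, let_b_inv] = ev \<tau> [let_b]" by simp
qed

lemma ev_letter_inv: "ev \<tau> [x, linv x] = ev \<tau> []"
  by (cases x) (simp_all only: linv.simps ev_aa ev_bB)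

lemma ev_winv_right: "ev \<tau> (w @ winv w) = ev \<tau> []"
proof (induction w)
  case (Cons x w)
  have "ev \<tau> ((x # w) @ winv (x # w)) = ev \<tau> ([x] @ (w @ winv w) @ [linv x])" by (simp add: winv_def)
  also have "\<dots> = ev \<tau> ([x] @ [] @ [linv x])" by (rule ev_mid[OF Cons])
  finally show ?case by (simp add: ev_letter_inv)
qed simp

lemma ev_winv_left: "ev \<tau> (winv w @ w) = ev \<tau> []"
  using ev_winv_right[of "winv w"] by simp

lemma ev_winv: "ev \<tau> (winv w) = inv\<^bsub>quotient_group \<tau>\<^esub> ev \<tau> w"
  using ev_winv_left[of w] by (simp add: ev_append Q.inv_equality)

lemma ev_winv_cong: "ev \<tau> u = ev \<tau> v \<Longrightarrow> ev \<tau> (winv u) = ev \<tau> (winv v)"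
  by (simp add: ev_winv)

lemma ev_onto: assumes "g \<in> carrier (quotient_group \<tau>)" shows "\<exists>w. g = ev \<tau> w"
proof -
  \<comment> \<open>The alphabet has no letter for the inverse of \<open>a\<close>; in the quotient
    \<open>a\<close> is its own inverse.\<close>
  have a: "gev \<tau> [(gen_a, False)] = gev \<tau> [(gen_a, True)]"
  proof -
    have "free_reduce [(gen_a, False), (gen_a, True)] = []" by (auto simp: free_reduce_def push_letter_def inv_letter_def)
    then have 1: "gev \<tau> [(gen_a, False)] \<otimes>\<^bsub>quotient_group \<tau>\<^esub> gev \<tau> [(gen_a, True)] = \<one>\<^bsub>quotient_group \<tau>\<^esub>"
      using gev_reduce[of \<tau> "[(gen_a, False), (gen_a, True)]"] gev_append[of \<tau> "[(gen_a, False)]" "[(gen_a, True)]"] by simp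
    have 2: "gev \<tau> [(gen_a, True)] \<otimes>\<^bsub>quotient_group \<tau>\<^esub> gev \<tau> [(gen_a, True)] = \<one>\<^bsub>quotient_group \<tau>\<^esub>"
      using ev_aa gev_append[of \<tau> "[(gen_a, True)]" "[(gen_a, True)]"] by (simp add: ev_def)
    show ?thesis using 1 2 gev_closed by (metis Q.inv_equality)
  qed
  have "\<exists>u. gev \<tau> w = ev \<tau> u" for w
  proof (induction w)
    case (Cons p w)
    then obtain u where u: "gev \<tau> w = ev \<tau> u" by blast
    have "\<exists>x. gev \<tau> [p] = ev \<tau> [x]"
      using a by (cases p; cases "fst p"; cases "snd p")
        (auto simp: ev_def intro: exI[of _ let_a] exI[of _ let_b] exI[of _ let_b_inv])
    then obtain x where x: "gev \<tau> [p] = ev \<tau> [x]" by blast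
    have "gev \<tau> (p # w) = ev \<tau> ([x] @ u)"
      using gev_append[of \<tau> "[p]" w] u x unfolding ev_append by simp
    then show ?case by blast
  qed (auto intro: exI[of _ "[]"])
  then show ?thesis using gev_onto[OF assms] by metis
qed

end

definition sub :: "mword \<Rightarrow> mword \<Rightarrow> mword \<Rightarrow> mword" where
  "sub U V w = concat (map (\<lambda>x. case x of let_a \<Rightarrow> U | let_b \<Rightarrow> V | let_b_inv \<Rightarrow> winv V) w)"

lemma sub_append: "sub U V (u @ v) = sub U V u @ sub U V v" by (simp add: sub_def)

lemma sub_Nil [simp]: "sub U V [] = []" by (simp add: sub_def)

lemma sub_Cons: "sub U V (x # w) = sub U V [x] @ sub U V w" by (simp add: sub_def)

lemma sub_single [simp]: "sub U V [let_a] = U" "sub U V [let_b] = V" "sub U V [let_b_inv] = winv V"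
  by (simp_all add: sub_def)

text \<open>\<open>U\<close> and \<open>V\<close> spell the images of \<open>a\<close> and
  \<open>b\<close>, so \<open>sub U V\<close> is the isomorphism on the level of words; the last
  clause is its surjectivity.\<close>

lemma iso_words:
  assumes "\<phi> \<in> iso (quotient_group \<sigma>) (quotient_group \<tau>)"
  obtains U V where "ev \<tau> (U @ U) = ev \<tau> []" "ev \<tau> (V @ V @ V) = ev \<tau> []"
    "\<And>r. r \<in> set \<sigma> \<Longrightarrow> ev \<tau> (sub U V r) = ev \<tau> []"
    "\<And>w. \<exists>u. ev \<tau> w = ev \<tau> (sub U V u)"
proof -
  let ?G = "quotient_group \<sigma>" and ?H = "quotient_group \<tau>"
  interpret group_hom ?G ?H \<phi>
    using assms group_quotient_group by (simp add: group_hom_def group_hom_axioms_def iso_def)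
  obtain U where U: "\<phi> (ev \<sigma> [let_a]) = ev \<tau> U" using ev_onto[of "\<phi> (ev \<sigma> [let_a])" \<tau>] ev_closed by auto
  obtain V where V: "\<phi> (ev \<sigma> [let_b]) = ev \<tau> V" using ev_onto[of "\<phi> (ev \<sigma> [let_b])" \<tau>] ev_closed by auto
  have B: "\<phi> (ev \<sigma> [let_b_inv]) = ev \<tau> (winv V)"
    using ev_winv[of \<sigma> "[let_b]"] V by (simp add: ev_winv)
  have sub: "\<phi> (ev \<sigma> w) = ev \<tau> (sub U V w)" for w
  proof (induction w)
    case (Cons x w)
    have "\<phi> (ev \<sigma> ([x] @ w)) = \<phi> (ev \<sigma> [x]) \<otimes>\<^bsub>?H\<^esub> \<phi> (ev \<sigma> w)" unfolding ev_append by simp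
    also have "\<phi> (ev \<sigma> [x]) = ev \<tau> (sub U V [x])" using U V B by (cases x) auto
    finally show ?case using Cons by (simp add: sub_Cons[of U V x w] ev_append)
  qed simp
  show thesis
  proof (rule that)
    show "ev \<tau> (U @ U) = ev \<tau> []" using sub[of "[let_a, let_a]"] ev_aa[of \<sigma>] by (simp add: sub_def)
    show "ev \<tau> (V @ V @ V) = ev \<tau> []" using sub[of "[let_b, let_b, let_b]"] ev_bbb[of \<sigma>] by (simp add: sub_def)
    show "ev \<tau> (sub U V r) = ev \<tau> []" if "r \<in> set \<sigma>" for r using sub[of r] ev_relator[OF that] by simp
    show "\<exists>u. ev \<tau> w = ev \<tau> (sub U V u)" for w
    proof -
      have "ev \<tau> w \<in> \<phi> ` carrier ?G" using assms by (simp add: iso_def bij_betw_def)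
      then obtain g where g: "g \<in> carrier ?G" "ev \<tau> w = \<phi> g" by (rule imageE)
      obtain u where "g = ev \<sigma> u" using ev_onto[OF g(1)] by (rule exE)
      then have "ev \<tau> w = ev \<tau> (sub U V u)" using g(2) sub by simp
      then show ?thesis by (rule exI)
    qed
  qed
qed

section \<open>Actions as a test for nontriviality\<close>

fun act_letter :: "('x \<Rightarrow> 'x) \<Rightarrow> (bool \<Rightarrow> 'x \<Rightarrow> 'x) \<Rightarrow> modular_gen \<times> bool \<Rightarrow> 'x \<Rightarrow> 'x" where
  "act_letter A B (gen_a, s) = A" | "act_letter A B (gen_b, s) = B s"

fun act :: "('x \<Rightarrow> 'x) \<Rightarrow> (bool \<Rightarrow> 'x \<Rightarrow> 'x) \<Rightarrow> modular_gen word \<Rightarrow> 'x \<Rightarrow> 'x" where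
  "act A B [] y = y" | "act A B (p # w) y = act A B w (act_letter A B p y)"

lemma act_append: "act A B (u @ v) y = act A B v (act A B u y)"
  by (induction u arbitrary: y) auto

text \<open>The free words that fix \<open>S\<close> pointwise form a subgroup, which is normal
  because \<open>S\<close> is invariant; \<open>gev_trivial_imp\<close> applies to it.\<close>

lemma ev_trivial_act:
  assumes A: "\<And>y. A (A y) = y" and B: "\<And>s y. B (\<not> s) (B s y) = y" "\<And>y. B True (B True (B True y)) = y"
    and S: "\<And>y. y \<in> S \<Longrightarrow> A y \<in> S" "\<And>y s. y \<in> S \<Longrightarrow> B s y \<in> S"
    and rel: "\<And>r y. r \<in> set \<tau> \<Longrightarrow> y \<in> S \<Longrightarrow> act A B (map letter_word r) y = y"
    and triv: "ev \<tau> w = ev \<tau> []" and y: "y \<in> S"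
  shows "act A B (map letter_word w) y = y"
proof -
  have letter: "act_letter A B (inv_letter p) (act_letter A B p z) = z" for p z
    using A B(1) by (cases p; cases "fst p") (auto simp: inv_letter_def)
  have push: "act A B (push_letter p u) z = act A B (p # u) z" for p u z
    using letter[of p z] by (auto simp: push_letter_def split: list.split)
  have red: "act A B (free_reduce u) z = act A B u z" for u z
    by (induction u arbitrary: z) (auto simp: free_reduce_def push simp del: act.simps(2), simp)
  have stab: "act_letter A B p z \<in> S" if "z \<in> S" for p z using S that by (cases p; cases "fst p") auto
  have stabw: "z \<in> S \<Longrightarrow> act A B u z \<in> S" for u z by (induction u arbitrary: z) (auto simp: stab)
  let ?K = "{u \<in> carrier FM. \<forall>z\<in>S. act A B u z = z}"
  interpret F: group FM by (rule group_free_group)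
  have mult: "act A B (u \<otimes>\<^bsub>FM\<^esub> v) z = act A B v (act A B u z)" for u v z
    by (simp add: free_group_def red act_append)
  have inv: "act A B (inv\<^bsub>FM\<^esub> u) (act A B u z) = z" if "u \<in> carrier FM" for u z
    using mult[of u "inv\<^bsub>FM\<^esub> u" z] that by (simp add: FM_one)
  have "subgroup ?K FM"
  proof (rule F.subgroupI)
    show "?K \<noteq> {}" using F.one_closed by (auto simp: FM_one intro!: exI[of _ "[]"])
    show "inv\<^bsub>FM\<^esub> u \<in> ?K" if "u \<in> ?K" for u using that inv[of u] by auto metis
  qed (auto simp: mult)
  then have "?K \<lhd> FM"
  proof (rule F.normal_invI)
    fix x h assume x: "x \<in> carrier FM" and h: "h \<in> ?K"
    have "act A B (x \<otimes>\<^bsub>FM\<^esub> h \<otimes>\<^bsub>FM\<^esub> inv\<^bsub>FM\<^esub> x) z = z" if "z \<in> S" for z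
      using h inv[OF x] stabw[OF that] by (simp add: mult)
    then show "x \<otimes>\<^bsub>FM\<^esub> h \<otimes>\<^bsub>FM\<^esub> inv\<^bsub>FM\<^esub> x \<in> ?K" using x h by auto
  qed
  moreover have "free_reduce ` modular_relators \<subseteq> ?K"
    using FM_carrier A B(2) by (auto simp: modular_relators_def red numeral_2_eq_2 numeral_3_eq_3)
  moreover have "free_reduce (map letter_word r) \<in> ?K" if "r \<in> set \<tau>" for r
    using FM_carrier rel[OF that] by (auto simp: red)
  ultimately have "free_reduce (map letter_word w) \<in> ?K"
    using gev_trivial_imp[of \<tau> "map letter_word w" ?K] triv by (simp add: ev_def)
  then show ?thesis using y by (auto simp: red)
qed

text \<open>\<open>W e\<close> is the word \<open>a b\<^sup>\<plusminus> a b\<^sup>\<plusminus> \<dots>\<close> with signs \<open>e\<close>; the inverse of \<open>W e\<close> is conjugate by \<open>a\<close> to \<open>W (flip e)\<close>.\<close>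

definition bl :: "bool \<Rightarrow> modular_letter" where "bl s = (if s then let_b else let_b_inv)"

definition W :: "bool list \<Rightarrow> mword" where "W e = concat (map (\<lambda>s. [let_a, bl s]) e)"

lemma W_simps [simp]: "W [] = []" "W (s # e) = [let_a, bl s] @ W e" "W (e @ f) = W e @ W f"
  by (simp_all add: W_def)

lemma linv_bl [simp]: "linv (bl s) = bl (\<not> s)" by (simp add: bl_def)

text \<open>The measure for all shortening arguments, in which powers of \<open>b\<close> cost
  nothing.\<close>

definition na :: "mword \<Rightarrow> nat" where "na w = length (filter (\<lambda>x. x = let_a) w)"

lemma na_simps [simp]: "na [] = 0" "na (u @ v) = na u + na v" "na (let_a # w) = Suc (na w)" "na (bl s # w) = na w"
  by (simp_all add: na_def bl_def)

lemma na_W [simp]: "na (W e) = length e"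
  by (induction e) auto

lemma na_winv [simp]: "na (winv w) = na w"
proof (induction w)
  case (Cons x w)
  then show ?case by (cases x) (simp_all add: na_def winv_def)
qed simp

lemma letter_cases: obtains "x = let_a" | s where "x = bl s"
proof (cases x)
  case let_b
  then show ?thesis using that(2)[of True] by (simp add: bl_def)
next
  case let_b_inv
  then show ?thesis using that(2)[of False] by (simp add: bl_def)
qed (use that in simp)

lemma winv_Cons [simp]: "winv (x # w) = winv w @ [linv x]"
  by (simp add: winv_def)

abbreviation flip :: "bool list \<Rightarrow> bool list" where "flip e \<equiv> rev (map Not e)"

definition bf :: "bool option \<Rightarrow> mword" where "bf f = (case f of None \<Rightarrow> [] | Some s \<Rightarrow> [bl s])"
definition ad :: "bool \<Rightarrow> mword" where "ad d = (if d then [let_a] else [])"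

lemma bf_simps [simp]: "bf None = []" "bf (Some s) = [bl s]" by (simp_all add: bf_def)
lemma ad_simps [simp]: "ad True = [let_a]" "ad False = []" by (simp_all add: ad_def)
context
  fixes \<tau> :: "mword list"
begin

interpretation Q: group "quotient_group \<tau>" by (rule group_quotient_group)

lemma ev_Cons2: "ev \<tau> (x # y # w) = ev \<tau> [x] \<otimes>\<^bsub>quotient_group \<tau>\<^esub> ev \<tau> (y # w)"
  using ev_append[of \<tau> "[x]" "y # w"] by simp

lemma ev_Cons_append: "ev \<tau> (x # u @ v) = ev \<tau> [x] \<otimes>\<^bsub>quotient_group \<tau>\<^esub> ev \<tau> (u @ v)"
  using ev_append[of \<tau> "[x]" "u @ v"] by simp

lemma mult_aa: "ev \<tau> [let_a] \<otimes>\<^bsub>quotient_group \<tau>\<^esub> ev \<tau> [let_a] = \<one>\<^bsub>quotient_group \<tau>\<^esub>"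
  using ev_aa[of \<tau>] ev_append[of \<tau> "[let_a]" "[let_a]"] by simp

lemma mult_bb: "ev \<tau> [bl s] \<otimes>\<^bsub>quotient_group \<tau>\<^esub> ev \<tau> [bl s] = ev \<tau> [bl (\<not> s)]"
  using ev_bb[of \<tau>] ev_append[of \<tau> "[bl s]" "[bl s]"] by (auto simp: bl_def)

lemma mult_bB: "ev \<tau> [bl s] \<otimes>\<^bsub>quotient_group \<tau>\<^esub> ev \<tau> [bl (\<not> s)] = \<one>\<^bsub>quotient_group \<tau>\<^esub>"
    "ev \<tau> [bl (\<not> s)] \<otimes>\<^bsub>quotient_group \<tau>\<^esub> ev \<tau> [bl s] = \<one>\<^bsub>quotient_group \<tau>\<^esub>"
  using ev_bB[of \<tau>] ev_append[of \<tau> "[let_b]" "[let_b_inv]"] ev_append[of \<tau> "[let_b_inv]" "[let_b]"] by (auto simp: bl_def)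

lemma cancel_left:
  assumes "x \<otimes>\<^bsub>quotient_group \<tau>\<^esub> y = z" "x \<in> carrier (quotient_group \<tau>)" "y \<in> carrier (quotient_group \<tau>)" "w \<in> carrier (quotient_group \<tau>)"
  shows "x \<otimes>\<^bsub>quotient_group \<tau>\<^esub> (y \<otimes>\<^bsub>quotient_group \<tau>\<^esub> w) = z \<otimes>\<^bsub>quotient_group \<tau>\<^esub> w"
  using assms by (simp flip: Q.m_assoc)

text \<open>Each relation is also given with a trailing factor, so that rewriting can cancel inside
  products bracketed to the right.\<close>

lemmas mult_simps = mult_aa mult_bb mult_bB mult_aa[THEN cancel_left, simplified] mult_bb[THEN cancel_left, simplified]
  mult_bB[THEN cancel_left, simplified] Q.l_inv[THEN cancel_left, simplified] Q.r_inv[THEN cancel_left, simplified]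

lemmas ev_simps = ev_Cons2 ev_Cons_append ev_append ev_winv Q.m_assoc Q.inv_mult_group mult_simps

lemma inv_ev_b: "inv\<^bsub>quotient_group \<tau>\<^esub> ev \<tau> [bl s] = ev \<tau> [bl (\<not> s)]"
  by (rule Q.inv_equality) (simp_all add: mult_simps)

lemma ev_flip: "ev \<tau> (W (flip e)) = ev \<tau> ([let_a] @ winv (W e) @ [let_a])"
proof (induction e)
  case Nil
  then show ?case by (simp add: ev_simps)
next
  case (Cons s e)
  have "ev \<tau> (W (flip (s # e))) = ev \<tau> (W (flip e)) \<otimes>\<^bsub>quotient_group \<tau>\<^esub> ev \<tau> [let_a, bl (\<not> s)]"
    by (simp add: ev_append)
  then show ?case unfolding Cons by (simp add: ev_simps inv_ev_b)
qed

text \<open>Appending a letter either extends the normal form or merges with its last letter, where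
  \<open>a a\<close> vanishes and \<open>b b\<close> becomes \<open>b^-1\<close>. The bound on
  syllables is what the minimality arguments need.\<close>

lemma normal_form:
  "\<exists>f e d. ev \<tau> w = ev \<tau> (bf f @ W e @ ad d) \<and> length e + (if d then 1 else 0) \<le> na w"
proof (induction w rule: rev_induct)
  case Nil
  show ?case by (rule exI[of _ None], rule exI[of _ "[]"], rule exI[of _ False]) simp
next
  case (snoc x w)
  then obtain f e d where w: "ev \<tau> w = ev \<tau> (bf f @ W e @ ad d)" "length e + (if d then 1 else 0) \<le> na w" by blast
  have wx: "ev \<tau> (w @ [x]) = ev \<tau> ((bf f @ W e @ ad d) @ [x])" by (rule ev_cong[OF w(1) refl])
  show ?case
  proof (cases rule: letter_cases[of x])
    case 1
    show ?thesis
    proof (cases d)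
      case True
      then have "ev \<tau> (w @ [x]) = ev \<tau> (bf f @ W e @ ad False)" using wx 1 by (simp add: ev_simps)
      moreover have "length e + (if False then 1 else 0) \<le> na (w @ [x])" using w(2) True by simp
      ultimately show ?thesis by blast
    next
      case False
      then have "ev \<tau> (w @ [x]) = ev \<tau> (bf f @ W e @ ad True)" using wx 1 by simp
      moreover have "length e + (if True then 1 else 0) \<le> na (w @ [x])" using w(2) False 1 by simp
      ultimately show ?thesis by blast
    qed
  next
    case (2 s)
    show ?thesis
    proof (cases d)
      case True
      then have "ev \<tau> (w @ [x]) = ev \<tau> (bf f @ W (e @ [s]) @ ad False)" using wx 2 by simp
      moreover have "length (e @ [s]) + (if False then 1 else 0) \<le> na (w @ [x])" using w(2) True by simp
      ultimately show ?thesis by blast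
    next
      case d: False
      show ?thesis
      proof (cases e rule: rev_cases)
        case Nil
        define f' where "f' = (case f of None \<Rightarrow> Some s | Some s' \<Rightarrow> if s' = s then Some (\<not> s) else None)"
        have "ev \<tau> (w @ [x]) = ev \<tau> (bf f' @ W [] @ ad False)"
          using wx 2 d Nil by (auto simp: f'_def ev_simps split: option.split)
        moreover have "length ([] :: bool list) + (if False then 1 else 0) \<le> na (w @ [x])" by simp
        ultimately show ?thesis by blast
      next
        case (snoc e' s')
        have len: "length e = length e' + 1" using snoc by simp
        show ?thesis
        proof (cases "s' = s")
          case True
          then have "ev \<tau> (w @ [x]) = ev \<tau> (bf f @ W (e' @ [\<not> s]) @ ad False)" using wx 2 d snoc by (simp add: ev_simps)
          moreover have "length (e' @ [\<not> s]) + (if False then 1 else 0) \<le> na (w @ [x])" using w(2) len d by simp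
          ultimately show ?thesis by blast
        next
          case False
          then have "s' = (\<not> s)" by simp
          then have "ev \<tau> (w @ [x]) = ev \<tau> (bf f @ W e' @ ad True)" using wx 2 d snoc by (simp add: ev_simps)
          moreover have "length e' + (if True then 1 else 0) \<le> na (w @ [x])" using w(2) len d by simp
          ultimately show ?thesis by blast
        qed
      qed
    qed
  qed
qed

section \<open>Conjugacy and cyclic normal forms\<close>

definition cj :: "mword \<Rightarrow> mword \<Rightarrow> bool" where
  "cj u v \<longleftrightarrow> (\<exists>p. ev \<tau> u = ev \<tau> (p @ v @ winv p))"

lemma cj_ev: "ev \<tau> u = ev \<tau> v \<Longrightarrow> cj u v"
  unfolding cj_def by (rule exI[of _ "[]"]) simp

lemma cj_trans: "cj u v \<Longrightarrow> cj v w \<Longrightarrow> cj u w"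
proof -
  assume "cj u v" "cj v w"
  then obtain p p' where "ev \<tau> u = ev \<tau> (p @ v @ winv p)" "ev \<tau> v = ev \<tau> (p' @ w @ winv p')" by (auto simp: cj_def)
  then have "ev \<tau> u = ev \<tau> ((p @ p') @ w @ winv (p @ p'))" by (simp add: ev_simps)
  then show ?thesis unfolding cj_def by blast
qed

lemma cj_rot: "cj (u @ v) (v @ u)"
  unfolding cj_def by (rule exI[of _ u]) (simp add: ev_simps)

lemma cj_trivial: "cj u v \<Longrightarrow> ev \<tau> v = ev \<tau> [] \<Longrightarrow> ev \<tau> u = ev \<tau> []"
  by (auto simp: cj_def ev_simps)

lemma cj_sym: "cj u v \<Longrightarrow> cj v u"
proof -
  assume "cj u v"
  then obtain p where "ev \<tau> u = ev \<tau> (p @ v @ winv p)" by (auto simp: cj_def)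
  then have "ev \<tau> v = ev \<tau> (winv p @ u @ winv (winv p))" by (simp add: ev_simps)
  then show ?thesis unfolding cj_def by blast
qed

abbreviation wpow :: "nat \<Rightarrow> 'x list \<Rightarrow> 'x list" where "wpow n u \<equiv> concat (replicate n u)"

lemma ev_wpow_conj: "ev \<tau> u = ev \<tau> (p @ v @ winv p) \<Longrightarrow> ev \<tau> (wpow n u) = ev \<tau> (p @ wpow n v @ winv p)"
  by (induction n) (simp_all add: ev_simps)

lemma cj_wpow: "cj u v \<Longrightarrow> ev \<tau> (wpow n u) = ev \<tau> [] \<Longrightarrow> ev \<tau> (wpow n v) = ev \<tau> []"
proof -
  assume "cj u v" "ev \<tau> (wpow n u) = ev \<tau> []"
  then have "cj v u" by (simp add: cj_sym)
  then obtain p where "ev \<tau> v = ev \<tau> (p @ u @ winv p)" by (auto simp: cj_def)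
  then have "ev \<tau> (wpow n v) = ev \<tau> (p @ wpow n u @ winv p)" by (rule ev_wpow_conj)
  then show ?thesis using \<open>ev \<tau> (wpow n u) = ev \<tau> []\<close> by (simp add: ev_simps)
qed

text \<open>Cyclic reduction: a final \<open>a\<close> or an initial power of \<open>b\<close> is
  conjugated to the other end, where it merges or cancels, and every cancellation shortens
  \<open>e\<close>.\<close>

lemma conj_normal_form:
  "\<exists>w'. cj (bf f @ W e @ ad d) w' \<and> (w' \<in> {[], [let_a]} \<or> (\<exists>s. w' = [bl s]) \<or>
     (\<exists>e'. w' = W e' \<and> e' \<noteq> [] \<and> length e' \<le> length e + (if d then 1 else 0)))"
proof (induction "length e" arbitrary: f e d rule: less_induct)
  case less
  show ?case
  proof (cases d)
    case True
    have c: "cj (bf f @ W e @ ad d) ([let_a] @ bf f @ W e)" using cj_rot[of "bf f @ W e" "[let_a]"] True by simp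
    show ?thesis
    proof (cases f)
      case None
      show ?thesis
      proof (cases e)
        case Nil
        then show ?thesis using c None by (intro exI[of _ "[let_a]"]) simp
      next
        case (Cons s e')
        have "ev \<tau> ([let_a] @ bf f @ W e) = ev \<tau> (bf (Some s) @ W e' @ ad False)"
          using None Cons by (simp add: ev_simps)
        then have c': "cj (bf f @ W e @ ad d) (bf (Some s) @ W e' @ ad False)" using c cj_ev cj_trans by blast
        from less[of e' "Some s" False] Cons obtain w' where w': "cj (bf (Some s) @ W e' @ ad False) w'"
          "w' \<in> {[], [let_a]} \<or> (\<exists>s. w' = [bl s]) \<or> (\<exists>e''. w' = W e'' \<and> e'' \<noteq> [] \<and> length e'' \<le> length e')" by auto
        then show ?thesis using cj_trans[OF c' w'(1)] Cons by (intro exI[of _ w']) (auto simp: le_SucI)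
      qed
    next
      case (Some s)
      then have "cj (bf f @ W e @ ad d) (W (s # e))" using c by simp
      then show ?thesis using True by (intro exI[of _ "W (s # e)"]) (auto intro!: exI[of _ "s # e"])
    qed
  next
    case d: False
    show ?thesis
    proof (cases f)
      case None
      then have "cj (bf f @ W e @ ad d) (W e)" using d by (simp add: cj_ev)
      then show ?thesis using d by (cases "e = []") auto
    next
      case (Some s)
      show ?thesis
      proof (cases e rule: rev_cases)
        case Nil
        then show ?thesis using Some d cj_ev by auto
      next
        case (snoc e' s')
        have c: "cj (bf f @ W e @ ad d) (W e @ bf f)" using cj_rot[of "bf f" "W e"] d by simp
        show ?thesis
        proof (cases "s' = s")
          case True
          then have "ev \<tau> (W e @ bf f) = ev \<tau> (W (e' @ [\<not> s]))" using snoc Some by (simp add: ev_simps)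
          then have "cj (bf f @ W e @ ad d) (W (e' @ [\<not> s]))" using c cj_ev cj_trans by blast
          then show ?thesis using snoc by (intro exI[of _ "W (e' @ [\<not> s])"]) (auto intro!: exI[of _ "e' @ [\<not> s]"])
        next
          case False
          then have "s' = (\<not> s)" by simp
          then have "ev \<tau> (W e @ bf f) = ev \<tau> (bf None @ W e' @ ad True)" using snoc Some by (simp add: ev_simps)
          then have c': "cj (bf f @ W e @ ad d) (bf None @ W e' @ ad True)" using c cj_ev cj_trans by blast
          from less[of e' None True] snoc obtain w' where w': "cj (bf None @ W e' @ ad True) w'"
            "w' \<in> {[], [let_a]} \<or> (\<exists>s. w' = [bl s]) \<or> (\<exists>e''. w' = W e'' \<and> e'' \<noteq> [] \<and> length e'' \<le> length e' + 1)" by auto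
          then show ?thesis using cj_trans[OF c' w'(1)] snoc by (intro exI[of _ w']) auto
        qed
      qed
    qed
  qed
qed

lemma cj_cases:
  obtains w' where "cj w w'" "w' \<in> {[], [let_a]} \<or> (\<exists>s. w' = [bl s]) \<or> (\<exists>e. w' = W e \<and> e \<noteq> [] \<and> length e \<le> na w)"
proof -
  obtain f e d where w: "ev \<tau> w = ev \<tau> (bf f @ W e @ ad d)" "length e + (if d then 1 else 0) \<le> na w" using normal_form by blast
  obtain w' where w': "cj (bf f @ W e @ ad d) w'" "w' \<in> {[], [let_a]} \<or> (\<exists>s. w' = [bl s]) \<or>
     (\<exists>e'. w' = W e' \<and> e' \<noteq> [] \<and> length e' \<le> length e + (if d then 1 else 0))" using conj_normal_form by blast
  have "cj w w'" using cj_trans[OF cj_ev[OF w(1)] w'(1)] .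
  moreover have "w' \<in> {[], [let_a]} \<or> (\<exists>s. w' = [bl s]) \<or> (\<exists>e. w' = W e \<and> e \<noteq> [] \<and> length e \<le> na w)"
    using w'(2) w(2) order_trans by blast
  ultimately show thesis by (rule that)
qed

lemma ev_sub_cong: "ev \<tau> u = ev \<tau> u' \<Longrightarrow> ev \<tau> v = ev \<tau> v' \<Longrightarrow> ev \<tau> (sub u v w) = ev \<tau> (sub u' v' w)"
proof (induction w)
  case (Cons x w)
  have "ev \<tau> (sub u v [x]) = ev \<tau> (sub u' v' [x])" using Cons.prems by (cases x) (simp_all add: ev_winv)
  with Cons show ?case by (simp add: sub_Cons[of _ _ x w] ev_append)
qed simp

lemma ev_sub_conj: "ev \<tau> (sub (p @ u @ winv p) (p @ v @ winv p) w) = ev \<tau> (p @ sub u v w @ winv p)"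
proof (induction w)
  case (Cons x w)
  have "ev \<tau> (sub (p @ u @ winv p) (p @ v @ winv p) [x]) = ev \<tau> (p @ sub u v [x] @ winv p)"
    by (cases x) (simp_all add: ev_simps)
  with Cons show ?case by (simp add: sub_Cons[of _ _ x w] ev_simps)
qed (simp add: ev_simps)

end

section \<open>Torsion in quotients by generic tuples\<close>

definition rl :: "(int \<Rightarrow> bool) \<Rightarrow> int \<Rightarrow> nat \<Rightarrow> bool list" where
  "rl \<rho> c n = map (\<lambda>i. \<rho> (c + int i)) [0..<n]"

lemma length_rl [simp]: "length (rl \<rho> c n) = n" by (simp add: rl_def)
lemma nth_rl [simp]: "i < n \<Longrightarrow> rl \<rho> c n ! i = \<rho> (c + int i)" by (simp add: rl_def)
lemma rl_append: "rl \<rho> c n @ rl \<rho> (c + int n) m = rl \<rho> c (n + m)"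
  by (rule nth_equalityI) (auto simp: nth_append)

lemma rl_rinv: "rl (rinv \<rho>) c n = flip (rl \<rho> (- c - int n) n)"
  by (rule nth_equalityI) (auto simp: rinv_def rev_nth nth_append of_nat_diff algebra_simps)

text \<open>The words \<open>F s (flip F) F s' (flip F) \<dots>\<close> with \<open>F\<close> of length \<open>t\<close> are symmetric up to sign
  around each junction of \<open>flip F\<close> and \<open>F\<close>.\<close>

definition pattern :: "(int \<Rightarrow> bool) \<Rightarrow> nat \<Rightarrow> nat \<Rightarrow> nat \<Rightarrow> bool" where
  "pattern \<rho> n t j \<longleftrightarrow> (\<forall>x s. (j + x) mod (2 * t + 1) = 2 * t \<longrightarrow> s < t \<longrightarrow> s \<le> x \<longrightarrow> x + 1 + s < n \<longrightarrow>
     \<rho> (int x - int s) = (\<not> \<rho> (int x + 1 + int s)))"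

text \<open>\<open>relator_form\<close> lets a relator begin with \<open>a\<close> or with
  \<open>b^+-1\<close>; \<open>prim\<close> says that no relator is a proper power. Patterns are
  excluded only for \<open>t < D\<close>, since for larger \<open>t\<close> the symmetry at a
  junction already contradicts small cancellation, see \<open>no_reflection\<close>.\<close>

locale generic_tuple = small_cancel Rp k D for Rp k D +
  fixes \<tau> :: "mword list"
  assumes prim: "\<rho> \<in> Rp \<Longrightarrow> rshift c \<rho> = \<rho> \<Longrightarrow> int k dvd c"
    and relator_form: "r \<in> set \<tau> \<Longrightarrow> \<exists>\<rho>\<in>Rp. r = W (rl \<rho> 0 k) \<or> r = rotate1 (W (rl \<rho> 0 k))"
    and relator_trivial: "\<rho> \<in> Rp \<Longrightarrow> ev \<tau> (W (rl \<rho> 0 k)) = ev \<tau> []"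
    and patternless: "\<rho> \<in> R \<Longrightarrow> 1 \<le> t \<Longrightarrow> t < D \<Longrightarrow> \<not> pattern \<rho> (q - 1) t j"
    and k_larger: "40 * D + 40 \<le> k"
begin

interpretation Q: group "quotient_group \<tau>" by (rule group_quotient_group)

definition chunk :: "nat \<Rightarrow> bool list \<Rightarrow> bool" where
  "chunk n e \<longleftrightarrow> (\<exists>xs \<rho> ys. \<rho> \<in> R \<and> e = xs @ rl \<rho> 0 n @ ys)"

abbreviation "N \<equiv> q - 1"

lemma N_bounds: "N + 12 * D + 1 = k" "28 * D + 30 \<le> N"
  using k_larger by (auto simp: q_def)

lemma chunkI:
  assumes "\<rho> \<in> R" "j + n \<le> length e" "\<And>i. i < n \<Longrightarrow> e ! (j + i) = \<rho> (c + int i)"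
  shows "chunk n e"
proof -
  have "take n (drop j e) = rl (rshift c \<rho>) 0 n"
    by (rule nth_equalityI) (use assms in \<open>auto simp: rshift_def add.commute\<close>)
  then have "e = take j e @ rl (rshift c \<rho>) 0 n @ drop n (drop j e)"
    by (metis append_take_drop_id)
  then show ?thesis unfolding chunk_def using rshift_R[OF assms(1)] by blast
qed

lemma chunk_flip: assumes "chunk n e" shows "chunk n (flip e)"
proof -
  obtain xs \<rho> ys where r: "\<rho> \<in> R" "e = xs @ rl \<rho> 0 n @ ys" using assms by (auto simp: chunk_def)
  have "flip (rl \<rho> 0 n) = rl (rshift (- int n) (rinv \<rho>)) 0 n"
    by (rule nth_equalityI) (auto simp: rinv_def rshift_def rev_nth of_nat_diff algebra_simps)
  then have "flip e = flip ys @ rl (rshift (- int n) (rinv \<rho>)) 0 n @ flip xs" using r(2) by simp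
  then show ?thesis unfolding chunk_def using rshift_R[OF rinv_R[OF r(1)]] by blast
qed

lemma relator_R: assumes "\<rho> \<in> R" shows "ev \<tau> (W (rl \<rho> c k)) = ev \<tau> []"
proof -
  have p: "ev \<tau> (W (rl \<sigma> d k)) = ev \<tau> []" if "\<sigma> \<in> Rp" for \<sigma> d
  proof -
    have "rl \<sigma> d k = rl (rshift d \<sigma>) 0 k" by (simp add: rl_def rshift_def add.commute)
    then show ?thesis using relator_trivial[OF rshift_Rp[OF that]] by simp
  qed
  from assms show ?thesis
  proof
    assume "\<rho> \<in> rinv ` Rp"
    then obtain \<sigma> where s: "\<sigma> \<in> Rp" "\<rho> = rinv \<sigma>" by blast
    show ?thesis unfolding s(2) rl_rinv ev_flip by (simp add: ev_simps p[OF s(1)] mult_aa)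
  qed (rule p)
qed

text \<open>The replacement step of Dehn's algorithm; it shortens the word when
  \<open>2 * n > k\<close>.\<close>

lemma complement:
  assumes "\<rho> \<in> R" "n \<le> k"
  shows "ev \<tau> (W (rl \<rho> c n)) = ev \<tau> (winv (W (rl \<rho> (c + int n) (k - n))))"
proof -
  have "ev \<tau> (W (rl \<rho> c n) @ W (rl \<rho> (c + int n) (k - n))) = ev \<tau> []"
    using relator_R[OF assms(1), of c] rl_append[of \<rho> c n "k - n"] assms(2) by (simp flip: W_simps(3))
  then show ?thesis by (simp add: ev_append ev_winv Q.inv_equality[symmetric] Q.inv_solve_right')
qed

lemma act_W: "act A rot (map letter_word (W e)) y = walk A y e"
  by (induction e arbitrary: y) (auto simp: bl_def)

text \<open>A trivial word fixes the base dart. Since the trailing power of \<open>b\<close> only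
  rotates a triangle, the walk along \<open>W e\<close> returns to its triangle, and
  \<open>windmill\<close> yields the chunk. The second clause is obtained from the same action,
  because \<open>rot\<close> fixes no dart.\<close>

lemma dehn:
  "(\<forall>e f. e \<noteq> [] \<longrightarrow> ev \<tau> (W e @ bf f) = ev \<tau> [] \<longrightarrow> chunk N e) \<and> ev \<tau> [let_b] \<noteq> ev \<tau> []"
proof -
  obtain A x V where A: "invol A" and x: "tri x \<in> V" and V: "\<forall>y. tri y \<in> V \<longrightarrow> tri (A y) \<in> V"
    and rel: "\<forall>\<rho>\<in>R. \<forall>y. tri y \<in> V \<longrightarrow> walk A y (map (\<lambda>i. \<rho> (int i)) [0..<k]) = y"
    and walk: "\<forall>y e. tri y \<in> V \<longrightarrow> e \<noteq> [] \<longrightarrow> tri (walk A y e) = tri y \<longrightarrow>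
        (\<exists>j. \<exists>\<rho>\<in>R. j + q \<le> length e \<and> (\<forall>i<q - 1. e ! (j + i) = \<rho> (int i)))"
    using windmill by (elim exE conjE) (rule that, assumption+)
  have AA: "A (A y) = y" for y using A by (simp add: invol_def)
  have triv: "act A rot (map letter_word w) y = y" if "ev \<tau> w = ev \<tau> []" "tri y \<in> V" for w y
  proof (rule ev_trivial_act[where S = "{y. tri y \<in> V}" and \<tau> = \<tau>])
    fix r y assume r: "r \<in> set \<tau>" and y: "y \<in> {y. tri y \<in> V}"
    obtain \<rho> where \<rho>: "\<rho> \<in> Rp" "r = W (rl \<rho> 0 k) \<or> r = rotate1 (W (rl \<rho> 0 k))" using relator_form[OF r] by blast
    have w: "act A rot (map letter_word (W (rl \<rho> 0 k))) z = z" if "tri z \<in> V" for z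
      using rel[rule_format, of \<rho> z] \<rho>(1) that by (simp add: act_W rl_def)
    from \<rho>(2) show "act A rot (map letter_word r) y = y"
    proof
      assume r: "r = rotate1 (W (rl \<rho> 0 k))"
      obtain s e where e: "rl \<rho> 0 k = s # e" using k_large by (cases "rl \<rho> 0 k") (auto dest: arg_cong[of _ _ length])
      have "act A rot (map letter_word (bl s # W e)) y = A y"
        using w[of "A y"] V[rule_format, of y] y AA by (simp add: e)
      then show ?thesis using AA by (simp add: r e act_append)
    qed (use w y in simp)
  qed (use that AA V in auto)
  have "chunk N e" if ne: "e \<noteq> []" and triv_e: "ev \<tau> (W e @ bf f) = ev \<tau> []" for e f
  proof -
    have "act A rot (map letter_word (bf f)) (walk A x e) = x"
      using triv[OF triv_e x] by (simp add: act_append act_W)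
    moreover have "tri (act A rot (map letter_word (bf f)) z) = tri z" for z
      by (cases f) (auto simp: bl_def)
    ultimately have "tri (walk A x e) = tri x" by metis
    then obtain j \<rho> where "\<rho> \<in> R" "j + q \<le> length e" "\<And>i. i < q - 1 \<Longrightarrow> e ! (j + i) = \<rho> (int i)"
      using walk[rule_format, OF x ne] by blast
    then show ?thesis by (intro chunkI[of \<rho> j N e 0]) auto
  qed
  moreover have "ev \<tau> [let_b] \<noteq> ev \<tau> []"
    using triv[of "[let_b]" x] x by auto
  ultimately show ?thesis by blast
qed

lemma dehn_chunk: "ev \<tau> (W e @ bf f) = ev \<tau> [] \<Longrightarrow> e \<noteq> [] \<Longrightarrow> chunk N e"
  using dehn by blast

lemma chunk_length: "chunk n e \<Longrightarrow> n \<le> length e"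
  by (auto simp: chunk_def)

lemma b_nontrivial: "ev \<tau> [bl s] \<noteq> ev \<tau> []"
proof (cases s)
  case False
  show ?thesis
  proof
    assume "ev \<tau> [bl s] = ev \<tau> []"
    then have "ev \<tau> [let_b] = ev \<tau> []" using mult_bb[of \<tau> s] False by (simp add: bl_def)
    then show False using dehn by blast
  qed
qed (use dehn in \<open>auto simp: bl_def\<close>)

text \<open>\<open>a\<close> equals \<open>a b b^-1\<close>, that is
  \<open>W [True] @ bf (Some False)\<close>, and one syllable is too short for a chunk.\<close>

lemma a_nontrivial: "ev \<tau> [let_a] \<noteq> ev \<tau> []"
proof
  assume "ev \<tau> [let_a] = ev \<tau> []"
  then have "ev \<tau> (W [True] @ bf (Some False)) = ev \<tau> []" using mult_bB(1)[of \<tau> True] by (simp add: ev_simps)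
  then show False using dehn_chunk[of "[True]" "Some False"] chunk_length[of N "[True]"] N_bounds by simp
qed

text \<open>The commutator \<open>a b a b^-1\<close> is \<open>W [True, False]\<close>, too short
  for a chunk.\<close>

lemma ab_noncommuting: "ev \<tau> ([let_a] @ [let_b]) \<noteq> ev \<tau> ([let_b] @ [let_a])"
proof
  assume "ev \<tau> ([let_a] @ [let_b]) = ev \<tau> ([let_b] @ [let_a])"
  then have "ev \<tau> (([let_a] @ [let_b]) @ [let_a, bl False]) = ev \<tau> (([let_b] @ [let_a]) @ [let_a, bl False])"
    by (rule ev_cong) simp
  moreover have "let_b = bl True" by (simp add: bl_def)
  ultimately have "ev \<tau> (W [True, False] @ bf None) = ev \<tau> []" using mult_bB(1)[of \<tau> True] by (simp add: ev_simps mult_simps)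
  then show False using dehn_chunk[of "[True, False]" None] chunk_length[of N "[True, False]"] N_bounds by simp
qed

lemma prim_R: "\<rho> \<in> R \<Longrightarrow> rshift c \<rho> = \<rho> \<Longrightarrow> int k dvd c"
proof -
  assume "\<rho> \<in> R" "rshift c \<rho> = \<rho>"
  then show "int k dvd c"
  proof (elim UnE)
    assume "\<rho> \<in> rinv ` Rp"
    then obtain \<sigma> where s: "\<sigma> \<in> Rp" "\<rho> = rinv \<sigma>" by blast
    then have "rinv (rshift (- c) \<sigma>) = rinv \<sigma>" using \<open>rshift c \<rho> = \<rho>\<close> by (simp add: rshift_rinv)
    then have "rshift (- c) \<sigma> = \<sigma>" by (metis rinv_rinv)
    then show ?thesis using prim[OF s(1)] by force
  qed (use prim in blast)
qed

lemma cj_rotate: "cj \<tau> (W e) (W (rotate j e))"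
proof -
  have "W (rotate j e) = W (drop (j mod length e) e) @ W (take (j mod length e) e)"
    by (simp add: rotate_drop_take)
  moreover have "W e = W (take (j mod length e) e) @ W (drop (j mod length e) e)"
    by (simp flip: W_simps(3))
  ultimately show ?thesis using cj_rot by metis
qed

lemma W_wpow: "W (wpow n e) = wpow n (W e)"
  by (induction n) auto

lemma nth_wpow: "x < n * length e \<Longrightarrow> wpow n e ! x = e ! (x mod length e)"
proof (induction n arbitrary: x)
  case (Suc n)
  then show ?case
    by (cases "x < length e") (auto simp: nth_append le_mod_geq not_less)
qed simp

lemma length_wpow [simp]: "length (wpow n e) = n * length e"
  by (induction n) auto

text \<open>The trivial power contains a chunk. If this agreed with its own shift by
  \<open>length e\<close> in \<open>D\<close> signs, primitivity would give
  \<open>k \<le> length e\<close>, although the chunk is then shorter than \<open>k\<close> and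
  longer than \<open>e\<close>. So \<open>N < length e + D\<close>, and some rotation of
  \<open>e\<close> begins with more than half of a relator, which \<open>complement\<close>
  replaces.\<close>

lemma shorten:
  assumes e: "e \<noteq> []" "ev \<tau> (wpow n (W e)) = ev \<tau> []" "n > 0"
  shows "\<exists>u. cj \<tau> (W e) u \<and> na u < length e"
proof -
  let ?l = "length e"
  have l: "?l > 0" using e by simp
  have "wpow n e \<noteq> []" using e by auto
  moreover have "ev \<tau> (W (wpow n e) @ bf None) = ev \<tau> []" using e by (simp add: W_wpow)
  ultimately have "chunk N (wpow n e)" using dehn_chunk by blast
  then obtain xs \<rho> ys where r: "\<rho> \<in> R" "wpow n e = xs @ rl \<rho> 0 N @ ys" by (auto simp: chunk_def)
  let ?j = "length xs"
  have len: "?j + N \<le> n * ?l" using arg_cong[OF r(2), of length] by simp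
  have at: "e ! ((?j + i) mod ?l) = \<rho> (int i)" if "i < N" for i
  proof -
    have "wpow n e ! (?j + i) = \<rho> (int i)" unfolding r(2) using that by (simp add: nth_append)
    then show ?thesis using nth_wpow[of "?j + i" n e] that len by simp
  qed
  have big: "N < ?l + D"
  proof (rule ccontr)
    assume "\<not> N < ?l + D"
    then have "\<rho> (s + 0) = \<rho> (s + int ?l)" if "0 \<le> s" "s < int D" for s
      using at[of "nat s"] at[of "nat s + ?l"] that by (simp add: add.assoc[symmetric])
    then have "rshift 0 \<rho> = rshift (int ?l) \<rho>" by (intro overlap_at[OF r(1) r(1)]) auto
    then have "int k dvd int ?l" by (intro prim_R[OF r(1)]) simp
    then have "k \<le> ?l" using l by (simp add: dvd_imp_le)
    then show False using \<open>\<not> N < ?l + D\<close> N_bounds by simp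
  qed
  define m where "m = min ?l N"
  have m: "m \<le> ?l" "m \<le> N" "N < m + D" using big D_pos by (auto simp: m_def)
  have mk: "m \<le> k" "k < 2 * m" using m N_bounds by auto
  let ?r = "drop m (rotate ?j e)"
  have "take m (rotate ?j e) = rl \<rho> 0 m"
    by (rule nth_equalityI) (use at m l in \<open>auto simp: nth_rotate\<close>)
  then have "rotate ?j e = rl \<rho> 0 m @ ?r" by (metis append_take_drop_id)
  then have "ev \<tau> (W (rotate ?j e)) = ev \<tau> (W (rl \<rho> 0 m) @ W ?r)" by (metis W_simps(3))
  also have "\<dots> = ev \<tau> (winv (W (rl \<rho> (0 + int m) (k - m))) @ W ?r)"
    by (rule ev_cong[OF complement[OF r(1) mk(1)] refl])
  finally have "cj \<tau> (W e) (winv (W (rl \<rho> (0 + int m) (k - m))) @ W ?r)"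
    using cj_trans[OF cj_rotate cj_ev] by blast
  moreover have "na (winv (W (rl \<rho> (0 + int m) (k - m))) @ W ?r) < ?l" using m mk by simp
  ultimately show ?thesis by blast
qed

text \<open>Otherwise the conjugacy class has a representative \<open>W e\<close>; a power of it is trivial and so contains
  a chunk of a relator, which replaced by its complement gives a shorter conjugate.\<close>

lemma torsion:
  assumes "ev \<tau> (wpow n u) = ev \<tau> []" "n > 0"
  shows "\<exists>w. cj \<tau> u w \<and> (w \<in> {[], [let_a]} \<or> (\<exists>s. w = [bl s]))"
  using assms(1)
proof (induction "na u" arbitrary: u rule: less_induct)
  case less
  obtain w where w: "cj \<tau> u w" "w \<in> {[], [let_a]} \<or> (\<exists>s. w = [bl s]) \<or> (\<exists>e. w = W e \<and> e \<noteq> [] \<and> length e \<le> na u)"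
    using cj_cases by blast
  show ?case
  proof (cases "\<exists>e. w = W e \<and> e \<noteq> [] \<and> length e \<le> na u")
    case True
    then obtain e where e: "w = W e" "e \<noteq> []" "length e \<le> na u" by blast
    have "ev \<tau> (wpow n (W e)) = ev \<tau> []" using cj_wpow[OF w(1) less.prems] e by simp
    then obtain v where v: "cj \<tau> (W e) v" "na v < length e" using shorten[OF e(2) _ assms(2)] by blast
    have uv: "cj \<tau> u v" using cj_trans w(1) v(1) e(1) by blast
    have "na v < na u" using v e by simp
    from less.hyps[OF this cj_wpow[OF uv less.prems]] show ?thesis using cj_trans[OF uv] by blast
  next
    case False
    then show ?thesis using w by blast
  qed
qed

end

section \<open>Rigidity of generic quotients\<close>

lemma length_concat_blocks: "(\<And>x. length (B x) = P) \<Longrightarrow> length (concat (map B e)) = P * length e"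
  by (induction e) auto

lemma nth_concat_blocks:
  assumes "\<And>x. length (B x) = P" "r < P" "b < length e"
  shows "concat (map B e) ! (P * b + r) = B (e ! b) ! r"
  using assms(3)
proof (induction e arbitrary: b)
  case (Cons x e)
  then show ?case using assms by (cases b) (auto simp: nth_append)
qed simp

context generic_tuple
begin

interpretation Q: group "quotient_group \<tau>" by (rule group_quotient_group)

text \<open>By \<open>overlap_at\<close> such a reflection makes a shift of the relator equal to a
  shift of its inverse, against \<open>oriented\<close>.\<close>

lemma no_reflection:
  assumes "\<rho> \<in> R" "\<And>s. s < D \<Longrightarrow> \<rho> (c - int s) = (\<not> \<rho> (d + int s))"
  shows False
proof -
  have "rshift (- c - 1) (rinv \<rho>) = rshift d \<rho>"
  proof (rule overlap_at[OF rinv_R[OF assms(1)] assms(1)])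
    fix s assume "0 \<le> s" "s < int D"
    then show "rinv \<rho> (s + (- c - 1)) = \<rho> (s + d)"
      using assms(2)[of "nat s"] by (simp add: rinv_def algebra_simps)
  qed
  then have e: "rinv (rshift (c + 1) \<rho>) = rshift d \<rho>" by (simp add: rshift_rinv add.commute)
  from assms(1) show False
  proof
    assume "\<rho> \<in> Rp"
    then show False using e oriented[OF rshift_Rp[of \<rho> "c + 1"]] rshift_Rp[of \<rho> d] by simp
  next
    assume "\<rho> \<in> rinv ` Rp"
    then obtain \<sigma> where s: "\<sigma> \<in> Rp" "\<rho> = rinv \<sigma>" by blast
    then have "rshift (- (c + 1)) \<sigma> = rinv (rshift (- d) \<sigma>)" using e by (simp add: rshift_rinv)
    then show False using oriented[OF rshift_Rp[OF s(1), of "- d"]] rshift_Rp[OF s(1), of "- (c + 1)"] by simp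
  qed
qed

text \<open>With \<open>t = length F\<close> the word consists of blocks of length
  \<open>2 * t + 1\<close>; it is antisymmetric with radius \<open>t\<close> around each junction of
  blocks and around each middle letter. For \<open>t < D\<close> the chunk would be a
  \<open>pattern\<close>. For \<open>t \<ge> D\<close> no centre of symmetry can lie deeper than
  \<open>D\<close> inside the chunk, so apart from \<open>D\<close> signs at either end the chunk
  lies in one copy of \<open>F\<close> or \<open>flip F\<close>.\<close>

lemma sandwich_chunk:
  assumes F: "F \<noteq> []" and ch: "chunk N (concat (map (\<lambda>s. F @ [s = \<beta>] @ flip F) e))"
  shows "chunk (N - 2 * D) F"
proof -
  let ?B = "\<lambda>s. F @ [s = \<beta>] @ flip F" and ?t = "length F"
  let ?P = "2 * ?t + 1" and ?Z = "concat (map ?B e)"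
  have t: "1 \<le> ?t" using F by (cases F) auto
  have lB: "length (?B x) = ?P" for x by simp
  have lZ: "length ?Z = ?P * length e" by (rule length_concat_blocks[OF lB])
  have Z: "?Z ! (?P * b + r) = ?B (e ! b) ! r" if "r < ?P" "?P * b + r < length ?Z" for b r
  proof (rule nth_concat_blocks[OF lB that(1)])
    have "?P * b < ?P * length e" using that(2) unfolding lZ by linarith
    then show "b < length e" by (simp only: mult_less_cancel1)
  qed
  have B1: "?B x ! r = F ! r" if "r < ?t" for x r using that by (simp add: nth_append)
  have B2: "?B x ! r = (\<not> F ! (2 * ?t - r))" if "?t < r" "r \<le> 2 * ?t" for x r
    using that by (simp add: nth_append rev_nth) (metis Suc_diff_Suc Suc_diff_diff diff_Suc_Suc diff_diff_left mult_2 not_less_eq nat_less_le add_diff_cancel_right' diff_add_inverse2 less_or_eq_imp_le Suc_diff_le)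
  obtain xs \<rho> ys where \<rho>: "\<rho> \<in> R" and xs: "?Z = xs @ rl \<rho> 0 N @ ys" using ch by (auto simp: chunk_def)
  let ?j = "length xs"
  have jN: "?j + N \<le> length ?Z" unfolding xs by simp
  have at: "?Z ! (?j + i) = \<rho> (int i)" if "i < N" for i
    unfolding xs using that by (simp add: nth_append)
  have at2: "\<rho> (int i) = ?B (e ! b) ! r" if "i < N" "?j + i = ?P * b + r" "r < ?P" for i b r
  proof -
    have "\<rho> (int i) = ?Z ! (?P * b + r)" using at[OF that(1)] that(2) by simp
    also have "\<dots> = ?B (e ! b) ! r" by (rule Z) (use that jN in linarith)+
    finally show ?thesis .
  qed
  \<comment> \<open>Residue \<open>2 * t\<close> marks the last letter of a block; the mirror is the
    gap between \<open>x\<close> and \<open>x + 1\<close>.\<close>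
  have junction: "\<rho> (int x - int s) = (\<not> \<rho> (int x + 1 + int s))"
    if "(?j + x) mod ?P = 2 * ?t" "s < ?t" "s \<le> x" "x + 1 + s < N" for x s
  proof -
    define b where "b = (?j + x) div ?P"
    have b: "?j + x = ?P * b + 2 * ?t" using that(1) mult_div_mod_eq[of ?P "?j + x"] by (simp only: b_def)
    have "?j + (x - s) = ?P * b + (2 * ?t - s)" using b that by simp
    moreover have "?B y ! (2 * ?t - s) = (\<not> F ! s)" for y using B2[of "2 * ?t - s" y] that(2) by simp
    ultimately have 1: "\<rho> (int (x - s)) = (\<not> F ! s)"
      using at2[of "x - s" b "2 * ?t - s"] that by simp
    have "?j + (x + 1 + s) = ?P * (b + 1) + s" using b by simp
    then have "\<rho> (int (x + 1 + s)) = F ! s"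
      using at2[of "x + 1 + s" "b + 1" s] B1[of s] that(2,4) by simp
    with 1 show ?thesis using that(3) by (simp add: of_nat_diff add_ac)
  qed
  \<comment> \<open>Residue \<open>t\<close> marks the middle letter of a block; the mirror is
    \<open>x\<close> itself, whose letter is not constrained.\<close>
  have centre: "\<rho> (int x - 1 - int s) = (\<not> \<rho> (int x + 1 + int s))"
    if "(?j + x) mod ?P = ?t" "s < ?t" "s < x" "x + 1 + s < N" for x s
  proof -
    define b where "b = (?j + x) div ?P"
    have b: "?j + x = ?P * b + ?t" using that(1) mult_div_mod_eq[of ?P "?j + x"] by (simp only: b_def)
    have "?j + (x - 1 - s) = ?P * b + (?t - 1 - s)" using b that by simp
    then have 1: "\<rho> (int (x - 1 - s)) = F ! (?t - 1 - s)"
      using at2[of "x - 1 - s" b "?t - 1 - s"] B1[of "?t - 1 - s"] that by simp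
    have "?j + (x + 1 + s) = ?P * b + (?t + 1 + s)" using b by simp
    moreover have "?B y ! (?t + 1 + s) = (\<not> F ! (?t - 1 - s))" for y
      using B2[of "?t + 1 + s" y] that(2) by (simp add: numeral_2_eq_2 diff_diff_eq)
    ultimately have "\<rho> (int (x + 1 + s)) = (\<not> F ! (?t - 1 - s))"
      using at2[of "x + 1 + s" b "?t + 1 + s"] that(2,4) by simp
    with 1 show ?thesis using that(3) by (simp add: of_nat_diff add_ac diff_diff_eq)
  qed
  have "D \<le> ?t"
  proof (rule ccontr)
    assume "\<not> D \<le> ?t"
    moreover have "pattern \<rho> N ?t ?j" unfolding pattern_def using junction by blast
    ultimately show False using patternless[OF \<rho> t] by simp
  qed
  have no_junction: "(?j + x) mod ?P \<noteq> 2 * ?t" "(?j + x) mod ?P \<noteq> ?t" if x: "D \<le> x" "x < N - D" for x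
  proof -
    show "(?j + x) mod ?P \<noteq> 2 * ?t"
    proof
      assume a: "(?j + x) mod ?P = 2 * ?t"
      show False
        by (rule no_reflection[OF \<rho>, of "int x" "int x + 1"], rule junction[OF a]) (use x \<open>D \<le> ?t\<close> in auto)
    qed
    show "(?j + x) mod ?P \<noteq> ?t"
    proof
      assume a: "(?j + x) mod ?P = ?t"
      show False
        by (rule no_reflection[OF \<rho>, of "int x - 1" "int x + 1"], rule centre[OF a]) (use x \<open>D \<le> ?t\<close> in auto)
    qed
  qed
  define r0 where "r0 = (?j + D) mod ?P"
  have r0: "r0 < ?P" "r0 \<noteq> ?t" "r0 \<noteq> 2 * ?t"
  proof -
    show "r0 < ?P" unfolding r0_def by (rule mod_less_divisor) simp
    have "D < N - D" using N_bounds by simp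
    then show "r0 \<noteq> ?t" "r0 \<noteq> 2 * ?t" using no_junction[of D] unfolding r0_def by blast+
  qed
  \<comment> \<open>The residue starts at \<open>r0\<close> and can cross neither \<open>t\<close>
    nor \<open>2 * t\<close>, so it increases without wrapping: the trimmed chunk stays in the half
    block where it starts.\<close>
  have res: "i < N - 2 * D \<Longrightarrow> (?j + D + i) mod ?P = r0 + i \<and> (r0 < ?t \<longrightarrow> r0 + i < ?t) \<and> r0 + i < 2 * ?t" for i
  proof (induction i)
    case 0
    have "(?j + D + 0) mod ?P = r0" by (simp only: r0_def add_0_right)
    moreover have "r0 < 2 * ?t" using r0 by linarith
    ultimately show ?case by simp
  next
    case (Suc i)
    then have IH: "(?j + D + i) mod ?P = r0 + i" "r0 < ?t \<longrightarrow> r0 + i < ?t" "r0 + i < 2 * ?t" by auto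
    then have m: "(?j + D + Suc i) mod ?P = r0 + Suc i" by (simp add: mod_Suc)
    have "r0 + Suc i \<noteq> ?t" "r0 + Suc i \<noteq> 2 * ?t"
      using no_junction[of "D + Suc i"] m Suc.prems by (auto simp: add.assoc)
    then show ?case using m IH by auto
  qed
  let ?n = "N - 2 * D"
  have n: "?n > 0" using N_bounds by simp
  have val: "?B (e ! ((?j + D + i) div ?P)) ! (r0 + i) = \<rho> (int D + int i)" if "i < ?n" for i
  proof -
    define b where "b = (?j + D + i) div ?P"
    have "?j + D + i = ?P * b + (r0 + i)"
      using res[OF that] mult_div_mod_eq[of ?P "?j + D + i"] by (simp only: b_def)
    then show ?thesis
      using at2[of "D + i" b "r0 + i"] res[OF that] that unfolding b_def[symmetric] by (simp add: add.assoc)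
  qed
  show ?thesis
  proof (cases "r0 < ?t")
    case True
    show ?thesis
    proof (rule chunkI[OF \<rho>, of r0 ?n F "int D"])
      have "?n - 1 < ?n" using n by simp
      from res[OF this] True have "r0 + (?n - 1) < ?t" by blast
      then show "r0 + ?n \<le> ?t" using n by linarith
      show "F ! (r0 + i) = \<rho> (int D + int i)" if "i < ?n" for i
        using val[OF that] B1[of "r0 + i"] res[OF that] True by simp
    qed
  next
    case False
    have "chunk ?n (flip F)"
    proof (rule chunkI[OF \<rho>, of "r0 - ?t - 1" ?n _ "int D"])
      have "?n - 1 < ?n" using n by simp
      from res[OF this] have "r0 + (?n - 1) < 2 * ?t" by blast
      then have "r0 - ?t - 1 + ?n \<le> ?t" using n False r0 by linarith
      then show "r0 - ?t - 1 + ?n \<le> length (flip F)" by simp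
      show "flip F ! (r0 - ?t - 1 + i) = \<rho> (int D + int i)" if "i < ?n" for i
        using val[OF that] res[OF that] False r0 by (auto simp: nth_append nth_Cons' not_less split: if_splits)
    qed
    from chunk_flip[OF this] show ?thesis by (simp add: rev_map o_def)
  qed
qed

definition comm :: "mword \<Rightarrow> mword \<Rightarrow> bool" where
  "comm u v \<longleftrightarrow> ev \<tau> (u @ v) = ev \<tau> (v @ u)"

lemma comm_sym: "comm u v \<Longrightarrow> comm v u" by (simp add: comm_def)

lemma comm_sub:
  assumes "\<And>x. comm (sub ua vb [x]) g" shows "comm (sub ua vb w) g"
proof (induction w)
  case (Cons x w)
  have "ev \<tau> (sub ua vb [x] @ sub ua vb w @ g) = ev \<tau> (sub ua vb [x] @ g @ sub ua vb w)"
    by (rule ev_cong[OF refl]) (use Cons in \<open>simp add: comm_def\<close>)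
  also have "\<dots> = ev \<tau> ((sub ua vb [x] @ g) @ sub ua vb w)" by simp
  also have "\<dots> = ev \<tau> ((g @ sub ua vb [x]) @ sub ua vb w)"
    by (rule ev_cong[OF _ refl]) (use assms in \<open>simp add: comm_def\<close>)
  finally show ?case by (simp add: comm_def sub_Cons[of ua vb x w])
qed (simp add: comm_def)

lemma comm_winv: assumes "comm u v" shows "comm (winv u) v"
proof -
  have "ev \<tau> (winv u @ v) = ev \<tau> (winv u @ (v @ u) @ winv u)" by (simp add: ev_simps)
  also have "\<dots> = ev \<tau> (winv u @ (u @ v) @ winv u)" by (rule ev_mid) (use assms in \<open>simp add: comm_def\<close>)
  also have "\<dots> = ev \<tau> (v @ winv u)" by (simp add: ev_simps)
  finally show ?thesis by (simp add: comm_def)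
qed

text \<open>If one generator were trivial, the two would commute and the quotient would be abelian,
  against \<open>ab_noncommuting\<close>.\<close>

lemma generators_nontrivial:
  assumes gen: "\<And>w. \<exists>u. ev \<tau> w = ev \<tau> (sub ua vb u)"
  shows "ev \<tau> ua \<noteq> ev \<tau> []" "ev \<tau> vb \<noteq> ev \<tau> []"
proof -
  have False if "comm ua vb"
  proof -
    have self: "comm x x" for x by (simp add: comm_def)
    have 1: "comm (sub ua vb [x]) ua" "comm (sub ua vb [x]) vb" for x
      using that comm_sym comm_winv self by (cases x; simp)+
    have "comm ua (sub ua vb w)" "comm vb (sub ua vb w)" for w using comm_sub[of ua vb] 1 comm_sym by blast+
    then have "comm (sub ua vb [x]) (sub ua vb w)" for x w using comm_winv by (cases x) auto
    then have c: "comm (sub ua vb u) (sub ua vb w)" for u w using comm_sub by blast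
    obtain u w where "ev \<tau> [let_a] = ev \<tau> (sub ua vb u)" "ev \<tau> [let_b] = ev \<tau> (sub ua vb w)" using gen by metis
    then show False using ab_noncommuting c[of u w] unfolding comm_def ev_append by simp
  qed
  then show "ev \<tau> ua \<noteq> ev \<tau> []" "ev \<tau> vb \<noteq> ev \<tau> []" by (auto simp: comm_def ev_append)
qed

text \<open>After \<open>torsion\<close> the order decides: the square of \<open>b\<close> is
  \<open>b^-1\<close>, which is nontrivial, so a conjugate of \<open>b^+-1\<close> is not an
  involution.\<close>

lemma cj_letter_a: assumes "ev \<tau> (ua @ ua) = ev \<tau> []" "ev \<tau> ua \<noteq> ev \<tau> []" shows "cj \<tau> ua [let_a]"
proof -
  have p: "ev \<tau> (wpow 2 ua) = ev \<tau> []" using assms by (simp add: numeral_2_eq_2)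
  obtain w where w: "cj \<tau> ua w" "w \<in> {[], [let_a]} \<or> (\<exists>s. w = [bl s])"
    using torsion[OF p zero_less_numeral] by blast
  have "w \<noteq> []" using cj_trivial[OF w(1)] assms(2) by blast
  moreover have "w \<noteq> [bl s]" for s
  proof
    assume "w = [bl s]"
    then have "ev \<tau> [bl s, bl s] = ev \<tau> []" using cj_wpow[OF w(1) p] by (simp add: numeral_2_eq_2)
    then show False using b_nontrivial[of "\<not> s"] mult_bb[of \<tau> s] ev_Cons2[of \<tau> "bl s" "bl s" "[]"] by simp
  qed
  ultimately show ?thesis using w by auto
qed

lemma cj_letter_b: assumes "ev \<tau> (vb @ vb @ vb) = ev \<tau> []" "ev \<tau> vb \<noteq> ev \<tau> []" shows "\<exists>s. cj \<tau> vb [bl s]"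
proof -
  have p: "ev \<tau> (wpow 3 vb) = ev \<tau> []" using assms by (simp add: numeral_3_eq_3)
  obtain w where w: "cj \<tau> vb w" "w \<in> {[], [let_a]} \<or> (\<exists>s. w = [bl s])"
    using torsion[OF p zero_less_numeral] by blast
  have "w \<noteq> []" using cj_trivial[OF w(1)] assms(2) by blast
  moreover have "w \<noteq> [let_a]"
  proof
    assume "w = [let_a]"
    then have "ev \<tau> [let_a, let_a, let_a] = ev \<tau> []" using cj_wpow[OF w(1) p] by (simp add: numeral_3_eq_3)
    then show False using a_nontrivial ev_append[of \<tau> "[let_a, let_a]" "[let_a]"] ev_aa[of \<tau>] by simp
  qed
  ultimately show ?thesis using w by auto
qed

lemma sub_syllable: "sub u v (let_a # bl s # w) = u @ sub u v [bl s] @ sub u v w"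
  using sub_append[of u v "[let_a]" "[bl s] @ w"] sub_append[of u v "[bl s]" w] by simp

lemma sub_W: "sub [let_a] [bl \<beta>] (W e) = W (map (\<lambda>s. s = \<beta>) e)"
proof (induction e)
  case (Cons s e)
  have "sub [let_a] [bl \<beta>] [bl s] = [bl (s = \<beta>)]" by (auto simp: bl_def sub_def)
  then show ?case using Cons by (simp add: sub_syllable)
qed simp

text \<open>A syllable becomes \<open>a h b^+-1 h^-1\<close>; for \<open>h = a (W F) a\<close> the
  leading \<open>a a\<close> cancels, and \<open>a (W F)^-1 a\<close> equals
  \<open>W (flip F)\<close> by \<open>ev_flip\<close>.\<close>

lemma ev_sub_sandwich:
  fixes F :: "bool list" and \<beta> :: bool
  defines "h \<equiv> [let_a] @ W F @ [let_a]"
  shows "ev \<tau> (sub [let_a] (h @ [bl \<beta>] @ winv h) (W e)) = ev \<tau> (W (concat (map (\<lambda>s. F @ [s = \<beta>] @ flip F) e)))"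
proof (induction e)
  case (Cons s e)
  let ?v = "h @ [bl \<beta>] @ winv h"
  have v: "sub [let_a] ?v [bl s] = h @ [bl (s = \<beta>)] @ winv h" by (cases s) (auto simp: bl_def)
  have "ev \<tau> ([let_a] @ h @ [bl (s = \<beta>)] @ winv h) = ev \<tau> (W (F @ [s = \<beta>]) @ W (flip F))"
    unfolding ev_append[of \<tau> "W (F @ [s = \<beta>])"] ev_flip by (simp add: h_def ev_simps mult_aa inv_ev_b)
  from ev_cong[OF this Cons] show ?case using v by (simp add: sub_syllable)
qed simp

text \<open>An isomorphism carries \<open>a\<close> and \<open>b\<close> to torsion elements, hence up to conjugation to \<open>a\<close> and
  \<open>g b\<^sup>\<plusminus> g\<^sup>-\<^sup>1\<close>.  For \<open>g\<close> shortest possible, a nontrivial \<open>g\<close> would force one of the excluded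
  patterns, so the relators of \<open>\<sigma>\<close>, up to the automorphism \<open>b \<mapsto> b\<^sup>-\<^sup>1\<close>, are trivial in the quotient by \<open>\<tau>\<close>.\<close>

theorem rigid:
  assumes iso: "quotient_group \<sigma> \<cong> quotient_group \<tau>"
    and E: "\<And>e. e \<in> E \<Longrightarrow> e \<noteq> [] \<and> (\<exists>r\<in>set \<sigma>. r = W e \<or> r = rotate1 (W e))"
  shows "\<exists>\<beta>. \<forall>e\<in>E. chunk N (map (\<lambda>s. s = \<beta>) e)"
proof -
  obtain \<phi> where "\<phi> \<in> iso (quotient_group \<sigma>) (quotient_group \<tau>)" using iso by (auto simp: is_iso_def)
  then obtain u v where u: "ev \<tau> (u @ u) = ev \<tau> []" and v: "ev \<tau> (v @ v @ v) = ev \<tau> []"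
    and rel: "\<And>r. r \<in> set \<sigma> \<Longrightarrow> ev \<tau> (sub u v r) = ev \<tau> []" and gen: "\<And>w. \<exists>z. ev \<tau> w = ev \<tau> (sub u v z)"
    by (rule iso_words) (rule that; blast)
  have relE: "ev \<tau> (sub u v (W e)) = ev \<tau> []" if e: "e \<in> E" for e
  proof -
    obtain r where r: "r \<in> set \<sigma>" "r = W e \<or> r = rotate1 (W e)" using E[OF e] by blast
    show ?thesis
    proof (cases "r = W e")
      case False
      obtain s e' where "e = s # e'" using E[OF e] by (cases e) auto
      then have w: "W e = [let_a] @ (bl s # W e')" "r = (bl s # W e') @ [let_a]" using r False by auto
      have "cj \<tau> (sub u v (W e)) (sub u v r)" unfolding w sub_append by (rule cj_rot)
      then show ?thesis using cj_trivial rel[OF r(1)] by blast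
    qed (use rel[OF r(1)] in simp)
  qed
  have nt: "ev \<tau> u \<noteq> ev \<tau> []" "ev \<tau> v \<noteq> ev \<tau> []" using generators_nontrivial[OF gen] by auto
  obtain p1 where p1: "ev \<tau> u = ev \<tau> (p1 @ [let_a] @ winv p1)" using cj_letter_a[OF u nt(1)] by (auto simp: cj_def)
  obtain \<beta> p2 where p2: "ev \<tau> v = ev \<tau> (p2 @ [bl \<beta>] @ winv p2)" using cj_letter_b[OF v nt(2)] by (auto simp: cj_def)
  \<comment> \<open>Only the relative conjugator \<open>h\<close> of the two torsion elements
    matters. The property is stable under \<open>a\<close> on the left and under removing powers of
    \<open>b\<close> on the right, so \<open>h\<close> can be normalised.\<close>
  define good where "good h \<longleftrightarrow> (\<forall>e\<in>E. ev \<tau> (sub [let_a] (h @ [bl \<beta>] @ winv h) (W e)) = ev \<tau> [])" for h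
  have good_ev: "good h'" if "good h" "ev \<tau> (h @ [bl \<beta>] @ winv h) = ev \<tau> (h' @ [bl \<beta>] @ winv h')" for h h'
    using that(1) ev_sub_cong[OF refl that(2)] unfolding good_def by metis
  have good_cong: "good h'" if "good h" "ev \<tau> h = ev \<tau> h'" for h h'
    by (rule good_ev[OF that(1) ev_cong[OF that(2) ev_cong[OF refl ev_winv_cong[OF that(2)]]]])
  have conj_trivial: "ev \<tau> w = ev \<tau> []" if "ev \<tau> (p @ w @ winv p) = ev \<tau> []" for p w
  proof -
    have "cj \<tau> (p @ w @ winv p) w" unfolding cj_def by blast
    then show ?thesis using cj_trivial[OF cj_sym] that by blast
  qed
  \<comment> \<open>Conjugating both images by \<open>a\<close> fixes the image \<open>a\<close> and
    turns \<open>h\<close> into \<open>a h\<close>.\<close>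
  have good_a: "good ([let_a] @ h)" if "good h" for h
    unfolding good_def
  proof
    fix e assume e: "e \<in> E"
    let ?v = "h @ [bl \<beta>] @ winv h"
    have "ev \<tau> (sub [let_a] (([let_a] @ h) @ [bl \<beta>] @ winv ([let_a] @ h)) (W e))
        = ev \<tau> (sub ([let_a] @ [let_a] @ winv [let_a]) ([let_a] @ ?v @ winv [let_a]) (W e))"
      by (rule ev_sub_cong) (simp_all add: ev_simps mult_aa inv_ev_b)
    also have "\<dots> = ev \<tau> ([let_a] @ sub [let_a] ?v (W e) @ winv [let_a])" by (rule ev_sub_conj)
    also have "\<dots> = ev \<tau> ([let_a] @ [] @ winv [let_a])" by (rule ev_mid) (use that e in \<open>simp add: good_def\<close>)
    finally show "ev \<tau> (sub [let_a] (([let_a] @ h) @ [bl \<beta>] @ winv ([let_a] @ h)) (W e)) = ev \<tau> []"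
      by (simp add: ev_simps mult_aa)
  qed
  have good_b: "good h" if "good (h @ [bl s])" for h s
  proof (rule good_ev[OF that])
    have "ev \<tau> [bl s, bl \<beta>, bl (\<not> s)] = ev \<tau> [bl \<beta>]"
      by (cases "s = \<beta>") (auto simp: ev_simps)
    from ev_mid[OF this] show "ev \<tau> ((h @ [bl s]) @ [bl \<beta>] @ winv (h @ [bl s])) = ev \<tau> (h @ [bl \<beta>] @ winv h)"
      by simp
  qed
  \<comment> \<open>Conjugating both images back by \<open>p1\<close> makes the image of
    \<open>a\<close> equal to \<open>a\<close>.\<close>
  have "good (winv p1 @ p2)"
    unfolding good_def
  proof
    fix e assume e: "e \<in> E"
    let ?h = "winv p1 @ p2"
    have "ev \<tau> (p1 @ sub [let_a] (?h @ [bl \<beta>] @ winv ?h) (W e) @ winv p1)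
        = ev \<tau> (sub (p1 @ [let_a] @ winv p1) (p1 @ (?h @ [bl \<beta>] @ winv ?h) @ winv p1) (W e))"
      by (rule ev_sub_conj[symmetric])
    also have "\<dots> = ev \<tau> (sub u v (W e))"
      using ev_append[of \<tau> "[bl \<beta>]" "winv p2"]
      by (intro ev_sub_cong) (simp_all add: p1 p2 ev_simps)
    finally show "ev \<tau> (sub [let_a] (?h @ [bl \<beta>] @ winv ?h) (W e)) = ev \<tau> []"
      using relE[OF e] conj_trivial by simp
  qed
  moreover have reduce: "\<exists>F. good (W F @ [let_a]) \<and> length F \<le> na h" if h: "good h" for h
  proof -
    obtain f e d where nf: "ev \<tau> h = ev \<tau> (bf f @ W e @ ad d)" "length e + (if d then 1 else 0) \<le> na h"
      using normal_form by blast
    have g: "good (bf f @ W e @ ad d)" by (rule good_cong[OF h nf(1)])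
    have lead: "\<exists>F. good (W F @ [let_a]) \<and> length F \<le> length e' + 1" if "good (bf f @ W e' @ [let_a])" for e'
    proof (cases f)
      case None
      then show ?thesis using that by (intro exI[of _ e']) simp
    next
      case (Some s)
      then have "good (W (s # e') @ [let_a])" using good_a[OF that] by simp
      then show ?thesis by (intro exI[of _ "s # e'"]) simp
    qed
    show ?thesis
    proof (cases d)
      case True
      then show ?thesis using lead[of e] g nf(2) by fastforce
    next
      case False
      show ?thesis
      proof (cases e rule: rev_cases)
        case Nil
        have "good []"
        proof (cases f)
          case (Some s)
          then show ?thesis using g False Nil good_b[of "[]" s] by simp
        qed (use g False Nil in simp)
        then have "good (W [] @ [let_a])" using good_a[of "[]"] by simp
        then show ?thesis by (intro exI[of _ "[]"]) simp
      next
        case (snoc e' s)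
        have "good (bf f @ W e' @ [let_a])" by (rule good_b[of _ s]) (use g False snoc in simp)
        then show ?thesis using lead[of e'] nf(2) False snoc by fastforce
      qed
    qed
  qed
  ultimately have "\<exists>F. good (W F @ [let_a])" by blast
  \<comment> \<open>A shortest conjugator of the normalised form; \<open>thin\<close> and
    \<open>sandwich_chunk\<close> together leave only the empty \<open>F\<close>.\<close>
  then obtain F where F: "good (W F @ [let_a])" "\<And>F'. good (W F' @ [let_a]) \<Longrightarrow> length F \<le> length F'"
    using ex_has_least_nat[of "\<lambda>F. good (W F @ [let_a])" _ length] by blast
  \<comment> \<open>Replacing the chunk by its complement and normalising again costs at most one
    extra syllable, and \<open>k + 1 < 2 * ?n\<close> still makes the result shorter than
    \<open>F\<close>.\<close>
  have thin: "\<not> chunk (N - 2 * D) F"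
  proof
    let ?n = "N - 2 * D"
    assume "chunk ?n F"
    then obtain xs \<rho> ys where r: "\<rho> \<in> R" "F = xs @ rl \<rho> 0 ?n @ ys" by (auto simp: chunk_def)
    let ?c = "winv (W (rl \<rho> (0 + int ?n) (k - ?n)))"
    have n: "?n \<le> k" "k + 1 < 2 * ?n" using N_bounds by auto
    have "ev \<tau> (W xs @ W (rl \<rho> 0 ?n) @ W ys @ [let_a]) = ev \<tau> (W xs @ ?c @ W ys @ [let_a])"
      by (rule ev_mid[OF complement[OF r(1) n(1)]])
    then have "good (W xs @ ?c @ W ys @ [let_a])" using good_cong[OF F(1)] r(2) by simp
    then obtain F' where "good (W F' @ [let_a])" "length F' \<le> na (W xs @ ?c @ W ys @ [let_a])" using reduce by blast
    then have "length F \<le> length xs + (k - ?n) + length ys + 1" using F(2)[of F'] by simp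
    then show False using n r(2) arg_cong[OF r(2), of length] by simp
  qed
  have "F = []"
  proof (rule ccontr)
    assume ne: "F \<noteq> []"
    show False
    proof (cases "E = {}")
      case True
      then have "good (W [] @ [let_a])" by (simp add: good_def)
      then show False using F(2)[of "[]"] ne by simp
    next
      case False
      then obtain e where e: "e \<in> E" by blast
      let ?Z = "concat (map (\<lambda>s. F @ [s = \<beta>] @ flip F) e)"
      have "good ([let_a] @ W F @ [let_a])" by (rule good_a[OF F(1)])
      then have "ev \<tau> (W ?Z) = ev \<tau> []" using e ev_sub_sandwich[of F \<beta> e] by (simp add: good_def)
      moreover have "?Z \<noteq> []" using E[OF e] by (cases e) auto
      ultimately have "chunk N ?Z" using dehn_chunk[of ?Z None] by simp
      from sandwich_chunk[OF ne this] show False using thin by contradiction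
    qed
  qed
  have "chunk N (map (\<lambda>s. s = \<beta>) e)" if e: "e \<in> E" for e
  proof -
    have "ev \<tau> ([let_a] @ [let_a]) = ev \<tau> []" by (simp add: ev_simps mult_aa)
    then have "good []" using good_cong[OF good_a[OF F(1)], of "[]"] \<open>F = []\<close> by simp
    then have "ev \<tau> (W (map (\<lambda>s. s = \<beta>) e)) = ev \<tau> []" using e by (simp add: good_def sub_W)
    then show ?thesis using dehn_chunk[of "map (\<lambda>s. s = \<beta>) e" None] E[OF e] by simp
  qed
  then show ?thesis by blast
qed

end

section \<open>Genericity and its frequency\<close>

text \<open>The five forbidden pairs are exactly \<open>a a\<close> and all pairs from
  \<open>b\<close>, \<open>b^-1\<close>, so reduced words alternate.\<close>

lemma mreduced_iff: "mreduced w \<longleftrightarrow> (\<forall>i. Suc i < length w \<longrightarrow> (w ! i = let_a) \<noteq> (w ! Suc i = let_a))"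
proof -
  have sl: "sublist [x, y] w \<longleftrightarrow> (\<exists>i. Suc i < length w \<and> w ! i = x \<and> w ! Suc i = y)" for x y
  proof
    assume "sublist [x, y] w"
    then obtain p s where "w = p @ [x, y] @ s" by (auto simp: sublist_def)
    then show "\<exists>i. Suc i < length w \<and> w ! i = x \<and> w ! Suc i = y"
      by (intro exI[of _ "length p"]) (auto simp: nth_append)
  next
    assume "\<exists>i. Suc i < length w \<and> w ! i = x \<and> w ! Suc i = y"
    then obtain i where i: "Suc i < length w" "w ! i = x" "w ! Suc i = y" by blast
    then have "w = take i w @ [x, y] @ drop (Suc (Suc i)) w"
      by (metis Cons_nth_drop_Suc Suc_lessD append_Cons append_Nil append_take_drop_id)
    then show "sublist [x, y] w" unfolding sublist_def by blast
  qed
  have c: "(x = let_a) \<noteq> (y = let_a) \<longleftrightarrow> [x, y] \<notin> {[let_a, let_a], [let_b, let_b_inv], [let_b_inv, let_b],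
      [let_b, let_b], [let_b_inv, let_b_inv]}" for x y
    by (cases x; cases y) auto
  show ?thesis
  proof
    assume w: "mreduced w"
    show "\<forall>i. Suc i < length w \<longrightarrow> (w ! i = let_a) \<noteq> (w ! Suc i = let_a)"
      unfolding c using w sl unfolding mreduced_def by blast
  next
    assume a: "\<forall>i. Suc i < length w \<longrightarrow> (w ! i = let_a) \<noteq> (w ! Suc i = let_a)"
    show "mreduced w" unfolding mreduced_def using a by (auto simp: sl)
  qed
qed

lemma length_W [simp]: "length (W e) = 2 * length e"
  by (induction e) auto

lemma nth_W: "i < length e \<Longrightarrow> W e ! (2 * i) = let_a" "i < length e \<Longrightarrow> W e ! (2 * i + 1) = bl (e ! i)"
proof (induction e arbitrary: i)
  case (Cons s e)
  { case 1 then show ?case using Cons.IH(1)[of "i - 1"] by (cases i) auto }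
  { case 2 then show ?case using Cons.IH(2)[of "i - 1"] by (cases i) auto }
qed auto

lemma bl_neq_a [simp]: "bl s \<noteq> let_a" by (simp add: bl_def)
lemma bl_inj [simp]: "bl s = bl s' \<longleftrightarrow> s = s'" by (simp add: bl_def)

lemma W_parity: "i < 2 * length e \<Longrightarrow> (W e ! i = let_a) \<longleftrightarrow> even i"
  using nth_W[of "i div 2" e] by (cases "even i") (auto elim!: evenE oddE)

lemma W_inj: "W e = W f \<Longrightarrow> e = f"
  by (induction e arbitrary: f) (case_tac f; simp)+

text \<open>A cyclically reduced word of length \<open>2 k\<close> is coded by its \<open>k\<close> signs and a flag that tells whether
  it starts with \<open>b\<^sup>\<plusminus>\<close>; \<open>Ps m k\<close> codes the tuples of length \<open>2 k\<close>.\<close>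

definition cw :: "bool \<times> bool list \<Rightarrow> mword" where
  "cw p = (if fst p then rotate1 (W (snd p)) else W (snd p))"

lemma length_cw [simp]: "length (cw p) = 2 * length (snd p)" by (simp add: cw_def)

lemma cw_nth: "i < 2 * length (snd p) \<Longrightarrow> cw p ! i = W (snd p) ! ((i + (if fst p then 1 else 0)) mod (2 * length (snd p)))"
  by (auto simp: cw_def nth_rotate1)

lemma even_mod_double: "even ((i :: nat) mod (2 * n)) \<longleftrightarrow> even i"
  by (metis dvd_mod_iff dvd_triv_left)

lemma cw_parity:
  assumes "i < 2 * length (snd p)"
  shows "(cw p ! i = let_a) \<longleftrightarrow> (even i \<noteq> fst p)"
proof -
  let ?j = "(i + (if fst p then 1 else 0)) mod (2 * length (snd p))"
  have "?j < 2 * length (snd p)" using assms by (intro mod_less_divisor) linarith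
  then show ?thesis unfolding cw_nth[OF assms] W_parity[OF \<open>?j < _\<close>] even_mod_double by auto
qed

lemma cw_cyclic: "cyclically_mreduced (cw p)"
  unfolding cyclically_mreduced_def mreduced_iff
proof (intro allI impI)
  fix j i assume i: "Suc i < length (rotate j (cw p))"
  let ?n = "2 * length (snd p)"
  have par: "(rotate j (cw p) ! x = let_a) \<longleftrightarrow> (even (j + x) \<noteq> fst p)" if "x < ?n" for x
  proof -
    have "(j + x) mod ?n < ?n" using that by (intro mod_less_divisor) linarith
    from cw_parity[OF this] show ?thesis using that unfolding even_mod_double by (simp add: nth_rotate)
  qed
  show "(rotate j (cw p) ! i = let_a) \<noteq> (rotate j (cw p) ! Suc i = let_a)"
    using par[of i] par[of "Suc i"] i by auto
qed

text \<open>A reduced word that begins with \<open>a\<close> alternates and is thus some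
  \<open>W e\<close>; otherwise it begins with \<open>a\<close> after its last letter is moved to
  the front, which the rotation by \<open>2 * k - 1\<close> does.\<close>

lemma cyclic_is_cw:
  assumes w: "cyclically_mreduced w" and n: "length w = 2 * k" and k: "k > 0"
  shows "\<exists>p. length (snd p) = k \<and> w = cw p"
proof -
  have alt: "mreduced (rotate j w)" for j using w by (simp add: cyclically_mreduced_def)
  have W: "\<exists>e. length e = k \<and> v = W e" if v: "mreduced v" "length v = 2 * k" "v ! 0 = let_a" for v
  proof -
    have par: "i < 2 * k \<Longrightarrow> (v ! i = let_a) \<longleftrightarrow> even i" for i
    proof (induction i)
      case (Suc i)
      then show ?case using v(1,2) unfolding mreduced_iff by auto
    qed (use v in simp)
    define e where "e = map (\<lambda>i. v ! (2 * i + 1) = let_b) [0..<k]"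
    have "v = W e"
    proof (rule nth_equalityI)
      fix i assume i: "i < length v"
      show "v ! i = W e ! i"
      proof (cases "even i")
        case True
        then show ?thesis using par[of i] i v(2) W_parity[of i e] by (simp add: e_def)
      next
        case False
        then obtain j where j: "i = 2 * j + 1" by (elim oddE)
        then have "v ! i \<noteq> let_a" using par[of i] i v(2) False by simp
        then have "v ! i = bl (v ! i = let_b)" by (cases "v ! i") (auto simp: bl_def)
        then show ?thesis using nth_W(2)[of j e] i v(2) j by (simp add: e_def)
      qed
    qed (simp add: e_def v)
    then show ?thesis by (intro exI[of _ e]) (simp add: e_def)
  qed
  show ?thesis
  proof (cases "w ! 0 = let_a")
    case True
    then obtain e where "length e = k" "w = W e" using W[of w] alt[of 0] n by auto
    then show ?thesis by (intro exI[of _ "(False, e)"]) (simp add: cw_def)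
  next
    case False
    let ?v = "rotate (2 * k - 1) w"
    have m: "mreduced ?v" by (rule alt)
    have "?v ! 1 = w ! ((2 * k - 1 + 1) mod (2 * k))" using n k by (simp add: nth_rotate del: One_nat_def)
    then have "?v ! 1 = w ! 0" using k by simp
    then have "?v ! 0 = let_a" using m n k False unfolding mreduced_iff by (force dest: spec[of _ 0])
    then obtain e where e: "length e = k" "?v = W e" using W[of ?v] m n by auto
    have "rotate1 ?v = rotate (Suc (2 * k - 1)) w" by simp
    also have "\<dots> = w" using n k by (simp add: rotate_id)
    finally show ?thesis using e by (intro exI[of _ "(True, e)"]) (simp add: cw_def)
  qed
qed

lemma cw_inj:
  assumes "cw p = cw p'" "length (snd p) = k" "length (snd p') = k" "k > 0"
  shows "p = p'"
proof -
  have "fst p = fst p'" using cw_parity[of 0 p] cw_parity[of 0 p'] assms by simp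
  moreover have "W (snd p) = W (snd p')"
  proof (cases "fst p")
    case True
    have "rotate1 (W (snd p)) = rotate1 (W (snd p'))" using assms(1) True calculation by (simp add: cw_def)
    then show ?thesis using inj_rotate1 by (auto dest: injD)
  next
    case False
    then show ?thesis using assms(1) calculation by (simp add: cw_def)
  qed
  ultimately show ?thesis using W_inj prod_eqI by blast
qed

definition Ps :: "nat \<Rightarrow> nat \<Rightarrow> (bool \<times> bool list) list set" where
  "Ps m k = {ps. length ps = m \<and> (\<forall>p\<in>set ps. length (snd p) = k)}"

lemma finite_words: "finite {e :: bool list. length e = k}"
  using finite_lists_length_eq[of "UNIV :: bool set" k] by simp

lemma card_words: "card {e :: bool list. length e = k} = 2 ^ k"
  using card_lists_length_eq[of "UNIV :: bool set" k] by simp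

lemma Ps_eq: "Ps m k = {ps. set ps \<subseteq> UNIV \<times> {e. length e = k} \<and> length ps = m}"
  unfolding Ps_def by auto

lemma finite_Ps [simp]: "finite (Ps m k)"
  unfolding Ps_eq by (intro finite_lists_length_eq finite_cartesian_product finite_words) simp

lemma card_Ps: "card (Ps m k) = (2 * 2 ^ k) ^ m"
  unfolding Ps_eq by (subst card_lists_length_eq) (auto simp: finite_words card_cartesian_product card_words)

lemma tuples_growth:
  assumes m: "m \<ge> 1" and k: "k > 0"
  shows "{\<tau> \<in> tuples m. tuple_length \<tau> = 2 * k} = map cw ` Ps m k" and "inj_on (map cw) (Ps m k)"
proof -
  show "inj_on (map cw) (Ps m k)"
  proof (rule inj_onI)
    fix ps ps' assume a: "ps \<in> Ps m k" "ps' \<in> Ps m k" "map cw ps = map cw ps'"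
    show "ps = ps'"
    proof (rule nth_equalityI)
      show "length ps = length ps'" using a by (simp add: Ps_def)
      fix i assume i: "i < length ps"
      then have "cw (ps ! i) = cw (ps' ! i)" using a by (metis length_map nth_map)
      then show "ps ! i = ps' ! i" using a i k by (intro cw_inj[of _ _ k]) (auto simp: Ps_def)
    qed
  qed
  show "{\<tau> \<in> tuples m. tuple_length \<tau> = 2 * k} = map cw ` Ps m k"
  proof (intro subset_antisym subsetI)
    fix \<tau> assume "\<tau> \<in> {\<tau> \<in> tuples m. tuple_length \<tau> = 2 * k}"
    then have t: "length \<tau> = m" "\<And>r. r \<in> set \<tau> \<Longrightarrow> cyclically_mreduced r"
      "\<And>r r'. r \<in> set \<tau> \<Longrightarrow> r' \<in> set \<tau> \<Longrightarrow> length r = length r'" "tuple_length \<tau> = 2 * k" unfolding tuples_def by blast+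
    have len: "length r = 2 * k" if r: "r \<in> set \<tau>" for r
    proof -
      have "length ` set \<tau> = (\<lambda>_. length r) ` set \<tau>" by (rule image_cong[OF refl]) (rule t(3)[OF _ r])
      then have "length ` set \<tau> = {length r}" using r by auto
      then show ?thesis using t(4) by (simp add: tuple_length_def)
    qed
    have "\<forall>r\<in>set \<tau>. \<exists>p. length (snd p) = k \<and> r = cw p" using cyclic_is_cw[OF t(2) len k] by blast
    then obtain g where g: "\<And>r. r \<in> set \<tau> \<Longrightarrow> length (snd (g r)) = k \<and> r = cw (g r)" by metis
    have "\<tau> = map cw (map g \<tau>)" using g by (simp add: map_idI)
    moreover have "map g \<tau> \<in> Ps m k" using g t(1) by (simp add: Ps_def)
    ultimately show "\<tau> \<in> map cw ` Ps m k" by blast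
  next
    fix \<tau> assume "\<tau> \<in> map cw ` Ps m k"
    then obtain ps where ps: "ps \<in> Ps m k" "\<tau> = map cw ps" by blast
    have len: "\<forall>r\<in>set \<tau>. length r = 2 * k" using ps by (auto simp: Ps_def)
    have "set \<tau> \<noteq> {}" using ps m by (auto simp: Ps_def)
    moreover have "length ` set \<tau> = (\<lambda>_. 2 * k) ` set \<tau>" by (rule image_cong[OF refl]) (use len in blast)
    ultimately have "length ` set \<tau> = {2 * k}" by (simp only: image_constant_conv if_False)
    then have "tuple_length \<tau> = 2 * k" unfolding tuple_length_def by (simp only: Max_singleton)
    then show "\<tau> \<in> {\<tau> \<in> tuples m. tuple_length \<tau> = 2 * k}"
      using ps len cw_cyclic by (auto simp: tuples_def Ps_def)
  qed
qed

lemma growth_Ps: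
  assumes "m \<ge> 1" "k > 0" "S \<subseteq> tuples m"
  shows "growth (2 * k) S = card {ps \<in> Ps m k. map cw ps \<in> S}"
proof -
  have "{\<tau> \<in> S. tuple_length \<tau> = 2 * k} = {\<tau> \<in> tuples m. tuple_length \<tau> = 2 * k} \<inter> S" using assms(3) by blast
  also have "\<dots> = map cw ` {ps \<in> Ps m k. map cw ps \<in> S}" unfolding tuples_growth(1)[OF assms(1,2)] by blast
  finally have e: "{\<tau> \<in> S. tuple_length \<tau> = 2 * k} = map cw ` {ps \<in> Ps m k. map cw ps \<in> S}" .
  have "inj_on (map cw) {ps \<in> Ps m k. map cw ps \<in> S}"
    by (rule inj_on_subset[OF tuples_growth(2)[OF assms(1,2)]]) simp
  then show ?thesis unfolding growth_def e by (rule card_image)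
qed

section \<open>Genericity of tuples of sign words\<close>

definition per :: "bool list \<Rightarrow> int \<Rightarrow> bool" where
  "per e = (\<lambda>i. e ! nat (i mod int (length e)))"

lemma per_period: "per e (i + int (length e)) = per e i" by (simp add: per_def)

definition readings :: "(bool \<times> bool list) list \<Rightarrow> (int \<Rightarrow> bool) set" where
  "readings ps = {\<rho>. \<exists>c. \<exists>p\<in>set ps. \<rho> = rshift c (per (snd p))}"

text \<open>In this and the next two conditions positions range over one period only, so that there
  are finitely many events to count; periodicity and \<open>pattern_mod\<close> give back the
  general case.\<close>

definition distinct_subwords :: "nat \<Rightarrow> nat \<Rightarrow> (bool \<times> bool list) list \<Rightarrow> bool" where
  "distinct_subwords k D ps \<longleftrightarrow> (\<forall>i<length ps. \<forall>j<length ps. \<forall>c d. 0 \<le> c \<and> c < int k \<and> 0 \<le> d \<and> d < int k \<and>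
      (i, c) \<noteq> (j, d) \<longrightarrow> \<not> (\<forall>t. 0 \<le> t \<and> t < int D \<longrightarrow> per (snd (ps ! i)) (c + t) = per (snd (ps ! j)) (d + t)))"

definition no_inverse_subwords :: "nat \<Rightarrow> nat \<Rightarrow> (bool \<times> bool list) list \<Rightarrow> bool" where
  "no_inverse_subwords k D ps \<longleftrightarrow> (\<forall>i<length ps. \<forall>j<length ps. \<forall>c d. 0 \<le> c \<and> c < int k \<and> 0 \<le> d \<and> d < int k \<longrightarrow>
      \<not> (\<forall>t. 0 \<le> t \<and> t < int D \<longrightarrow> per (snd (ps ! i)) (c + t) = (\<not> per (snd (ps ! j)) (d - t))))"

definition no_patterns :: "nat \<Rightarrow> nat \<Rightarrow> (bool \<times> bool list) list \<Rightarrow> bool" where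
  "no_patterns k D ps \<longleftrightarrow> (\<forall>i<length ps. \<forall>c. 0 \<le> c \<and> c < int k \<longrightarrow> (\<forall>t j. 1 \<le> t \<and> t < D \<and> j < 2 * t + 1 \<longrightarrow>
      \<not> pattern (rshift c (per (snd (ps ! i)))) (k - 12 * D - 1) t j \<and>
      \<not> pattern (rinv (rshift c (per (snd (ps ! i))))) (k - 12 * D - 1) t j))"

definition generic :: "nat \<Rightarrow> nat \<Rightarrow> (bool \<times> bool list) list \<Rightarrow> bool" where
  "generic k D ps \<longleftrightarrow> distinct_subwords k D ps \<and> no_inverse_subwords k D ps \<and> no_patterns k D ps"

lemma readings_shift: "\<rho> \<in> readings ps \<Longrightarrow> rshift c \<rho> \<in> readings ps"
  unfolding readings_def using rshift_rshift by blast

lemma pattern_mod: "pattern \<rho> n t (j mod (2 * t + 1)) \<longleftrightarrow> pattern \<rho> n t j"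
  unfolding pattern_def by (simp add: mod_add_left_eq)

lemma rl_per: "length e = k \<Longrightarrow> 0 \<le> c \<Longrightarrow> c < int k \<Longrightarrow> rl (rshift c (per e)) 0 k = rotate (nat c) e"
  by (rule nth_equalityI) (auto simp: rshift_def per_def nth_rotate nat_mod_distrib nat_add_distrib add.commute)

text \<open>\<open>nf\<close> brings every reading to a position in one period, after which the
  three conditions yield \<open>overlap\<close>, \<open>oriented\<close>, \<open>prim\<close> and
  \<open>patternless\<close>. In \<open>neg\<close> the position is \<open>d - 1\<close>, as
  \<open>rinv\<close> reads the letter at \<open>- i - 1\<close>.\<close>

lemma generic_tuple:
  assumes ps: "ps \<in> Ps m k" and m: "m \<ge> 1" and g: "generic k D ps" and D: "D \<ge> 1" "40 * D + 40 \<le> k"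
  shows "generic_tuple (readings ps) k D (map cw ps)"
proof -
  have k: "k > 0" using D by simp
  have len: "length (snd (ps ! i)) = k" if "i < length ps" for i using ps that by (simp add: Ps_def)
  have nf: "\<exists>i<length ps. \<exists>c. 0 \<le> c \<and> c < int k \<and> \<rho> = rshift c (per (snd (ps ! i)))" if rho: "\<rho> \<in> readings ps" for \<rho>
  proof -
    obtain c p where "p \<in> set ps" "\<rho> = rshift c (per (snd p))" using rho unfolding readings_def by blast
    then obtain i where i: "i < length ps" "\<rho> = rshift c (per (snd (ps ! i)))" by (metis in_set_conv_nth)
    have "rshift c (per (snd (ps ! i))) = rshift (c mod int k) (per (snd (ps ! i)))"
      by (rule ext) (simp add: rshift_def per_def len[OF i(1)] mod_add_right_eq)
    then show ?thesis using i k by (intro exI[of _ i] conjI exI[of _ "c mod int k"]) auto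
  qed
  have mem: "rshift c (per (snd (ps ! i))) \<in> readings ps" if "i < length ps" for i c
    unfolding readings_def using nth_mem[OF that] by blast
  have pos: "\<rho> = \<sigma> \<and> (\<forall>i c j d. \<rho> = rshift c (per (snd (ps ! i))) \<longrightarrow> \<sigma> = rshift d (per (snd (ps ! j))) \<longrightarrow> i < length ps \<longrightarrow> j < length ps \<longrightarrow>
      0 \<le> c \<longrightarrow> c < int k \<longrightarrow> 0 \<le> d \<longrightarrow> d < int k \<longrightarrow> i = j \<and> c = d)"
    if r: "\<rho> \<in> readings ps" "\<sigma> \<in> readings ps" "\<And>i. 0 \<le> i \<Longrightarrow> i < int D \<Longrightarrow> \<rho> i = \<sigma> i" for \<rho> \<sigma>
  proof -
    have *: "i = j \<and> c = d" if "\<rho> = rshift c (per (snd (ps ! i)))" "\<sigma> = rshift d (per (snd (ps ! j)))" "i < length ps" "j < length ps"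
      "0 \<le> c" "c < int k" "0 \<le> d" "d < int k" for i c j d
    proof (rule ccontr)
      assume "\<not> (i = j \<and> c = d)"
      moreover have "\<forall>t. 0 \<le> t \<and> t < int D \<longrightarrow> per (snd (ps ! i)) (c + t) = per (snd (ps ! j)) (d + t)"
        using r(3) that(1,2) by (simp add: rshift_def add.commute)
      ultimately show False using g that unfolding generic_def distinct_subwords_def by blast
    qed
    obtain i c j d where "i < length ps" "0 \<le> c" "c < int k" "\<rho> = rshift c (per (snd (ps ! i)))"
      "j < length ps" "0 \<le> d" "d < int k" "\<sigma> = rshift d (per (snd (ps ! j)))" using nf[OF r(1)] nf[OF r(2)] by blast
    then have "\<rho> = \<sigma>" using * by blast
    then show ?thesis using * by blast
  qed
  have neg: False if r: "\<rho> \<in> readings ps" "\<sigma> \<in> readings ps" "\<And>i. 0 \<le> i \<Longrightarrow> i < int D \<Longrightarrow> \<rho> i = rinv \<sigma> i" for \<rho> \<sigma>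
  proof -
    obtain i c j d where a: "i < length ps" "0 \<le> c" "c < int k" "\<rho> = rshift c (per (snd (ps ! i)))"
      "j < length ps" "\<sigma> = rshift d (per (snd (ps ! j)))" using nf[OF r(1)] nf[OF r(2)] by blast
    let ?d = "(d - 1) mod int k"
    have d: "0 \<le> ?d" "?d < int k" using k by auto
    have "per (snd (ps ! i)) (c + t) = (\<not> per (snd (ps ! j)) (?d - t))" if "0 \<le> t" "t < int D" for t
    proof -
      have "per (snd (ps ! j)) (?d - t) = per (snd (ps ! j)) (d - 1 - t)"
        by (simp add: per_def len[OF a(5)] mod_diff_left_eq)
      moreover have "d - 1 - t = - t - 1 + d" by simp
      ultimately show ?thesis using r(3)[OF that] a(4,6) by (simp add: rshift_def rinv_def add.commute)
    qed
    then show False using g a d unfolding generic_def no_inverse_subwords_def by blast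
  qed
  have sc: "small_cancel (readings ps) k D"
  proof unfold_locales
    fix \<rho> :: "int \<Rightarrow> bool" and c :: int
    assume r: "\<rho> \<in> readings ps"
    show "rshift c \<rho> \<in> readings ps" using r by (rule readings_shift)
    obtain i d where i: "i < length ps" "0 \<le> d" "d < int k" "\<rho> = rshift d (per (snd (ps ! i)))" using nf[OF r] by blast
    show "\<rho> (x + int k) = \<rho> x" for x
      using per_period[of "snd (ps ! i)" "x + d"] len[OF i(1)] by (simp add: i rshift_def algebra_simps)
    show "rinv \<rho> \<notin> readings ps" using neg[of "rinv \<rho>" \<rho>] r by auto
  next
    fix \<rho> \<sigma> assume r: "\<rho> \<in> readings ps \<union> rinv ` readings ps" "\<sigma> \<in> readings ps \<union> rinv ` readings ps"
      and e: "\<And>i. 0 \<le> i \<Longrightarrow> i < int D \<Longrightarrow> \<rho> i = \<sigma> i"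
    from r show "\<rho> = \<sigma>"
    proof (elim UnE)
      assume "\<rho> \<in> readings ps" "\<sigma> \<in> readings ps"
      then show ?thesis using pos e by blast
    next
      assume a: "\<rho> \<in> readings ps" "\<sigma> \<in> rinv ` readings ps"
      then obtain \<sigma>' where "\<sigma>' \<in> readings ps" "\<sigma> = rinv \<sigma>'" by blast
      then show ?thesis using neg[OF a(1), of \<sigma>'] e by blast
    next
      assume a: "\<rho> \<in> rinv ` readings ps" "\<sigma> \<in> readings ps"
      then obtain \<rho>' where "\<rho>' \<in> readings ps" "\<rho> = rinv \<rho>'" by blast
      then show ?thesis using neg[OF a(2), of \<rho>'] e by metis
    next
      assume "\<rho> \<in> rinv ` readings ps" "\<sigma> \<in> rinv ` readings ps"
      then obtain \<rho>' \<sigma>' where s: "\<rho>' \<in> readings ps" "\<rho> = rinv \<rho>'" "\<sigma>' \<in> readings ps" "\<sigma> = rinv \<sigma>'" by blast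
      note sh = readings_shift[where ps = ps]
      \<comment> \<open>\<open>rinv\<close> carries the window from \<open>0\<close> to
        \<open>D\<close> to the one from \<open>- D\<close> to \<open>0\<close>, hence the
        shift.\<close>
      have "rshift (- int D) \<rho>' = rshift (- int D) \<sigma>'"
      proof -
        have "rshift (- int D) \<rho>' x = rshift (- int D) \<sigma>' x" if "0 \<le> x" "x < int D" for x
          using e[of "int D - x - 1"] that s by (simp add: rinv_def rshift_def)
        then show ?thesis using pos[OF sh[OF s(1)] sh[OF s(3)]] by blast
      qed
      then have "rshift (int D) (rshift (- int D) \<rho>') = rshift (int D) (rshift (- int D) \<sigma>')" by simp
      then show ?thesis using s by simp
    qed
  next
    have "ps ! 0 \<in> set ps" using ps m by (simp add: Ps_def)
    then show "readings ps \<noteq> {}" by (auto simp: readings_def)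
  qed (use D in auto)
  show ?thesis
  proof (intro generic_tuple.intro[OF sc] generic_tuple_axioms.intro)
    fix \<rho> c assume r: "\<rho> \<in> readings ps" and e: "rshift c \<rho> = \<rho>"
    obtain i d where i: "i < length ps" "0 \<le> d" "d < int k" "\<rho> = rshift d (per (snd (ps ! i)))" using nf[OF r] by blast
    have "rshift c \<rho> = rshift ((c + d) mod int k) (per (snd (ps ! i)))"
      by (rule ext) (simp add: i(4) rshift_def per_def len[OF i(1)] mod_add_right_eq algebra_simps)
    then have "\<rho> = rshift ((c + d) mod int k) (per (snd (ps ! i)))" using e by simp
    moreover have "0 \<le> (c + d) mod int k" "(c + d) mod int k < int k" using k by auto
    ultimately have "(c + d) mod int k = d" using pos[OF r r refl] i by blast
    then have "(c + d) mod int k = d mod int k" using i by simp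
    then show "int k dvd c" by (simp add: mod_eq_dvd_iff)
  next
    fix r assume "r \<in> set (map cw ps)"
    then obtain i where i: "i < length ps" "r = cw (ps ! i)" by (auto simp: in_set_conv_nth)
    have "rl (rshift 0 (per (snd (ps ! i)))) 0 k = snd (ps ! i)" using rl_per[OF len[OF i(1)], of 0] k by simp
    then show "\<exists>\<rho>\<in>readings ps. r = W (rl \<rho> 0 k) \<or> r = rotate1 (W (rl \<rho> 0 k))"
      using i(2) by (intro bexI[OF _ mem[OF i(1), of 0]]) (simp add: cw_def)
  next
    fix \<rho> t j assume r: "\<rho> \<in> readings ps \<union> rinv ` readings ps" and t: "1 \<le> t" "t < D"
    have "j mod (2 * t + 1) < 2 * t + 1" by simp
    have p: "\<not> pattern \<sigma> (k - 12 * D - 1) t (j mod (2 * t + 1)) \<and> \<not> pattern (rinv \<sigma>) (k - 12 * D - 1) t (j mod (2 * t + 1))"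
      if s: "\<sigma> \<in> readings ps" for \<sigma>
    proof -
      obtain i c where "i < length ps" "0 \<le> c" "c < int k" "\<sigma> = rshift c (per (snd (ps ! i)))" using nf[OF s] by blast
      then show ?thesis using g t \<open>j mod (2 * t + 1) < 2 * t + 1\<close> unfolding generic_def no_patterns_def by blast
    qed
    then have "\<not> pattern \<rho> (k - 12 * D - 1) t (j mod (2 * t + 1))" using r by blast
    then show "\<not> pattern \<rho> (small_cancel.q k D - 1) t j"
      unfolding pattern_mod small_cancel.q_def[OF sc] .
  next
    fix \<rho> assume r: "\<rho> \<in> readings ps"
    obtain i d where i: "i < length ps" "0 \<le> d" "d < int k" "\<rho> = rshift d (per (snd (ps ! i)))" using nf[OF r] by blast
    show "ev (map cw ps) (W (rl \<rho> 0 k)) = ev (map cw ps) []"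
    proof -
      have "W (rl \<rho> 0 k) = W (rotate (nat d) (snd (ps ! i)))" using rl_per[OF len[OF i(1)] i(2,3)] i(4) by simp
      moreover have "cj (map cw ps) (W (rotate (nat d) (snd (ps ! i)))) (W (snd (ps ! i)))"
      proof -
        let ?e = "snd (ps ! i)" and ?j = "nat d mod length (snd (ps ! i))"
        have "W (rotate (nat d) ?e) = W (drop ?j ?e) @ W (take ?j ?e)" by (simp add: rotate_drop_take)
        moreover have "W ?e = W (take ?j ?e) @ W (drop ?j ?e)" by (simp flip: W_simps(3))
        ultimately show ?thesis using cj_rot by metis
      qed
      moreover have "cj (map cw ps) (W (snd (ps ! i))) (cw (ps ! i))"
      proof (cases "fst (ps ! i)")
        case True
        obtain s e where e: "snd (ps ! i) = s # e" using len[OF i(1)] k by (cases "snd (ps ! i)") auto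
        have "cj (map cw ps) ([let_a] @ (bl s # W e)) ((bl s # W e) @ [let_a])" by (rule cj_rot)
        then show ?thesis using True by (simp add: cw_def e)
      next
        case False
        then show ?thesis by (simp add: cw_def cj_ev)
      qed
      moreover have "ev (map cw ps) (cw (ps ! i)) = ev (map cw ps) []" using ev_relator[of "cw (ps ! i)" "map cw ps"] i(1) by simp
      ultimately show ?thesis using cj_trivial by metis
    qed
  qed (use D in auto)
qed

section \<open>Counting tuples that are not generic\<close>

lemma determined_card:
  assumes i: "i < m" and S: "S \<subseteq> Ps m k" and Q: "Q \<subseteq> {..<k}"
    and det: "\<And>ps ps'. ps \<in> S \<Longrightarrow> ps' \<in> S \<Longrightarrow> (\<And>j. j < m \<Longrightarrow> j \<noteq> i \<Longrightarrow> ps ! j = ps' ! j) \<Longrightarrow>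
      (\<And>x. x < k \<Longrightarrow> x \<notin> Q \<Longrightarrow> snd (ps ! i) ! x = snd (ps' ! i) ! x) \<Longrightarrow> snd (ps ! i) = snd (ps' ! i)"
  shows "card S * 2 ^ card Q \<le> card (Ps m k)"
proof -
  \<comment> \<open>Flipping letters at any subset \<open>X\<close> of \<open>Q\<close> loses no
    information: the letters outside \<open>Q\<close> are unchanged, \<open>det\<close> recovers the
    original word from them, and comparison gives back \<open>X\<close>.\<close>
  define f where "f = (\<lambda>(ps :: (bool \<times> bool list) list, X). ps[i := (fst (ps ! i), map (\<lambda>x. (snd (ps ! i) ! x) \<noteq> (x \<in> X)) [0..<k])])"
  have fin: "finite Q" using Q finite_subset by blast
  have len: "length ps = m" "\<And>j. j < m \<Longrightarrow> length (snd (ps ! j)) = k" if "ps \<in> S" for ps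
    using that S by (auto simp: Ps_def)
  have inj: "inj_on f (S \<times> Pow Q)"
  proof (rule inj_onI, clarify)
    fix ps X ps' X' assume a: "ps \<in> S" "X \<subseteq> Q" "ps' \<in> S" "X' \<subseteq> Q" "f (ps, X) = f (ps', X')"
    note l = len[OF a(1)] len[OF a(3)]
    have other: "ps ! j = ps' ! j" if "j < m" "j \<noteq> i" for j
      using arg_cong[OF a(5), of "\<lambda>v. v ! j"] that by (simp add: f_def)
    have at: "f (ps, X) ! i = f (ps', X') ! i" using a(5) by simp
    then have fst_eq: "fst (ps ! i) = fst (ps' ! i)" using i l by (simp add: f_def)
    have val: "(snd (ps ! i) ! x \<noteq> (x \<in> X)) = (snd (ps' ! i) ! x \<noteq> (x \<in> X'))" if "x < k" for x
      using arg_cong[OF at, of "\<lambda>v. snd v ! x"] i l that by (simp add: f_def)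
    have snd_eq: "snd (ps ! i) = snd (ps' ! i)"
    proof (rule det[OF a(1,3) other])
      show "snd (ps ! i) ! x = snd (ps' ! i) ! x" if "x < k" "x \<notin> Q" for x using val[OF that(1)] that(2) a by blast
    qed
    have "ps = ps'"
    proof (rule nth_equalityI)
      show "ps ! j = ps' ! j" if "j < length ps" for j
        using other[of j] fst_eq snd_eq that l by (cases "j = i") (auto simp: prod_eq_iff)
    qed (use l in simp)
    moreover have "X = X'"
    proof -
      have "x \<in> X \<longleftrightarrow> x \<in> X'" for x
        using val[of x] snd_eq a(2,4) Q by (cases "x < k") auto
      then show ?thesis by blast
    qed
    ultimately show "ps = ps' \<and> X = X'" by blast
  qed
  have "f ` (S \<times> Pow Q) \<subseteq> Ps m k"
  proof (rule image_subsetI, clarify)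
    fix ps X assume "ps \<in> S" "X \<subseteq> Q"
    then have "ps \<in> Ps m k" using S by blast
    then show "f (ps, X) \<in> Ps m k"
      using set_update_subset_insert[of ps i] unfolding f_def Ps_def by fastforce
  qed
  then have "card (S \<times> Pow Q) \<le> card (Ps m k)" by (rule card_inj_on_le[OF inj _ finite_Ps])
  then show ?thesis using fin by (simp add: card_cartesian_product card_Pow)
qed

definition idx :: "nat \<Rightarrow> int \<Rightarrow> nat" where "idx k x = nat (x mod int k)"

lemma idx_less: "k > 0 \<Longrightarrow> idx k x < k" by (simp add: idx_def nat_less_iff)

lemma idx_eq: "k > 0 \<Longrightarrow> idx k x = idx k y \<longleftrightarrow> int k dvd x - y"
  by (simp add: idx_def eq_nat_nat_iff flip: mod_eq_dvd_iff)

lemma per_idx: "length e = k \<Longrightarrow> per e x = e ! idx k x" by (simp add: per_def idx_def)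

lemma small_dvd: "int k dvd x \<Longrightarrow> \<bar>x\<bar> < int k \<Longrightarrow> x = 0"
  using dvd_imp_le_int[of x "int k"] by (cases "x = 0") auto

lemma idx_inj:
  assumes "k > 0" "\<And>x y. x \<in> T \<Longrightarrow> y \<in> T \<Longrightarrow> \<bar>x - y\<bar> < int k"
  shows "inj_on (\<lambda>t. idx k (d + t)) T" "inj_on (\<lambda>t. idx k (d - t)) T"
proof -
  have eq: "x = y" if "x \<in> T" "y \<in> T" "int k dvd x - y" for x y
    using small_dvd[OF that(3)] assms(2)[OF that(1,2)] by simp
  show "inj_on (\<lambda>t. idx k (d + t)) T"
  proof (rule inj_onI)
    fix x y assume xy: "x \<in> T" "y \<in> T" "idx k (d + x) = idx k (d + y)"
    have "int k dvd (d + x) - (d + y)" using xy(3) idx_eq[OF assms(1)] by blast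
    then show "x = y" using eq[OF xy(1,2)] by simp
  qed
  show "inj_on (\<lambda>t. idx k (d - t)) T"
  proof (rule inj_onI)
    fix x y assume xy: "x \<in> T" "y \<in> T" "idx k (d - x) = idx k (d - y)"
    have "int k dvd (d - x) - (d - y)" using xy(3) idx_eq[OF assms(1)] by blast
    then have "int k dvd y - x" by simp
    then show "x = y" using eq[OF xy(2,1)] by simp
  qed
qed

lemma words_eqI:
  assumes "length e = k" "length e' = k" "\<And>x. x < k \<Longrightarrow> x \<notin> idx k ` G \<Longrightarrow> e ! x = e' ! x"
    "\<And>g. g \<in> G \<Longrightarrow> per e g = per e' g"
  shows "e = e'"
proof (rule nth_equalityI)
  fix x assume "x < length e"
  then show "e ! x = e' ! x"
    using assms by (cases "x \<in> idx k ` G") (auto simp: per_idx)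
qed (use assms in simp)

abbreviation letters :: "(bool \<times> bool list) list \<Rightarrow> nat \<Rightarrow> int \<Rightarrow> bool" where
  "letters ps i \<equiv> per (snd (ps ! i))"

definition same_event where
  "same_event m k D i c j d = {ps \<in> Ps m k. \<forall>t. 0 \<le> t \<and> t < int D \<longrightarrow> letters ps i (c + t) = letters ps j (d + t)}"

definition inverse_event where
  "inverse_event m k D i c j d = {ps \<in> Ps m k. \<forall>t. 0 \<le> t \<and> t < int D \<longrightarrow> letters ps i (c + t) = (\<not> letters ps j (d - t))}"

lemma Ps_len: "ps \<in> Ps m k \<Longrightarrow> i < m \<Longrightarrow> length (snd (ps ! i)) = k"
  by (simp add: Ps_def)

lemma card_idx_seg:
  assumes "n \<le> k" "k > 0"
  shows "card (idx k ` (\<lambda>t. d + t) ` {a..<a + int n}) = n" "card (idx k ` (\<lambda>t. d - t) ` {a..<a + int n}) = n"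
proof -
  have d: "\<bar>x - y\<bar> < int k" if "x \<in> {a..<a + int n}" "y \<in> {a..<a + int n}" for x y using that assms by auto
  show "card (idx k ` (\<lambda>t. d + t) ` {a..<a + int n}) = n" "card (idx k ` (\<lambda>t. d - t) ` {a..<a + int n}) = n"
    unfolding image_image by (subst card_image[OF idx_inj(1)[OF assms(2)]] card_image[OF idx_inj(2)[OF assms(2)]]; simp add: d)+
qed

text \<open>The letters of the window at \<open>d\<close> are determined from left to right: each
  equals the letter \<open>s = (d - c) mod k\<close> places before it, which lies outside the window
  or further left in it. As \<open>s\<close> is at most half of \<open>k\<close>, the window is not
  met a second time around the cycle.\<close>

lemma same_event_shift:
  assumes i: "i < m" and k: "2 * D < k" and s: "0 < (d - c) mod int k" "2 * ((d - c) mod int k) \<le> int k"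
  shows "card (same_event m k D i c i d) * 2 ^ D \<le> card (Ps m k)"
proof -
  let ?G = "(\<lambda>t. d + t) ` {0..<0 + int D}"
  define s where "s = (d - c) mod int k"
  have "card (same_event m k D i c i d) * 2 ^ card (idx k ` ?G) \<le> card (Ps m k)"
  proof (rule determined_card[OF i])
    show "idx k ` ?G \<subseteq> {..<k}" using idx_less k by auto
    fix ps ps' assume a: "ps \<in> same_event m k D i c i d" "ps' \<in> same_event m k D i c i d"
      "\<And>x. x < k \<Longrightarrow> x \<notin> idx k ` ?G \<Longrightarrow> snd (ps ! i) ! x = snd (ps' ! i) ! x"
    have len: "length (snd (ps ! i)) = k" "length (snd (ps' ! i)) = k" using a i by (auto simp: same_event_def Ps_len)
    have st: "letters ps i (c + int t) = letters ps i (d + int t)" "letters ps' i (c + int t) = letters ps' i (d + int t)"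
      if "t < D" for t using a(1,2) that by (auto simp: same_event_def)
    have "t < D \<Longrightarrow> letters ps i (d + int t) = letters ps' i (d + int t)" for t
    proof (induction t rule: less_induct)
      case (less t)
      have "letters ps i (c + int t) = letters ps' i (c + int t)"
      proof (cases "idx k (c + int t) \<in> idx k ` ?G")
        case True
        then obtain u where u: "0 \<le> u" "u < int D" "idx k (c + int t) = idx k (d + u)"
          unfolding image_image by (elim imageE) (rule that, auto)
        then have "int k dvd (c + int t) - (d + u)" using idx_eq[of k] k by simp
        moreover have "int k dvd (d - c) - s" unfolding s_def by (simp add: mod_eq_dvd_iff[symmetric])
        ultimately have "int k dvd ((c + int t) - (d + u)) + ((d - c) - s)" by (rule dvd_add)
        then have "int k dvd int t - u - s" by (simp add: algebra_simps)
        moreover have "\<bar>int t - u - s\<bar> < int k" using u less.prems k s unfolding s_def[symmetric] by linarith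
        ultimately have "int t - u - s = 0" by (rule small_dvd)
        then have "u = int (nat u)" "nat u < t" using u s unfolding s_def[symmetric] by auto
        then have "letters ps i (d + u) = letters ps' i (d + u)" using less.IH[of "nat u"] less.prems u by simp
        then show ?thesis using u(3) len by (simp add: per_idx)
      next
        case False
        then show ?thesis using a(3) len idx_less k by (simp add: per_idx)
      qed
      then show ?case using st[OF less.prems] by simp
    qed
    then have "letters ps i g = letters ps' i g" if g: "g \<in> ?G" for g
    proof -
      obtain u where u: "0 \<le> u" "u < int D" "g = d + u" using g by (elim imageE) (rule that, auto)
      then show ?thesis using \<open>\<And>t. t < D \<Longrightarrow> letters ps i (d + int t) = letters ps' i (d + int t)\<close>[of "nat u"] by simp
    qed
    then show "snd (ps ! i) = snd (ps' ! i)" using words_eqI[OF len a(3)] by blast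
  qed (auto simp: same_event_def)
  then show ?thesis using card_idx_seg(1)[of D k d 0] k by simp
qed

text \<open>Within one word the windows may be exchanged, which brings the shift below half of
  \<open>k\<close>; for two different words the second window is copied from the first.\<close>

lemma card_same_event:
  assumes ij: "i < m" "j < m" and k: "2 * D < k" and c: "0 \<le> c" "c < int k" "0 \<le> d" "d < int k" and ne: "(i, c) \<noteq> (j, d)"
  shows "card (same_event m k D i c j d) * 2 ^ D \<le> card (Ps m k)"
proof (cases "i = j")
  case True
  then have "c \<noteq> d" using ne by simp
  have sym: "same_event m k D i c i d = same_event m k D i d i c" unfolding same_event_def by (auto simp: eq_commute)
  have nz: "(d - c) mod int k \<noteq> 0"
  proof
    assume "(d - c) mod int k = 0"
    then have "int k dvd d - c" by (simp add: mod_eq_0_iff_dvd)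
    then have "d - c = 0" by (rule small_dvd) (use c in linarith)
    then show False using \<open>c \<noteq> d\<close> by simp
  qed
  have k0: "int k > 0" using k by simp
  have pos: "0 < (d - c) mod int k" using nz pos_mod_sign[OF k0, of "d - c"] by linarith
  show ?thesis
  proof (cases "2 * ((d - c) mod int k) \<le> int k")
    case le: True
    then show ?thesis using same_event_shift[OF ij(1) k pos] True by simp
  next
    case False
    have "(c - d) mod int k = int k - (d - c) mod int k"
      using zmod_zminus1_eq_if[of "d - c" "int k"] nz by simp
    then show ?thesis using same_event_shift[OF ij(1) k, of c d] False True sym pos_mod_bound[OF k0, of "d - c"] by simp
  qed
next
  case False
  let ?G = "(\<lambda>t. d + t) ` {0..<0 + int D}"
  have "card (same_event m k D i c j d) * 2 ^ card (idx k ` ?G) \<le> card (Ps m k)"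
  proof (rule determined_card[OF ij(2)])
    show "idx k ` ?G \<subseteq> {..<k}" using idx_less k by auto
    fix ps ps' assume a: "ps \<in> same_event m k D i c j d" "ps' \<in> same_event m k D i c j d"
      "\<And>x. x < m \<Longrightarrow> x \<noteq> j \<Longrightarrow> ps ! x = ps' ! x"
      "\<And>x. x < k \<Longrightarrow> x \<notin> idx k ` ?G \<Longrightarrow> snd (ps ! j) ! x = snd (ps' ! j) ! x"
    have len: "length (snd (ps ! j)) = k" "length (snd (ps' ! j)) = k" using a ij by (auto simp: same_event_def Ps_len)
    have "letters ps j g = letters ps' j g" if g: "g \<in> ?G" for g
    proof -
      obtain u where u: "0 \<le> u" "u < int D" "g = d + u" using g by (elim imageE) (rule that, auto)
      have "letters ps j (d + u) = letters ps i (c + u)" "letters ps' j (d + u) = letters ps' i (c + u)"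
        using a(1,2) u by (auto simp: same_event_def)
      then show ?thesis using a(3)[OF ij(1) False] u by simp
    qed
    then show "snd (ps ! j) = snd (ps' ! j)" using words_eqI[OF len a(4)] by blast
  qed (auto simp: same_event_def)
  then show ?thesis using card_idx_seg(1)[of D k d 0] k by simp
qed

text \<open>As one window is read backwards, the two may overlap and tie a letter to itself. The
  positions \<open>c + t\<close> and \<open>d - u\<close> meet only if \<open>t + u = s\<close>
  modulo \<open>k\<close>; so half of the window is used, and its start \<open>a\<close> is chosen
  to keep \<open>t + u\<close> entirely below or entirely above \<open>s\<close>.\<close>

lemma card_inverse_event:
  assumes ij: "i < m" "j < m" and k: "2 * D < k" and c: "0 \<le> c" "c < int k" "0 \<le> d" "d < int k"
  shows "card (inverse_event m k D i c j d) * 2 ^ (D div 2) \<le> card (Ps m k)"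
proof -
  define s where "s = (d - c) mod int k"
  define h where "h = int (D div 2)"
  define a where "a = (if s < 2 * h then h else 0)"
  have k0: "int k > 0" using k by simp
  have s: "0 \<le> s" "s < int k" using k0 by (auto simp: s_def)
  have h: "0 \<le> h" "2 * h \<le> int D" "a = 0 \<or> a = h" unfolding h_def a_def by auto
  let ?G = "(\<lambda>t. d - t) ` {a..<a + int (D div 2)}"
  have off: "idx k (c + t) \<notin> idx k ` ?G" if t: "a \<le> t" "t < a + h" for t
  proof
    assume "idx k (c + t) \<in> idx k ` ?G"
    then obtain u where u: "a \<le> u" "u < a + h" "idx k (c + t) = idx k (d - u)"
      unfolding image_image by (elim imageE) (rule that, auto simp: h_def)
    then have "int k dvd (c + t) - (d - u)" using idx_eq[of k] k by simp
    moreover have "int k dvd (d - c) - s" unfolding s_def by (simp add: mod_eq_dvd_iff[symmetric])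
    ultimately have "int k dvd ((c + t) - (d - u)) + ((d - c) - s)" by (rule dvd_add)
    then have "int k dvd t + u - s" by (simp add: algebra_simps)
    moreover have "\<bar>t + u - s\<bar> < int k" using u t s h k by linarith
    ultimately have "t + u - s = 0" by (rule small_dvd)
    then show False using u t h unfolding a_def by (auto split: if_splits)
  qed
  have "card (inverse_event m k D i c j d) * 2 ^ card (idx k ` ?G) \<le> card (Ps m k)"
  proof (rule determined_card[OF ij(2)])
    show "idx k ` ?G \<subseteq> {..<k}" using idx_less k by auto
    fix ps ps' assume b: "ps \<in> inverse_event m k D i c j d" "ps' \<in> inverse_event m k D i c j d"
      "\<And>x. x < m \<Longrightarrow> x \<noteq> j \<Longrightarrow> ps ! x = ps' ! x"
      "\<And>x. x < k \<Longrightarrow> x \<notin> idx k ` ?G \<Longrightarrow> snd (ps ! j) ! x = snd (ps' ! j) ! x"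
    have len: "length (snd (ps ! x)) = k" "length (snd (ps' ! x)) = k" if "x < m" for x
      using b that by (auto simp: inverse_event_def Ps_len)
    have "letters ps j g = letters ps' j g" if g: "g \<in> ?G" for g
    proof -
      obtain t where t: "a \<le> t" "t < a + h" "g = d - t" using g by (elim imageE) (rule that, auto simp: h_def)
      have tD: "0 \<le> t \<and> t < int D" using t h by auto
      have "letters ps i (c + t) = letters ps' i (c + t)"
      proof (cases "i = j")
        case True
        then show ?thesis using b(4)[OF idx_less off[OF t(1,2)]] len[OF ij(2)] k by (simp add: per_idx)
      qed (use b(3)[OF ij(1)] in simp)
      then show ?thesis using b(1,2) tD unfolding t(3) inverse_event_def by blast
    qed
    then show "snd (ps ! j) = snd (ps' ! j)" using words_eqI[OF len(1)[OF ij(2)] len(2)[OF ij(2)] b(4)] by blast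
  qed (auto simp: inverse_event_def)
  then show ?thesis using card_idx_seg(2)[of "D div 2" k d a] k by simp
qed

text \<open>The positions whose letters the pattern forces as negations of earlier letters.\<close>

definition forced :: "nat \<Rightarrow> nat \<Rightarrow> nat \<Rightarrow> nat set" where
  "forced n t j = {y. y < n \<and> (j + y) mod (2 * t + 1) < t \<and> 2 * ((j + y) mod (2 * t + 1)) + 1 \<le> y}"

text \<open>The mirror image of \<open>y\<close> in the junction before it is \<open>x - s\<close>,
  whose residue \<open>2 * t - s\<close> exceeds \<open>t\<close>. So it is not forced itself, and
  its letter decides the one at \<open>y\<close>.\<close>

lemma pattern_determined:
  assumes p: "pattern \<rho> n t j" "pattern \<rho>' n t j" and y: "y \<in> forced n t j"
    and eq: "\<And>x. x < n \<Longrightarrow> x \<notin> forced n t j \<Longrightarrow> \<rho> (int x) = \<rho>' (int x)"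
  shows "\<rho> (int y) = \<rho>' (int y)"
proof -
  let ?P = "2 * t + 1"
  define s where "s = (j + y) mod ?P"
  define b where "b = (j + y) div ?P"
  have jy: "j + y = ?P * b + s" unfolding s_def b_def by (simp only: mult_div_mod_eq)
  have s: "y < n" "s < t" "2 * s + 1 \<le> y" using y unfolding forced_def s_def by auto
  have "b \<noteq> 0"
  proof
    assume "b = 0"
    then have "j + y = s" using jy by simp
    then show False using s by simp
  qed
  then obtain b' where b': "b = Suc b'" by (cases b) auto
  define x where "x = y - 1 - s"
  have jx: "j + x = ?P * b' + 2 * t" using jy s by (simp add: b' x_def)
  have mx: "(j + x) mod ?P = 2 * t" unfolding jx by (simp only: mod_mult_self4) simp
  have r: "\<rho>1 (int x - int s) = (\<not> \<rho>1 (int y))" if "pattern \<rho>1 n t j" for \<rho>1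
  proof -
    have "\<rho>1 (int x - int s) = (\<not> \<rho>1 (int x + 1 + int s))"
      using that[unfolded pattern_def, rule_format, OF mx s(2)] s by (simp add: x_def)
    moreover have "int x + 1 + int s = int y" using s by (simp add: x_def)
    ultimately show ?thesis by simp
  qed
  have "j + (x - s) = ?P * b' + (2 * t - s)" using jx s by (simp add: x_def)
  then have "(j + (x - s)) mod ?P = 2 * t - s" by (simp only: mod_mult_self4) simp
  then have "x - s \<notin> forced n t j" using s by (simp add: forced_def)
  then have "\<rho> (int (x - s)) = \<rho>' (int (x - s))" using eq[of "x - s"] s by (simp add: x_def)
  moreover have "int (x - s) = int x - int s" using s by (simp add: x_def of_nat_diff)
  ultimately have "\<rho> (int x - int s) = \<rho>' (int x - int s)" by simp
  then show ?thesis using r[OF p(1)] r[OF p(2)] by blast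
qed

text \<open>The positions \<open>?y i\<close> run through the residues below \<open>t\<close> in
  successive blocks. They start at \<open>?P * 2 - j\<close>, late enough for all mirror images to
  be nonnegative, and \<open>10 * D\<close> letters leave room for \<open>D div 2\<close> of
  them.\<close>

lemma card_forced:
  assumes t: "1 \<le> t" "t < D" and n: "10 * D \<le> n" and j: "j < 2 * t + 1"
  shows "D div 2 \<le> card (forced n t j)"
proof -
  let ?P = "2 * t + 1"
  let ?y = "\<lambda>i. ?P * 2 - j + (?P * (i div t) + i mod t)"
  have res: "(j + ?y i) mod ?P = i mod t" for i
  proof -
    have "j + ?y i = ?P * (2 + i div t) + i mod t" using j by (simp add: algebra_simps)
    moreover have "i mod t < ?P" using t mod_less_divisor[of t i] by linarith
    ultimately show ?thesis by (simp only: mod_mult_self4) simp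
  qed
  have "inj_on ?y {..<D div 2}"
  proof (rule inj_onI)
    fix x y assume "?y x = ?y y"
    then have e: "?P * (x div t) + x mod t = ?P * (y div t) + y mod t" by simp
    have r: "(?P * (z div t) + z mod t) mod ?P = z mod t" for z
    proof -
      have "z mod t < ?P" using t mod_less_divisor[of t z] by linarith
      then show ?thesis by (simp only: mod_mult_self4) simp
    qed
    have "x mod t = y mod t" using r[of x] r[of y] e by simp
    moreover from this have "?P * (x div t) = ?P * (y div t)" using e by linarith
    then have "x div t = y div t" by (simp only: mult_cancel1) simp
    ultimately have "x div t = y div t \<and> x mod t = y mod t" by blast
    then show "x = y" by (metis mult_div_mod_eq)
  qed
  moreover have "?y ` {..<D div 2} \<subseteq> forced n t j"
  proof (rule image_subsetI)
    fix i assume i: "i \<in> {..<D div 2}"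
    have m: "i mod t < t" using t by simp
    have "t * (i div t) \<le> i" by simp
    moreover have "i div t \<le> i" by simp
    moreover have "?P * (i div t) = 2 * (t * (i div t)) + i div t" by (simp add: algebra_simps)
    ultimately have "?P * (i div t) \<le> 3 * i" by linarith
    moreover have "i < D" using i by simp
    moreover have "?y i \<le> 4 * t + 2 + (?P * (i div t) + i mod t)" by simp
    ultimately have "?y i < n" using m n t by linarith
    moreover have "2 * (i mod t) + 1 \<le> ?y i" using m j by simp
    ultimately show "?y i \<in> forced n t j" unfolding forced_def mem_Collect_eq res using m by simp
  qed
  moreover have "finite (forced n t j)" unfolding forced_def by simp
  ultimately have "card {..<D div 2} \<le> card (forced n t j)" by (rule card_inj_on_le)
  then show ?thesis by simp
qed

definition reading :: "bool \<Rightarrow> int \<Rightarrow> bool list \<Rightarrow> int \<Rightarrow> bool" where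
  "reading b c e = (if b then rshift c (per e) else rinv (rshift c (per e)))"

definition pattern_event where
  "pattern_event m k n b i c t j = {ps \<in> Ps m k. pattern (reading b c (snd (ps ! i))) n t j}"

lemma card_pattern_event:
  assumes i: "i < m" and t: "1 \<le> t" "t < D" and n: "10 * D \<le> n" "n < k" and j: "j < 2 * t + 1"
  shows "card (pattern_event m k n b i c t j) * 2 ^ (D div 2) \<le> card (Ps m k)"
proof -
  define pos where "pos = (\<lambda>y. if b then c + int y else c - 1 - int y)"
  have k: "k > 0" using n by simp
  have fn: "y < n" if "y \<in> forced n t j" for y using that by (simp add: forced_def)
  have rd: "reading b c e (int y) = (per e (pos y) = b)" for e y
    by (auto simp: reading_def pos_def rshift_def rinv_def algebra_simps)
  have inj: "y = z" if "idx k (pos y) = idx k (pos z)" "y < n" "z < n" for y z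
  proof -
    have "int k dvd pos y - pos z" using that idx_eq[OF k] by simp
    then have "pos y - pos z = 0" by (rule small_dvd) (use that n in \<open>auto simp: pos_def\<close>)
    then show ?thesis by (auto simp: pos_def split: if_splits)
  qed
  let ?G = "pos ` forced n t j"
  have "card (pattern_event m k n b i c t j) * 2 ^ card (idx k ` ?G) \<le> card (Ps m k)"
  proof (rule determined_card[OF i])
    show "idx k ` ?G \<subseteq> {..<k}" using idx_less k by auto
    fix ps ps' assume a: "ps \<in> pattern_event m k n b i c t j" "ps' \<in> pattern_event m k n b i c t j"
      "\<And>x. x < k \<Longrightarrow> x \<notin> idx k ` ?G \<Longrightarrow> snd (ps ! i) ! x = snd (ps' ! i) ! x"
    have len: "length (snd (ps ! i)) = k" "length (snd (ps' ! i)) = k" using a i by (auto simp: pattern_event_def Ps_len)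
    have "letters ps i g = letters ps' i g" if g: "g \<in> ?G" for g
    proof -
      obtain y where y: "y \<in> forced n t j" "g = pos y" using g by blast
      have "reading b c (snd (ps ! i)) (int y) = reading b c (snd (ps' ! i)) (int y)"
      proof (rule pattern_determined[OF _ _ y(1)])
        fix x assume x: "x < n" "x \<notin> forced n t j"
        have "idx k (pos x) \<notin> idx k ` ?G"
        proof
          assume "idx k (pos x) \<in> idx k ` ?G"
          then obtain z where z: "z \<in> forced n t j" "idx k (pos x) = idx k (pos z)" by (elim imageE) (rule that, auto)
          then show False using inj[OF z(2) x(1) fn[OF z(1)]] x(2) by simp
        qed
        then have "letters ps i (pos x) = letters ps' i (pos x)" using a(3) idx_less[OF k] len by (simp add: per_idx)
        then show "reading b c (snd (ps ! i)) (int x) = reading b c (snd (ps' ! i)) (int x)" by (simp add: rd)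
      qed (use a in \<open>auto simp: pattern_event_def\<close>)
      then show ?thesis by (auto simp: rd y(2))
    qed
    then show "snd (ps ! i) = snd (ps' ! i)" using words_eqI[OF len a(3)] by blast
  qed (auto simp: pattern_event_def)
  moreover have "card (idx k ` ?G) = card (forced n t j)"
    unfolding image_image by (rule card_image, rule inj_onI, rule inj) (auto intro: fn)
  ultimately have "card (pattern_event m k n b i c t j) * 2 ^ card (forced n t j) \<le> card (Ps m k)" by simp
  moreover have "(2 :: nat) ^ (D div 2) \<le> 2 ^ card (forced n t j)"
    using card_forced[OF t n(1) j] by (simp add: power_increasing)
  ultimately show ?thesis by (meson le_trans mult_le_mono2)
qed

lemma card_UN_mult_le:
  assumes "finite I" "\<And>x. x \<in> I \<Longrightarrow> card (S x) * a \<le> (b :: nat)"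
  shows "card (\<Union>x\<in>I. S x) * a \<le> card I * b"
proof -
  have "card (\<Union>x\<in>I. S x) * a \<le> (\<Sum>x\<in>I. card (S x)) * a" by (intro mult_le_mono1 card_UN_le assms)
  also have "\<dots> = (\<Sum>x\<in>I. card (S x) * a)" by (rule sum_distrib_right)
  also have "\<dots> \<le> (\<Sum>x\<in>I. b)" by (rule sum_mono) (rule assms(2))
  finally show ?thesis by simp
qed

text \<open>Union bound: \<open>m^2 k^2\<close> events at most of each of the first two kinds and
  \<open>4 m k D^2 \<le> m k^3\<close> patterns, each of proportion at most
  \<open>2^-(D div 2)\<close>.\<close>

lemma card_nongeneric:
  assumes D: "1 \<le> D" "40 * D + 40 \<le> k" and m: "1 \<le> m"
  shows "card {ps \<in> Ps m k. \<not> generic k D ps} * 2 ^ (D div 2) \<le> 3 * m\<^sup>2 * k ^ 3 * card (Ps m k)"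
proof -
  let ?h = "D div 2" and ?n = "k - 12 * D - 1"
  let ?C = "{0..<int k}"
  let ?I1 = "({..<m} \<times> ?C \<times> {..<m} \<times> ?C) \<inter> {(i, c, j, d). (i, c) \<noteq> (j, d)}"
  let ?I2 = "{..<m} \<times> ?C \<times> {..<m} \<times> ?C"
  let ?I3 = "{(b :: bool, i, c, t, j). i < m \<and> c \<in> ?C \<and> 1 \<le> t \<and> t < D \<and> j < 2 * t + 1}"
  let ?S1 = "\<Union>(i, c, j, d)\<in>?I1. same_event m k D i c j d"
  let ?S2 = "\<Union>(i, c, j, d)\<in>?I2. inverse_event m k D i c j d"
  let ?S3 = "\<Union>(b, i, c, t, j)\<in>?I3. pattern_event m k ?n b i c t j"
  let ?M = "card (Ps m k)"
  have sub3: "?I3 \<subseteq> UNIV \<times> {..<m} \<times> ?C \<times> {..<D} \<times> {..<2 * D}" by auto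
  have fin3: "finite ?I3" by (rule finite_subset[OF sub3]) simp
  have "card ?I3 \<le> card ((UNIV :: bool set) \<times> {..<m} \<times> ?C \<times> {..<D} \<times> {..<2 * D})" by (rule card_mono[OF _ sub3]) simp
  also have "\<dots> = m * k * (4 * D * D)" by (simp add: card_cartesian_product)
  also have "4 * D * D \<le> k * k" using mult_le_mono[of "4 * D" k D k] D by simp
  finally have c3: "card ?I3 \<le> m * k ^ 3" by (simp add: power3_eq_cube mult.assoc mult_le_mono2)
  have c2: "card ?I2 = m * k * m * k" by (simp add: card_cartesian_product)
  have c1: "card ?I1 \<le> m * k * m * k" unfolding c2[symmetric] by (rule card_mono) auto
  have "card ?S1 * 2 ^ D \<le> card ?I1 * ?M"
    by (rule card_UN_mult_le) (use card_same_event[of _ m _ D k] D in auto)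
  moreover have "(2 :: nat) ^ ?h \<le> 2 ^ D" by (simp add: power_increasing)
  ultimately have s1: "card ?S1 * 2 ^ ?h \<le> (m * k * m * k) * ?M"
    using c1 by (meson le_trans mult_le_mono1 mult_le_mono2)
  have "card ?S2 * 2 ^ ?h \<le> card ?I2 * ?M"
    by (rule card_UN_mult_le) (use card_inverse_event[of _ m _ D k] D in auto)
  then have s2: "card ?S2 * 2 ^ ?h \<le> (m * k * m * k) * ?M" unfolding c2 .
  have "card ?S3 * 2 ^ ?h \<le> card ?I3 * ?M"
    by (rule card_UN_mult_le[OF fin3]) (use card_pattern_event[of _ m _ D ?n k] D in auto)
  then have s3: "card ?S3 * 2 ^ ?h \<le> (m * k ^ 3) * ?M" using c3 by (meson le_trans mult_le_mono1)
  have "{ps \<in> Ps m k. \<not> generic k D ps} \<subseteq> ?S1 \<union> ?S2 \<union> ?S3"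
  proof
    fix ps assume "ps \<in> {ps \<in> Ps m k. \<not> generic k D ps}"
    then have ps: "ps \<in> Ps m k" "\<not> generic k D ps" and len: "length ps = m" by (auto simp: Ps_def)
    then consider "\<not> distinct_subwords k D ps" | "\<not> no_inverse_subwords k D ps" | "\<not> no_patterns k D ps"
      by (auto simp: generic_def)
    then show "ps \<in> ?S1 \<union> ?S2 \<union> ?S3"
    proof cases
      case 1
      then obtain i j c d where "i < m" "j < m" "0 \<le> c" "c < int k" "0 \<le> d" "d < int k" "(i, c) \<noteq> (j, d)"
        "\<forall>t. 0 \<le> t \<and> t < int D \<longrightarrow> letters ps i (c + t) = letters ps j (d + t)"
        unfolding distinct_subwords_def len by blast
      then have "(i, c, j, d) \<in> ?I1" "ps \<in> same_event m k D i c j d" using ps by (auto simp: same_event_def)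
      then show ?thesis by blast
    next
      case 2
      then obtain i j c d where "i < m" "j < m" "0 \<le> c" "c < int k" "0 \<le> d" "d < int k"
        "\<forall>t. 0 \<le> t \<and> t < int D \<longrightarrow> letters ps i (c + t) = (\<not> letters ps j (d - t))"
        unfolding no_inverse_subwords_def len by blast
      then have "(i, c, j, d) \<in> ?I2" "ps \<in> inverse_event m k D i c j d" using ps by (auto simp: inverse_event_def)
      then show ?thesis by blast
    next
      case 3
      then obtain i c t j where x: "i < m" "0 \<le> c" "c < int k" "1 \<le> t" "t < D" "j < 2 * t + 1"
        and "pattern (reading True c (snd (ps ! i))) ?n t j \<or> pattern (reading False c (snd (ps ! i))) ?n t j"
        unfolding no_patterns_def len reading_def by auto
      then obtain b where "ps \<in> pattern_event m k ?n b i c t j" using ps by (auto simp: pattern_event_def)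
      moreover have "(b, i, c, t, j) \<in> ?I3" using x by simp
      ultimately show ?thesis by blast
    qed
  qed
  moreover have "finite (?S1 \<union> ?S2 \<union> ?S3)"
    by (rule finite_subset[of _ "Ps m k"]) (auto simp: same_event_def inverse_event_def pattern_event_def)
  ultimately have "card {ps \<in> Ps m k. \<not> generic k D ps} \<le> card (?S1 \<union> ?S2 \<union> ?S3)" by (intro card_mono)
  also have "\<dots> \<le> card ?S1 + card ?S2 + card ?S3" by (meson add_le_mono1 card_Un_le le_trans)
  finally have "card {ps \<in> Ps m k. \<not> generic k D ps} * 2 ^ ?h \<le> (card ?S1 + card ?S2 + card ?S3) * 2 ^ ?h" by (rule mult_le_mono1)
  also have "\<dots> = card ?S1 * 2 ^ ?h + card ?S2 * 2 ^ ?h + card ?S3 * 2 ^ ?h" by (simp add: distrib_right)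
  also have "\<dots> \<le> (m * k * m * k) * ?M + (m * k * m * k) * ?M + (m * k ^ 3) * ?M" by (intro add_mono s1 s2 s3)
  also have "\<dots> = (2 * (m\<^sup>2 * k\<^sup>2) + m * k ^ 3) * ?M" by (simp add: algebra_simps power2_eq_square)
  also have "\<dots> \<le> (3 * m\<^sup>2 * k ^ 3) * ?M"
  proof (rule mult_le_mono1)
    have "k\<^sup>2 \<le> k ^ 3" using D by (intro power_increasing) auto
    then have "m\<^sup>2 * k\<^sup>2 \<le> m\<^sup>2 * k ^ 3" by (rule mult_le_mono2)
    moreover have "m * k ^ 3 \<le> m\<^sup>2 * k ^ 3" using m by (simp add: power2_eq_square)
    ultimately show "2 * (m\<^sup>2 * k\<^sup>2) + m * k ^ 3 \<le> 3 * m\<^sup>2 * k ^ 3" by linarith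
  qed
  finally show ?thesis .
qed

section \<open>Isomorphism classes of generic quotients\<close>

lemma iso_chunk:
  assumes ps: "ps \<in> Ps m k" and m: "m \<ge> 1" and g: "generic k D ps" and D: "D \<ge> 1" "40 * D + 40 \<le> k"
    and ps': "ps' \<in> Ps m k" and iso: "quotient_group (map cw ps') \<cong> quotient_group (map cw ps)"
  shows "\<exists>\<beta>. \<forall>p\<in>set ps'. \<exists>xs \<rho> ys. \<rho> \<in> readings ps \<union> rinv ` readings ps \<and>
    map (\<lambda>s. s = \<beta>) (snd p) = xs @ rl \<rho> 0 (k - 12 * D - 1) @ ys"
proof -
  have gt: "generic_tuple (readings ps) k D (map cw ps)" by (rule generic_tuple[OF ps m g D])
  then have sc: "small_cancel (readings ps) k D" by (rule generic_tuple.axioms)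
  have E: "e \<noteq> [] \<and> (\<exists>r\<in>set (map cw ps'). r = W e \<or> r = rotate1 (W e))" if e: "e \<in> snd ` set ps'" for e
  proof -
    obtain p where p: "p \<in> set ps'" "e = snd p" using e by blast
    then have "length e = k" using ps' by (simp add: Ps_def)
    then have "e \<noteq> []" using D by auto
    moreover have "cw p \<in> set (map cw ps')" using p by simp
    ultimately show ?thesis unfolding p(2) cw_def by metis
  qed
  from generic_tuple.rigid[OF gt iso E] obtain \<beta>
    where \<beta>: "\<forall>e\<in>snd ` set ps'. generic_tuple.chunk (readings ps) (small_cancel.q k D - 1) (map (\<lambda>s. s = \<beta>) e)" by blast
  show ?thesis
    using \<beta> unfolding generic_tuple.chunk_def[OF gt] small_cancel.q_def[OF sc] by blast
qed

lemma readings_normal: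
  assumes ps: "ps \<in> Ps m k" and k: "k > 0" and r: "\<rho> \<in> readings ps"
  shows "\<exists>i<m. \<exists>c. 0 \<le> c \<and> c < int k \<and> \<rho> = rshift c (per (snd (ps ! i)))"
proof -
  obtain c p where p: "p \<in> set ps" "\<rho> = rshift c (per (snd p))" using r unfolding readings_def by blast
  then obtain i where i: "i < length ps" "\<rho> = rshift c (per (snd (ps ! i)))" by (metis in_set_conv_nth)
  have len: "length ps = m" "length (snd (ps ! i)) = k" using ps i by (auto simp: Ps_def)
  have "rshift c (per (snd (ps ! i))) = rshift (c mod int k) (per (snd (ps ! i)))"
    by (rule ext) (simp add: rshift_def per_def len mod_add_right_eq)
  then show ?thesis using i len k by (intro exI[of _ i] conjI exI[of _ "c mod int k"]) auto
qed

lemma card_reading_words: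
  assumes ps: "ps \<in> Ps m k" and k: "k > 0"
  shows "finite ((\<lambda>\<rho>. rl \<rho> 0 N) ` (readings ps \<union> rinv ` readings ps))"
    and "card ((\<lambda>\<rho>. rl \<rho> 0 N) ` (readings ps \<union> rinv ` readings ps)) \<le> 2 * m * k"
proof -
  let ?f = "\<lambda>(b :: bool, i, c). rl (if b then rshift c (per (snd (ps ! i))) else rinv (rshift c (per (snd (ps ! i))))) 0 N"
  let ?I = "(UNIV :: bool set) \<times> {..<m} \<times> {0..<int k}"
  have sub: "(\<lambda>\<rho>. rl \<rho> 0 N) ` (readings ps \<union> rinv ` readings ps) \<subseteq> ?f ` ?I"
  proof (rule image_subsetI)
    fix \<rho> assume "\<rho> \<in> readings ps \<union> rinv ` readings ps"
    then consider "\<rho> \<in> readings ps" | \<sigma> where "\<sigma> \<in> readings ps" "\<rho> = rinv \<sigma>" by blast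
    then show "rl \<rho> 0 N \<in> ?f ` ?I"
    proof cases
      case 1
      then obtain i c where "i < m" "0 \<le> c" "c < int k" "\<rho> = rshift c (per (snd (ps ! i)))" using readings_normal[OF ps k] by blast
      then show ?thesis by (intro image_eqI[of _ _ "(True, i, c)"]) auto
    next
      case (2 \<sigma>)
      then obtain i c where "i < m" "0 \<le> c" "c < int k" "\<sigma> = rshift c (per (snd (ps ! i)))" using readings_normal[OF ps k] by blast
      then show ?thesis using 2 by (intro image_eqI[of _ _ "(False, i, c)"]) auto
    qed
  qed
  have fin: "finite ?I" by simp
  show "finite ((\<lambda>\<rho>. rl \<rho> 0 N) ` (readings ps \<union> rinv ` readings ps))"
    by (rule finite_subset[OF sub finite_imageI[OF fin]])
  have "card ((\<lambda>\<rho>. rl \<rho> 0 N) ` (readings ps \<union> rinv ` readings ps)) \<le> card (?f ` ?I)"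
    by (rule card_mono[OF finite_imageI[OF fin] sub])
  also have "\<dots> \<le> card ?I" by (rule card_image_le[OF fin])
  also have "card ?I = 2 * m * k" by (simp add: card_cartesian_product)
  finally show "card ((\<lambda>\<rho>. rl \<rho> 0 N) ` (readings ps \<union> rinv ` readings ps)) \<le> 2 * m * k" .
qed

definition chunk_words :: "nat \<Rightarrow> nat \<Rightarrow> (bool \<times> bool list) list \<Rightarrow> bool \<Rightarrow> bool list set" where
  "chunk_words k N ps \<beta> = {e. length e = k \<and> (\<exists>xs \<rho> ys. \<rho> \<in> readings ps \<union> rinv ` readings ps \<and>
    map (\<lambda>s. s = \<beta>) e = xs @ rl \<rho> 0 N @ ys)}"

text \<open>Such a word is given by the \<open>N\<close> signs of the relator that it contains,
  their position and the other \<open>k - N\<close> letters.\<close>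

lemma card_chunk_words:
  assumes ps: "ps \<in> Ps m k" and k: "k > 0"
  shows "card (chunk_words k N ps \<beta>) \<le> 2 * m * k * ((k + 1) * 2 ^ (k - N))"
proof -
  let ?W = "(\<lambda>\<rho>. rl \<rho> 0 N) ` (readings ps \<union> rinv ` readings ps)"
  let ?f = "\<lambda>(w, j, z). map (\<lambda>s. s = \<beta>) (take j z @ w @ drop j z)"
  let ?I = "?W \<times> {..k} \<times> {z :: bool list. length z = k - N}"
  have "chunk_words k N ps \<beta> \<subseteq> ?f ` ?I"
  proof
    fix e assume "e \<in> chunk_words k N ps \<beta>"
    then obtain xs \<rho> ys where e: "length e = k" "\<rho> \<in> readings ps \<union> rinv ` readings ps"
      "map (\<lambda>s. s = \<beta>) e = xs @ rl \<rho> 0 N @ ys" by (auto simp: chunk_words_def)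
    have "length xs + N + length ys = k" using arg_cong[OF e(3), of length] e(1) by simp
    then have "(rl \<rho> 0 N, length xs, xs @ ys) \<in> ?I" using e(2) by auto
    moreover have "e = map (\<lambda>s. s = \<beta>) (map (\<lambda>s. s = \<beta>) e)" by (rule nth_equalityI) auto
    then have "e = ?f (rl \<rho> 0 N, length xs, xs @ ys)" unfolding e(3) by simp
    ultimately show "e \<in> ?f ` ?I" by blast
  qed
  moreover have fin: "finite ?I" using card_reading_words(1)[OF ps k] by (intro finite_cartesian_product finite_words) auto
  ultimately have "card (chunk_words k N ps \<beta>) \<le> card ?I" by (meson card_image_le card_mono finite_imageI le_trans)
  also have "\<dots> = card ?W * ((k + 1) * 2 ^ (k - N))" by (simp add: card_cartesian_product card_words)
  also have "\<dots> \<le> 2 * m * k * ((k + 1) * 2 ^ (k - N))" by (intro mult_le_mono1 card_reading_words ps k)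
  finally show ?thesis .
qed

text \<open>The leading 2 counts the choice of \<open>\<beta>\<close>, the 2 next to it the flag of
  \<open>cw\<close> for each relator.\<close>

lemma card_iso_class:
  assumes ps: "ps \<in> Ps m k" and m: "m \<ge> 1" and g: "generic k D ps" and D: "D \<ge> 1" "40 * D + 40 \<le> k"
  shows "card {ps' \<in> Ps m k. quotient_group (map cw ps') \<cong> quotient_group (map cw ps)}
    \<le> 2 * (2 * (2 * m * k * ((k + 1) * 2 ^ (12 * D + 1)))) ^ m"
proof -
  let ?N = "k - 12 * D - 1"
  let ?c = "2 * m * k * ((k + 1) * 2 ^ (12 * D + 1))"
  let ?C = "\<lambda>\<beta>. chunk_words k ?N ps \<beta>"
  let ?B = "\<lambda>\<beta>. {ps' :: (bool \<times> bool list) list. set ps' \<subseteq> UNIV \<times> ?C \<beta> \<and> length ps' = m}"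
  have finC: "finite (?C \<beta>)" for \<beta> by (rule finite_subset[OF _ finite_words[of k]]) (auto simp: chunk_words_def)
  have "k - ?N = 12 * D + 1" using D by simp
  then have c: "card (?C \<beta>) \<le> ?c" for \<beta> using card_chunk_words[OF ps, of ?N \<beta>] D by simp
  have B: "finite (?B \<beta>)" "card (?B \<beta>) \<le> (2 * ?c) ^ m" for \<beta>
  proof -
    have fin: "finite ((UNIV :: bool set) \<times> ?C \<beta>)" using finC by simp
    show "finite (?B \<beta>)" by (rule finite_lists_length_eq[OF fin])
    have "card (?B \<beta>) = (2 * card (?C \<beta>)) ^ m"
      by (subst card_lists_length_eq[OF fin]) (simp add: card_cartesian_product)
    also have "\<dots> \<le> (2 * ?c) ^ m" by (intro power_mono mult_le_mono2 c) simp
    finally show "card (?B \<beta>) \<le> (2 * ?c) ^ m" .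
  qed
  have "{ps' \<in> Ps m k. quotient_group (map cw ps') \<cong> quotient_group (map cw ps)} \<subseteq> ?B True \<union> ?B False"
  proof
    fix ps' assume "ps' \<in> {ps' \<in> Ps m k. quotient_group (map cw ps') \<cong> quotient_group (map cw ps)}"
    then have p: "ps' \<in> Ps m k" "quotient_group (map cw ps') \<cong> quotient_group (map cw ps)" by auto
    obtain \<beta> where b: "\<forall>p\<in>set ps'. \<exists>xs \<rho> ys. \<rho> \<in> readings ps \<union> rinv ` readings ps \<and>
        map (\<lambda>s. s = \<beta>) (snd p) = xs @ rl \<rho> 0 ?N @ ys" using iso_chunk[OF ps m g D p] by blast
    have "\<forall>p\<in>set ps'. snd p \<in> ?C \<beta>"
      using b p(1) unfolding chunk_words_def Ps_def by blast
    moreover have "length ps' = m" using p(1) by (simp add: Ps_def)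
    ultimately have "ps' \<in> ?B \<beta>" by auto
    then show "ps' \<in> ?B True \<union> ?B False" by (cases \<beta>) auto
  qed
  then have "card {ps' \<in> Ps m k. quotient_group (map cw ps') \<cong> quotient_group (map cw ps)} \<le> card (?B True \<union> ?B False)"
    by (intro card_mono finite_UnI B)
  also have "\<dots> \<le> card (?B True) + card (?B False)" by (rule card_Un_le)
  also have "\<dots> \<le> (2 * ?c) ^ m + (2 * ?c) ^ m" by (intro add_mono B)
  finally show ?thesis by simp
qed

section \<open>Presentations of small length\<close>

definition gen_of :: "nat \<times> bool \<Rightarrow> modular_gen \<times> bool" where
  "gen_of p = (if fst p = 0 then gen_a else gen_b, snd p)"
definition num_of :: "modular_gen \<times> bool \<Rightarrow> nat \<times> bool" where
  "num_of p = (case fst p of gen_a \<Rightarrow> 0 | gen_b \<Rightarrow> 1, snd p)"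

lemma gen_num [simp]: "gen_of (num_of p) = p"
  by (cases p; cases "fst p") (auto simp: gen_of_def num_of_def)

lemma num_gen: "fst p < 2 \<Longrightarrow> num_of (gen_of p) = p"
  by (cases p) (auto simp: gen_of_def num_of_def)

lemma num_of_less: "fst (num_of p) < 2" by (cases "fst p") (auto simp: num_of_def)

lemma reduce_map:
  assumes "\<And>p. p \<in> T \<Longrightarrow> inv_letter p \<in> T" "\<And>p. p \<in> T \<Longrightarrow> f (inv_letter p) = inv_letter (f p)" "inj_on f T" "set w \<subseteq> T"
  shows "free_reduce (map f w) = map f (free_reduce w) \<and> set (free_reduce w) \<subseteq> T"
  using assms(4)
proof (induction w)
  case (Cons p w)
  let ?r = "free_reduce w"
  have IH: "free_reduce (map f w) = map f ?r" "set ?r \<subseteq> T" "p \<in> T" using Cons by auto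
  have e': "free_reduce (f p # map f w) = push_letter (f p) (map f ?r)" by (simp add: free_reduce_def IH(1)[unfolded free_reduce_def])
  have e'': "free_reduce (p # w) = push_letter p ?r" by (simp add: free_reduce_def)
  have eq: "f q = inv_letter (f p) \<longleftrightarrow> q = inv_letter p" if "q \<in> T" for q
    using inj_on_eq_iff[OF assms(3) that assms(1)[OF IH(3)]] assms(2)[OF IH(3)] by simp
  have "push_letter (f p) (map f ?r) = map f (push_letter p ?r)"
  proof (cases ?r)
    case (Cons q v)
    then have "q \<in> T" using IH(2) by simp
    from eq[OF this] show ?thesis by (simp add: push_letter_def Cons)
  qed (simp add: push_letter_def)
  moreover have "set (push_letter p ?r) \<subseteq> T" using IH(2,3) by (auto simp: push_letter_def split: list.split)
  ultimately show ?case by (simp add: e' e'')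
qed (simp add: free_reduce_def)

lemma reduce_gen_of: "w \<in> words_over {..<2} \<Longrightarrow> free_reduce (map gen_of w) = map gen_of (free_reduce w)"
proof -
  assume w: "w \<in> words_over {..<2}"
  have "inj_on gen_of {p. fst p < 2}" by (rule inj_on_inverseI[of _ num_of]) (simp add: num_gen)
  moreover have "set w \<subseteq> {p. fst p < 2}" using w by (auto simp: words_over_def)
  ultimately show ?thesis
    using reduce_map[of "{p. fst p < 2}" gen_of w] by (simp add: gen_of_def inv_letter_def)
qed

lemma reduce_num_of: "free_reduce (map num_of w) = map num_of (free_reduce w)"
proof -
  have "inj num_of" by (rule inj_on_inverseI[of _ gen_of]) simp
  then show ?thesis
    using reduce_map[of UNIV num_of w] by (simp add: num_of_def inv_letter_def)
qed

lemma num_of_words: "map num_of w \<in> words_over {..<2}"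
  using num_of_less by (auto simp: words_over_def)

definition quotient_presentation :: "mword list \<Rightarrow> fin_presentation" where
  "quotient_presentation \<tau> = (2, map (map num_of) ([replicate 2 (gen_a, True), replicate 3 (gen_b, True)] @ map (map letter_word) \<tau>))"

text \<open>Shows that the minimum \<open>T1\<close> is taken over a nonempty set. For the inclusion
  of the kernel in the normal closure, \<open>gev_trivial_imp\<close> is applied to the kernel of
  the map from the free group on \<open>modular_gen\<close> to the presented group.\<close>

lemma presents_quotient: "presents (quotient_presentation \<tau>) (quotient_group \<tau>)"
proof -
  let ?F = "free_group {..<2::nat}" and ?Q = "quotient_group \<tau>"
  let ?R = "set (snd (quotient_presentation \<tau>))"
  let ?NC = "normal_closure ?F (free_reduce ` ?R)"
  have words: "?R \<subseteq> words_over {..<2}"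
    unfolding quotient_presentation_def snd_conv set_map by (rule image_subsetI) (rule num_of_words)
  then have fp: "fin_presentation (quotient_presentation \<tau>)" by (simp add: fin_presentation_def quotient_presentation_def)
  have Rr: "free_reduce ` ?R \<subseteq> carrier ?F" using words by (auto simp: free_group_def free_reduce_words_over)
  have NC: "?NC \<lhd> ?F" by (rule group.normal_normal_closure[OF group_free_group Rr])
  have carF: "x \<in> words_over {..<2}" "free_reduce x = x" if "x \<in> carrier ?F" for x
    using that by (auto simp: free_group_def free_reduce_id)
  let ?h = "\<lambda>x. gev \<tau> (map gen_of x)"
  have hr: "?h (free_reduce w) = ?h w" if "w \<in> words_over {..<2}" for w
    using reduce_gen_of[OF that] gev_reduce by metis
  interpret h: group_hom ?F ?Q ?h
  proof (intro group_hom.intro group_hom_axioms.intro group_free_group group_quotient_group homI)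
    fix x y assume "x \<in> carrier ?F" "y \<in> carrier ?F"
    then have "x @ y \<in> words_over {..<2}" by (auto simp: free_group_def words_over_def)
    from hr[OF this] show "?h (x \<otimes>\<^bsub>?F\<^esub> y) = ?h x \<otimes>\<^bsub>?Q\<^esub> ?h y" by (simp add: free_group_def gev_append)
  qed (rule gev_closed)
  have onto: "?h ` carrier ?F = carrier ?Q"
  proof
    show "carrier ?Q \<subseteq> ?h ` carrier ?F"
    proof
      fix g assume "g \<in> carrier ?Q"
      then obtain w where w: "g = gev \<tau> w" using gev_onto by blast
      have "g = ?h (free_reduce (map num_of w))"
        unfolding hr[OF num_of_words] by (simp add: w o_def)
      moreover have "free_reduce (map num_of w) \<in> carrier ?F"
        using free_reduce_words_over[OF num_of_words] by (simp add: free_group_def)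
      ultimately show "g \<in> ?h ` carrier ?F" by blast
    qed
  qed (auto simp: gev_closed)
  have "kernel ?F ?Q ?h = ?NC"
  proof
    show "?NC \<subseteq> kernel ?F ?Q ?h"
    proof (rule normal_closure_minimal[OF h.normal_kernel])
      show "free_reduce ` ?R \<subseteq> kernel ?F ?Q ?h"
      proof (rule image_subsetI)
        fix r assume r: "r \<in> ?R"
        have "gev \<tau> (map gen_of r) = \<one>\<^bsub>?Q\<^esub>"
        proof -
          obtain u where u: "u \<in> modular_relators \<union> map letter_word ` set \<tau>" "r = map num_of u"
            using r unfolding quotient_presentation_def modular_relators_def snd_conv set_map set_append list.set by (rule imageE)
          have "map gen_of r = u" by (simp add: u(2) o_def)
          then show ?thesis using u(1) gev_relator gev_modular by auto
        qed
        then show "free_reduce r \<in> kernel ?F ?Q ?h" using hr[of r] words r Rr by (auto simp: kernel_def)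
      qed
    qed
    show "kernel ?F ?Q ?h \<subseteq> ?NC"
    proof
      fix x assume "x \<in> kernel ?F ?Q ?h"
      then have x: "x \<in> carrier ?F" "?h x = \<one>\<^bsub>?Q\<^esub>" by (auto simp: kernel_def)
      let ?P = "?F Mod ?NC" and ?g = "\<lambda>u. ?NC #>\<^bsub>?F\<^esub> map num_of u"
      have numF: "map num_of u \<in> carrier ?F" if "u \<in> carrier FM" for u
      proof -
        have "freely_reduced (map num_of u)" using reduce_num_of[of u] FM_repr[OF that] freely_reduced_free_reduce by metis
        then show ?thesis using num_of_words by (simp add: free_group_def)
      qed
      interpret c: group_hom ?F ?P "\<lambda>x. ?NC #>\<^bsub>?F\<^esub> x" by (rule coset_hom[OF NC])
      interpret g: group_hom FM ?P ?g
      proof (intro group_hom.intro group_hom_axioms.intro group_free_group c.H.is_group homI)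
        show "?g u \<in> carrier ?P" if "u \<in> carrier FM" for u using c.hom_closed[OF numF[OF that]] .
        fix u v assume uv: "u \<in> carrier FM" "v \<in> carrier FM"
        have "map num_of (u \<otimes>\<^bsub>FM\<^esub> v) = map num_of u \<otimes>\<^bsub>?F\<^esub> map num_of v"
          by (simp add: free_group_def flip: reduce_num_of)
        then show "?g (u \<otimes>\<^bsub>FM\<^esub> v) = ?g u \<otimes>\<^bsub>?P\<^esub> ?g v" using c.hom_mult[OF numF[OF uv(1)] numF[OF uv(2)]] by simp
      qed
      have inK: "u \<in> kernel FM ?P ?g \<longleftrightarrow> map num_of u \<in> ?NC" if u: "u \<in> carrier FM" for u
        using group.coset_join1[OF group_free_group _ numF[OF u] normal_imp_subgroup[OF NC]]
          group.coset_join2[OF group_free_group numF[OF u] normal_imp_subgroup[OF NC]] u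
        by (auto simp: kernel_def)
      have rel: "free_reduce r \<in> kernel FM ?P ?g" if "map num_of r \<in> ?R" for r
      proof -
        have "free_reduce (map num_of r) \<in> ?NC" by (rule subsetD[OF normal_closure_subset imageI[OF that]])
        then show ?thesis using inK[OF FM_carrier] by (simp add: reduce_num_of)
      qed
      have "free_reduce (map gen_of x) \<in> kernel FM ?P ?g"
      proof (rule gev_trivial_imp[OF x(2) g.normal_kernel])
        show "free_reduce ` modular_relators \<subseteq> kernel FM ?P ?g"
          by (rule image_subsetI, rule rel) (auto simp: modular_relators_def quotient_presentation_def)
        show "free_reduce (map letter_word r) \<in> kernel FM ?P ?g" if "r \<in> set \<tau>" for r
          by (rule rel) (use that in \<open>auto simp: quotient_presentation_def\<close>)
      qed
      then have "map num_of (free_reduce (map gen_of x)) \<in> ?NC" using inK[OF FM_carrier] by blast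
      moreover have "free_reduce (map gen_of x) = map gen_of x" using reduce_gen_of[OF carF(1)[OF x(1)]] carF(2)[OF x(1)] by simp
      moreover have "map num_of (map gen_of x) = x"
        using carF(1)[OF x(1)] num_gen by (auto simp: words_over_def intro!: map_idI)
      ultimately show "x \<in> ?NC" by simp
    qed
  qed
  then have "presented_group {..<2} ?R \<cong> ?Q"
    using h.FactGroup_iso[OF onto] by (simp add: presented_group_def)
  then show ?thesis using fp by (simp add: presents_def quotient_presentation_def)
qed

lemma T1_presentation: "\<exists>P. presents P (quotient_group \<tau>) \<and> ell1 P = T1 (quotient_group \<tau>)"
  unfolding T1_def by (rule LeastI_ex) (use presents_quotient in blast)

lemma presented_group_trim:
  "presented_group S (set (filter (\<lambda>w. w \<noteq> []) ws)) = presented_group S (set ws)"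
proof -
  have "free_reduce ` set (filter (\<lambda>w. w \<noteq> []) ws) \<subseteq> N \<longleftrightarrow> free_reduce ` set ws \<subseteq> N" if "N \<lhd> free_group S" for N
  proof -
    have "\<one>\<^bsub>free_group S\<^esub> \<in> N" by (rule subgroup.one_closed[OF normal_imp_subgroup[OF that]])
    then have "free_reduce [] \<in> N" by (simp add: free_group_def free_reduce_def)
    then show ?thesis by auto
  qed
  then have "{N. N \<lhd> free_group S \<and> free_reduce ` set (filter (\<lambda>w. w \<noteq> []) ws) \<subseteq> N}
      = {N. N \<lhd> free_group S \<and> free_reduce ` set ws \<subseteq> N}" by (intro Collect_cong) blast
  then show ?thesis by (simp only: presented_group_def normal_closure_def)
qed

text \<open>Empty relators add nothing to \<open>ell1\<close>; unless they are removed,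
  presentations of a given length cannot be counted.\<close>

lemma T1_presentation_trim:
  "\<exists>P. presents P (quotient_group \<tau>) \<and> ell1 P = T1 (quotient_group \<tau>) \<and> [] \<notin> set (snd P)"
proof -
  obtain P where P: "presents P (quotient_group \<tau>)" "ell1 P = T1 (quotient_group \<tau>)" using T1_presentation by blast
  let ?P = "(fst P, filter (\<lambda>w. w \<noteq> []) (snd P))"
  have "presents ?P (quotient_group \<tau>)"
    using P(1) unfolding presents_def fin_presentation_def fst_conv snd_conv presented_group_trim by auto
  moreover have "(\<Sum>w\<leftarrow>filter (\<lambda>w. w \<noteq> []) ws. length w) = (\<Sum>w\<leftarrow>ws. length w)" for ws :: "nat word list"
    by (induction ws) auto
  then have "ell1 ?P = ell1 P" by (simp add: ell1_def)
  ultimately show ?thesis using P(2) by (intro exI[of _ ?P]) auto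
qed

lemma presents_iso:
  assumes "presents P G" "presents P H"
  shows "G \<cong> H"
proof -
  have P: "presented_group {..<fst P} (set (snd P)) \<cong> G" "presented_group {..<fst P} (set (snd P)) \<cong> H"
    "set (snd P) \<subseteq> words_over {..<fst P}" using assms by (auto simp: presents_def fin_presentation_def)
  show ?thesis by (rule iso_trans[OF group.iso_sym[OF group_presented_group[OF P(3)] P(1)] P(2)])
qed

text \<open>A generator that occurs in no relator would give a homomorphism onto the integers, but
  the quotient is generated by elements of finite order.\<close>

lemma presents_gens:
  assumes P: "presents P (quotient_group \<tau>)" and i: "i < fst P"
  shows "i \<in> fst ` set (concat (snd P))"
proof (rule ccontr)
  assume ni: "i \<notin> fst ` set (concat (snd P))"
  let ?F = "free_group {..<fst P}" and ?Q = "quotient_group \<tau>"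
  let ?NC = "normal_closure ?F (free_reduce ` set (snd P))"
  let ?P = "?F Mod ?NC"
  let ?Z = "\<lparr>carrier = UNIV, mult = (+), one = 0\<rparr> :: int monoid"
  \<comment> \<open>Exponent sum of the generator \<open>i\<close>, a homomorphism to the integers
    that kills all relators.\<close>
  define ex :: "nat word \<Rightarrow> int" where "ex w = (\<Sum>p\<leftarrow>w. if fst p = i then (if snd p then 1 else - 1) else 0)" for w
  have ex_app: "ex (u @ v) = ex u + ex v" for u v by (simp add: ex_def)
  have push: "ex (push_letter p w) = ex (p # w)" for p w
    by (cases w) (auto simp: push_letter_def ex_def inv_letter_def)
  have red: "ex (free_reduce w) = ex w" for w
  proof (induction w)
    case (Cons p w)
    have "ex (free_reduce (p # w)) = ex (p # free_reduce w)" by (simp add: free_reduce_def push)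
    then show ?case using Cons by (simp add: ex_def)
  qed (simp add: free_reduce_def)
  have Rsub: "set (snd P) \<subseteq> words_over {..<fst P}" using P by (simp add: presents_def fin_presentation_def)
  then have Rr: "free_reduce ` set (snd P) \<subseteq> carrier ?F" by (auto simp: free_group_def free_reduce_words_over)
  have NC: "?NC \<lhd> ?F" by (rule group.normal_normal_closure[OF group_free_group Rr])
  have mult: "ex (x \<otimes>\<^bsub>?F\<^esub> y) = ex x + ex y" for x y by (simp add: free_group_def red ex_app)
  have "group ?Z" by (rule groupI) (auto intro: exI[of _ "- x" for x])
  then interpret e: group_hom ?F ?Z ex
    by (intro group_hom.intro group_hom_axioms.intro group_free_group homI) (auto simp: mult)
  have "?NC \<subseteq> kernel ?F ?Z ex"
  proof (rule normal_closure_minimal[OF e.normal_kernel], rule image_subsetI)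
    fix r assume r: "r \<in> set (snd P)"
    then have "\<forall>p\<in>set r. fst p \<noteq> i" using ni by auto
    then have "ex r = 0" unfolding ex_def by (induction r) auto
    then show "free_reduce r \<in> kernel ?F ?Z ex" using Rr r by (auto simp: kernel_def red)
  qed
  then have ker: "ex x = 0" if "x \<in> ?NC" for x using that by (auto simp: kernel_def)
  interpret c: group_hom ?F ?P "\<lambda>x. ?NC #>\<^bsub>?F\<^esub> x" by (rule coset_hom[OF NC])
  \<comment> \<open>\<open>ex\<close> is constant on cosets of the normal closure; this is the
    induced map on the presented group.\<close>
  define \<theta> where "\<theta> X = (THE d. \<forall>x\<in>X. ex x = d)" for X
  have \<theta>: "\<theta> (?NC #>\<^bsub>?F\<^esub> z) = ex z" if z: "z \<in> carrier ?F" for z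
  proof -
    have all: "\<forall>x\<in>?NC #>\<^bsub>?F\<^esub> z. ex x = ex z" unfolding r_coset_def using ker by (auto simp: mult)
    have self: "z \<in> ?NC #>\<^bsub>?F\<^esub> z" by (rule group.rcos_self[OF group_free_group z normal_imp_subgroup[OF NC]])
    show ?thesis unfolding \<theta>_def
    proof (rule the_equality[where P = "\<lambda>d. \<forall>x\<in>?NC #>\<^bsub>?F\<^esub> z. ex x = d", OF all])
      fix d assume "\<forall>x\<in>?NC #>\<^bsub>?F\<^esub> z. ex x = d"
      from bspec[OF this self] show "d = ex z" by simp
    qed
  qed
  have onto: "\<exists>x\<in>carrier ?F. X = ?NC #>\<^bsub>?F\<^esub> x" if "X \<in> carrier ?P" for X
    using that unfolding carrier_FactGroup by blast
  have \<theta>_mult: "\<theta> (X \<otimes>\<^bsub>?P\<^esub> Y) = \<theta> X + \<theta> Y" if XY: "X \<in> carrier ?P" "Y \<in> carrier ?P" for X Y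
  proof -
    obtain x where x: "x \<in> carrier ?F" "X = ?NC #>\<^bsub>?F\<^esub> x" using onto[OF XY(1)] by (rule bexE)
    obtain y where y: "y \<in> carrier ?F" "Y = ?NC #>\<^bsub>?F\<^esub> y" using onto[OF XY(2)] by (rule bexE)
    note xy = x y
    have "X \<otimes>\<^bsub>?P\<^esub> Y = ?NC #>\<^bsub>?F\<^esub> (x \<otimes>\<^bsub>?F\<^esub> y)" unfolding xy(2,4) by (rule c.hom_mult[OF xy(1,3), symmetric])
    then have "\<theta> (X \<otimes>\<^bsub>?P\<^esub> Y) = ex (x \<otimes>\<^bsub>?F\<^esub> y)" using \<theta>[OF e.G.m_closed[OF xy(1,3)]] by (simp only:)
    then show ?thesis unfolding mult xy(2,4) \<theta>[OF xy(1)] \<theta>[OF xy(3)] .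
  qed
  have "?P \<cong> ?Q" using P by (simp add: presents_def presented_group_def)
  then have "?Q \<cong> ?P" by (rule group.iso_sym[OF c.H.is_group])
  then obtain \<phi> where \<phi>: "\<phi> \<in> iso ?Q ?P" by (auto simp: is_iso_def)
  have bij: "\<phi> ` carrier ?Q = carrier ?P" and hom: "\<phi> \<in> hom ?Q ?P" using \<phi> by (auto simp: iso_def bij_betw_def)
  define \<Theta> where "\<Theta> w = \<theta> (\<phi> (ev \<tau> w))" for w
  have app: "\<Theta> (u @ v) = \<Theta> u + \<Theta> v" for u v
  proof -
    have "\<phi> (ev \<tau> (u @ v)) = \<phi> (ev \<tau> u) \<otimes>\<^bsub>?P\<^esub> \<phi> (ev \<tau> v)" unfolding ev_append by (rule hom_mult[OF hom]) simp_all
    then show ?thesis unfolding \<Theta>_def using \<theta>_mult[OF hom_in_carrier[OF hom] hom_in_carrier[OF hom]] by simp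
  qed
  have nil: "\<Theta> [] = 0" using app[of "[]" "[]"] by simp
  have cong: "\<Theta> u = \<Theta> v" if "ev \<tau> u = ev \<tau> v" for u v using that by (simp add: \<Theta>_def)
  \<comment> \<open>Elements of finite order vanish in the integers.\<close>
  have a: "\<Theta> [let_a] = 0" using cong[OF ev_aa] app[of "[let_a]" "[let_a]"] nil by simp
  have b: "\<Theta> [let_b] = 0"
    using cong[OF ev_bbb] app[of "[let_b]" "[let_b, let_b]"] app[of "[let_b]" "[let_b]"] nil by simp
  have B: "\<Theta> [let_b_inv] = 0" using cong[OF ev_bB(1)] app[of "[let_b]" "[let_b_inv]"] b nil by simp
  have zero: "\<Theta> w = 0" for w
  proof (induction w)
    case (Cons x w)
    have "\<Theta> [x] = 0" using a b B by (cases x) auto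
    then show ?case using app[of "[x]" w] Cons by simp
  qed (rule nil)
  let ?x = "[(i, True)]"
  have x: "?x \<in> carrier ?F" using i by (simp add: free_group_def words_over_def freely_reduced_def)
  have "?NC #>\<^bsub>?F\<^esub> ?x \<in> \<phi> ` carrier ?Q" unfolding bij by (rule c.hom_closed[OF x])
  then obtain g where g: "g \<in> carrier ?Q" "?NC #>\<^bsub>?F\<^esub> ?x = \<phi> g" by (rule imageE)
  obtain w where "g = ev \<tau> w" using ev_onto[OF g(1)] by (rule exE)
  then have "\<Theta> w = ex ?x" unfolding \<Theta>_def using \<theta>[OF x] g(2) by simp
  then show False using zero by (simp add: ex_def)
qed

lemma presents_gens_le:
  assumes "presents P (quotient_group \<tau>)"
  shows "fst P \<le> ell1 P"
proof -
  have "card {..<fst P} \<le> card (fst ` set (concat (snd P)))"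
    using presents_gens[OF assms] by (intro card_mono) auto
  also have "\<dots> \<le> card (set (concat (snd P)))" by (rule card_image_le) simp
  also have "\<dots> \<le> length (concat (snd P))" by (rule card_length)
  finally show ?thesis by (simp add: ell1_def length_concat)
qed

text \<open>A list of nonempty words is coded by its concatenation, in which each letter carries
  a flag telling whether it ends a word.\<close>

fun flagged :: "'a list \<Rightarrow> (bool \<times> 'a) list" where
  "flagged [] = []"
| "flagged [x] = [(True, x)]"
| "flagged (x # y # w) = (False, x) # flagged (y # w)"

fun unflag :: "(bool \<times> 'a) list \<Rightarrow> 'a list list" where
  "unflag [] = []"
| "unflag ((b, x) # l) = (if b then [x] # unflag l else (x # hd (unflag l)) # tl (unflag l))"

lemma unflag_flagged: "w \<noteq> [] \<Longrightarrow> unflag (flagged w @ l) = w # unflag l"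
  by (induction w rule: flagged.induct) auto

lemma unflag_concat: "[] \<notin> set ws \<Longrightarrow> unflag (concat (map flagged ws)) = ws"
  by (induction ws) (auto simp: unflag_flagged)

lemma flagged_length [simp]: "length (flagged w) = length w"
  by (induction w rule: flagged.induct) auto

lemma flagged_set: "snd ` set (flagged w) = set w"
  by (induction w rule: flagged.induct) auto

definition small_presentations :: "nat \<Rightarrow> fin_presentation set" where
  "small_presentations t = {P. fin_presentation P \<and> fst P \<le> t \<and> [] \<notin> set (snd P) \<and> ell1 P = t}"

text \<open>At most \<open>t + 1\<close> numbers of generators, and \<open>4 * t\<close> values of a
  flagged letter: flag, generator and sign.\<close>

lemma card_small_presentations:
  "finite (small_presentations t)" "card (small_presentations t) \<le> (t + 1) * (4 * t) ^ t"
proof -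
  let ?A = "(UNIV :: bool set) \<times> ({..<t} \<times> (UNIV :: bool set))"
  let ?B = "{l. set l \<subseteq> ?A \<and> length l = t}"
  let ?f = "\<lambda>P :: fin_presentation. (fst P, concat (map flagged (snd P)))"
  have fin: "finite ?A" by simp
  have inj: "inj_on ?f (small_presentations t)"
  proof (rule inj_onI)
    fix P P' assume a: "P \<in> small_presentations t" "P' \<in> small_presentations t" "?f P = ?f P'"
    then have "unflag (concat (map flagged (snd P))) = unflag (concat (map flagged (snd P')))" by simp
    then have "snd P = snd P'" using a(1,2) by (simp add: unflag_concat small_presentations_def)
    then show "P = P'" using a(3) by (simp add: prod_eq_iff)
  qed
  have sub: "?f ` small_presentations t \<subseteq> {..t} \<times> ?B"
  proof (rule image_subsetI)
    fix P assume P: "P \<in> small_presentations t"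
    have "x \<in> ?A" if x: "x \<in> set (concat (map flagged (snd P)))" for x
    proof -
      obtain w where w: "w \<in> set (snd P)" "x \<in> set (flagged w)" using x by auto
      have "snd x \<in> set w" using w(2) flagged_set by force
      moreover have "w \<in> words_over {..<fst P}" using P w(1) by (auto simp: small_presentations_def fin_presentation_def)
      ultimately have "fst (snd x) < fst P" by (auto simp: words_over_def)
      then show ?thesis using P by (cases x) (auto simp: small_presentations_def)
    qed
    moreover have "length (concat (map flagged (snd P))) = t"
      using P by (simp add: small_presentations_def ell1_def length_concat o_def)
    ultimately show "?f P \<in> {..t} \<times> ?B" using P by (auto simp: small_presentations_def)
  qed
  have finB: "finite ({..t} \<times> ?B)" using finite_lists_length_eq[OF fin] by simp
  show "finite (small_presentations t)" by (rule inj_on_finite[OF inj sub finB])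
  have "card (small_presentations t) \<le> card ({..t} \<times> ?B)" by (rule card_inj_on_le[OF inj sub finB])
  also have "\<dots> = (t + 1) * card ?A ^ t" unfolding card_cartesian_product card_lists_length_eq[OF fin] by simp
  also have "card ?A = 4 * t" by (simp add: card_cartesian_product)
  finally show "card (small_presentations t) \<le> (t + 1) * (4 * t) ^ t" .
qed

text \<open>For \<open>t \<ge> 2\<close> one has \<open>t \<le> t * log 2 t\<close>, so
  \<open>(t + 1) * (4 * t) ^ t\<close> is at most 2 to the power
  \<open>t + 2 * t + t * log 2 t\<close>, which is at most four times \<open>k / 8\<close>. The
  factor 8 covers \<open>t = 1\<close>, where the logarithm vanishes.\<close>

lemma small_presentations_bound:
  assumes k: "k \<ge> 1" and t: "real t * log 2 (real t) < real k / 8"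
  shows "t \<le> k" "real (card (small_presentations t)) \<le> 8 * 2 powr (real k / 2)"
proof -
  have c: "real (card (small_presentations t)) \<le> real ((t + 1) * (4 * t) ^ t)"
    using card_small_presentations(2)[of t] by (simp only: of_nat_le_iff)
  have one: "1 \<le> 2 powr (real k / 2)" by (rule ge_one_powr_ge_zero) auto
  show "t \<le> k" "real (card (small_presentations t)) \<le> 8 * 2 powr (real k / 2)"
  proof -
    consider "t = 0" | "t = 1" | "t \<ge> 2" by linarith
    then have "t \<le> k \<and> real (card (small_presentations t)) \<le> 8 * 2 powr (real k / 2)"
    proof cases
      case 1
      then show ?thesis using c one by simp
    next
      case 2
      then show ?thesis using c one k by simp
    next
      case 3
      let ?x = "real t * log 2 (real t)"
      have "1 \<le> log 2 (real t)" using 3 by (simp add: le_log_iff)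
      then have x: "real t \<le> ?x" using mult_left_mono[of 1 "log 2 (real t)" "real t"] by simp
      have "t + 1 \<le> 2 ^ t" using less_exp[of t] by (simp only: Suc_leI flip: Suc_eq_plus1)
      then have 1: "real (t + 1) \<le> 2 powr real t" by (simp add: powr_realpow flip: of_nat_le_iff[where 'a = real])
      have 2: "real (4 ^ t) = 2 powr (2 * real t)"
        using powr_realpow[of 4 t] powr_powr[of 2 2 "real t"] by simp
      have "real (t ^ t) = (2 powr log 2 (real t)) powr real t" using 3 by (simp add: powr_realpow)
      then have 3: "real (t ^ t) = 2 powr ?x" by (simp add: powr_powr mult.commute)
      have "real ((t + 1) * (4 * t) ^ t) = real (t + 1) * (real (4 ^ t) * real (t ^ t))" by (simp only: of_nat_mult power_mult_distrib)
      also have "\<dots> \<le> 2 powr real t * (real (4 ^ t) * real (t ^ t))" using 1 by (rule mult_right_mono) simp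
      also have "\<dots> = 2 powr (real t + (2 * real t + ?x))" unfolding 2 3 by (simp only: powr_add)
      also have "\<dots> \<le> 2 powr (real k / 2)" using x t by (intro powr_mono) auto
      also have "\<dots> \<le> 8 * 2 powr (real k / 2)" by simp
      finally show ?thesis using c x t by auto
    qed
    then show "t \<le> k" "real (card (small_presentations t)) \<le> 8 * 2 powr (real k / 2)" by auto
  qed
qed

abbreviation complexity :: "mword list \<Rightarrow> real" where
  "complexity \<tau> \<equiv> real (T1 (quotient_group \<tau>)) * log 2 (real (T1 (quotient_group \<tau>)))"

text \<open>Each tuple is sent to a presentation of minimal length. A fibre lies in one isomorphism
  class, and there are at most \<open>k + 1\<close> lengths with the number of presentations from
  \<open>small_presentations_bound\<close> for each.\<close>

lemma card_compressible:
  assumes m: "m \<ge> 1" and D: "D \<ge> 1" "40 * D + 40 \<le> k"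
  shows "real (card {ps \<in> Ps m k. generic k D ps \<and> complexity (map cw ps) < real k / 8})
    \<le> (real k + 1) * (8 * 2 powr (real k / 2)) * (2 * (2 * (2 * real m * real k * ((real k + 1) * 2 ^ (12 * D + 1)))) ^ m)"
proof -
  let ?B = "{ps \<in> Ps m k. generic k D ps \<and> complexity (map cw ps) < real k / 8}"
  let ?M = "2 * (2 * (2 * m * k * ((k + 1) * 2 ^ (12 * D + 1)))) ^ m"
  have "\<forall>ps. \<exists>P. presents P (quotient_group (map cw ps)) \<and> ell1 P = T1 (quotient_group (map cw ps)) \<and> [] \<notin> set (snd P)"
    using T1_presentation_trim by blast
  then obtain f where f: "\<And>ps. presents (f ps) (quotient_group (map cw ps))"
    "\<And>ps. ell1 (f ps) = T1 (quotient_group (map cw ps))" "\<And>ps. [] \<notin> set (snd (f ps))" by metis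
  let ?T = "{t \<in> {..k}. real t * log 2 (real t) < real k / 8}"
  have k1: "k \<ge> 1" using D by simp
  have im: "f ` ?B \<subseteq> (\<Union>t\<in>?T. small_presentations t)"
  proof (rule image_subsetI)
    fix ps assume "ps \<in> ?B"
    then have "ell1 (f ps) \<in> ?T" using small_presentations_bound(1)[OF k1] by (simp add: f(2))
    moreover have "f ps \<in> small_presentations (ell1 (f ps))"
      using f(1,3)[of ps] presents_gens_le[OF f(1)] by (simp add: small_presentations_def presents_def)
    ultimately show "f ps \<in> (\<Union>t\<in>?T. small_presentations t)" by (rule UN_I)
  qed
  have fin: "finite (\<Union>t\<in>?T. small_presentations t)" by (rule finite_UN_I) (simp_all add: card_small_presentations(1))
  have "card (f ` ?B) \<le> card (\<Union>t\<in>?T. small_presentations t)" by (rule card_mono[OF fin im])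
  also have "\<dots> \<le> (\<Sum>t\<in>?T. card (small_presentations t))" by (rule card_UN_le) simp
  finally have "real (card (f ` ?B)) \<le> (\<Sum>t\<in>?T. real (card (small_presentations t)))" by (simp flip: of_nat_sum)
  also have "\<dots> \<le> (\<Sum>t\<in>?T. 8 * 2 powr (real k / 2))"
    by (rule sum_mono) (use small_presentations_bound(2)[OF k1] in blast)
  also have "\<dots> = real (card ?T) * (8 * 2 powr (real k / 2))" by simp
  also have "\<dots> \<le> (real k + 1) * (8 * 2 powr (real k / 2))"
  proof (rule mult_right_mono)
    have "card ?T \<le> card {..k}" by (rule card_mono) auto
    then show "real (card ?T) \<le> real k + 1" by simp
  qed simp
  finally have fB: "real (card (f ` ?B)) \<le> (real k + 1) * (8 * 2 powr (real k / 2))" .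
  have finB: "finite ?B" using finite_Ps by (rule finite_subset[rotated]) auto
  have fibre: "card {ps \<in> ?B. f ps = P} \<le> ?M" if P: "P \<in> f ` ?B" for P
  proof -
    obtain ps where ps: "ps \<in> ?B" "P = f ps" using P by blast
    have "{ps' \<in> ?B. f ps' = P} \<subseteq> {ps' \<in> Ps m k. quotient_group (map cw ps') \<cong> quotient_group (map cw ps)}"
    proof
      fix ps' assume a: "ps' \<in> {ps' \<in> ?B. f ps' = P}"
      then have "presents P (quotient_group (map cw ps'))" using f(1)[of ps'] by simp
      moreover have "presents P (quotient_group (map cw ps))" using f(1)[of ps] ps(2) by simp
      ultimately show "ps' \<in> {ps' \<in> Ps m k. quotient_group (map cw ps') \<cong> quotient_group (map cw ps)}"
        using presents_iso a by blast
    qed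
    then have "card {ps' \<in> ?B. f ps' = P} \<le> card {ps' \<in> Ps m k. quotient_group (map cw ps') \<cong> quotient_group (map cw ps)}"
      by (intro card_mono) (use finite_Ps in auto)
    also have "\<dots> \<le> ?M" by (rule card_iso_class) (use ps(1) m D in auto)
    finally show ?thesis .
  qed
  have "?B = (\<Union>P\<in>f ` ?B. {ps \<in> ?B. f ps = P})" by blast
  then have "card ?B = card (\<Union>P\<in>f ` ?B. {ps \<in> ?B. f ps = P})" by (rule arg_cong)
  also have "\<dots> \<le> (\<Sum>P\<in>f ` ?B. card {ps \<in> ?B. f ps = P})" by (rule card_UN_le) (rule finite_imageI[OF finB])
  also have "\<dots> \<le> (\<Sum>P\<in>f ` ?B. ?M)" by (rule sum_mono) (rule fibre)
  also have "\<dots> = card (f ` ?B) * ?M" by simp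
  finally have "real (card ?B) \<le> real (card (f ` ?B) * ?M)" by (simp only: of_nat_le_iff)
  also have "\<dots> = real (card (f ` ?B)) * (2 * (2 * (2 * real m * real k * ((real k + 1) * 2 ^ (12 * D + 1)))) ^ m)"
    by (simp only: of_nat_mult of_nat_power of_nat_add of_nat_numeral of_nat_1)
  also have "\<dots> \<le> (real k + 1) * (8 * 2 powr (real k / 2)) * (2 * (2 * (2 * real m * real k * ((real k + 1) * 2 ^ (12 * D + 1)))) ^ m)"
    by (rule mult_right_mono[OF fB]) simp
  finally show ?thesis .
qed

section \<open>Asymptotics\<close>

lemma nongeneric_fraction:
  assumes m: "m \<ge> 1" and k: "k \<ge> 100"
  shows "real (card {ps \<in> Ps m k. \<not> generic k (k div 100) ps})
    \<le> 3 * (real m)\<^sup>2 * (real k ^ 3 / 2 powr (real k / 200 - 1)) * real (card (Ps m k))"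
proof -
  let ?D = "k div 100" and ?X = "card {ps \<in> Ps m k. \<not> generic k (k div 100) ps}"
  have D: "1 \<le> ?D" "40 * ?D + 40 \<le> k" using k by auto
  have "real k / 200 - 1 \<le> real (?D div 2)" by linarith
  then have e: "2 powr (real k / 200 - 1) \<le> 2 ^ (?D div 2)" by (subst powr_realpow[symmetric]) (auto intro: powr_mono)
  have "real ?X * 2 powr (real k / 200 - 1) \<le> real ?X * 2 ^ (?D div 2)" by (rule mult_left_mono[OF e]) simp
  also have "\<dots> = real (?X * 2 ^ (?D div 2))" by simp
  also have "\<dots> \<le> real (3 * m\<^sup>2 * k ^ 3 * card (Ps m k))" unfolding of_nat_le_iff by (rule card_nongeneric[OF D m])
  finally show ?thesis by (simp add: field_simps)
qed

text \<open>From \<open>12 * D \<le> (3 / 25) * k\<close> the share per relator left by an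
  isomorphism class has exponent \<open>- (22 / 25) * k\<close>; the presentations contribute
  \<open>k / 2\<close>, and \<open>1 / 2 - 22 / 25 = - 19 / 50\<close>. By \<open>small\<close> the
  \<open>m\<close>-th power of this share is at most the share itself.\<close>

lemma compressible_fraction:
  assumes m: "m \<ge> 1" and k: "k \<ge> 100"
    and small: "4 * real m * (real k * (real k + 1) * 2 powr (- (22 / 25) * real k)) \<le> 1"
  shows "real (card {ps \<in> Ps m k. generic k (k div 100) ps \<and> complexity (map cw ps) < real k / 8})
    \<le> 64 * real m * (real k * (real k + 1)\<^sup>2 * 2 powr (- (19 / 50) * real k)) * real (card (Ps m k))"
proof -
  let ?D = "k div 100" and ?y = "4 * real m * (real k * (real k + 1) * 2 powr (- (22 / 25) * real k))"
  let ?z = "2 * (2 * real m * real k * ((real k + 1) * 2 ^ (12 * ?D + 1)))"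
  have D: "1 \<le> ?D" "40 * ?D + 40 \<le> k" using k by auto
  have "2 ^ (12 * ?D) = 2 powr real (12 * ?D)" by (rule powr_realpow[symmetric]) simp
  also have "\<dots> \<le> 2 powr ((3 / 25) * real k)" by (rule powr_mono) (linarith, simp)
  also have "\<dots> = 2 powr (real k + - (22 / 25) * real k)" by (rule arg_cong[where f = "\<lambda>x. 2 powr x"]) (simp add: field_simps)
  also have "\<dots> = 2 ^ k * 2 powr (- (22 / 25) * real k)" unfolding powr_add by (simp add: powr_realpow)
  finally have e: "2 ^ (12 * ?D) \<le> (2 ^ k * 2 powr (- (22 / 25) * real k) :: real)" .
  have "?z = (8 * real m * real k * (real k + 1)) * 2 ^ (12 * ?D)" by simp
  also have "\<dots> \<le> (8 * real m * real k * (real k + 1)) * (2 ^ k * 2 powr (- (22 / 25) * real k))"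
    by (rule mult_left_mono[OF e]) simp
  also have "\<dots> = (2 * 2 ^ k) * ?y" by simp
  finally have z: "?z \<le> (2 * 2 ^ k) * ?y" .
  have "?z ^ m \<le> ((2 * 2 ^ k) * ?y) ^ m" by (rule power_mono[OF z]) simp
  also have "\<dots> = (2 * 2 ^ k) ^ m * ?y ^ m" by (rule power_mult_distrib)
  also have "\<dots> \<le> (2 * 2 ^ k) ^ m * ?y"
  proof (rule mult_left_mono)
    show "?y ^ m \<le> ?y" using power_decreasing[of 1 m ?y] m small by simp
  qed simp
  also have "(2 * 2 ^ k) ^ m = real (card (Ps m k))" by (simp add: card_Ps)
  finally have zm: "?z ^ m \<le> real (card (Ps m k)) * ?y" .
  have "real (card {ps \<in> Ps m k. generic k ?D ps \<and> complexity (map cw ps) < real k / 8})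
    \<le> (real k + 1) * (8 * 2 powr (real k / 2)) * (2 * ?z ^ m)" by (rule card_compressible[OF m D])
  also have "\<dots> \<le> (real k + 1) * (8 * 2 powr (real k / 2)) * (2 * (real (card (Ps m k)) * ?y))"
    by (intro mult_left_mono zm) auto
  also have "\<dots> = 64 * real m * (real k * (real k + 1)\<^sup>2 * (2 powr (real k / 2) * 2 powr (- (22 / 25) * real k))) * real (card (Ps m k))"
    by (simp add: power2_eq_square)
  also have "2 powr (real k / 2) * 2 powr (- (22 / 25) * real k) = 2 powr (- (19 / 50) * real k)"
    unfolding powr_add[symmetric] by (rule arg_cong[where f = "\<lambda>x. 2 powr x"]) (simp add: field_simps)
  finally show ?thesis .
qed

theorem theorem4:
  fixes m :: nat and \<epsilon> :: real
  assumes "m \<ge> 1" and "0 < \<epsilon>" and "\<epsilon> < 1"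
  shows "\<exists>n\<^sub>0::nat. n\<^sub>0 > 0 \<and> (\<exists>L::real. L > 0 \<and>
           (\<forall>n::nat. even n \<and> n \<ge> n\<^sub>0 \<longrightarrow>
              real (growth n (incompressible_tuples m L)) / real (growth n (tuples m)) \<ge> 1 - \<epsilon>))"
proof -
  let ?f = "\<lambda>k. real k ^ 3 / 2 powr (real k / 200 - 1)"
  let ?g = "\<lambda>k. real k * (real k + 1)\<^sup>2 * 2 powr (- (19 / 50) * real k)"
  let ?h = "\<lambda>k. real k * (real k + 1) * 2 powr (- (22 / 25) * real k)"
  have lim: "?f \<longlonglongrightarrow> 0" "?g \<longlonglongrightarrow> 0" "?h \<longlonglongrightarrow> 0" by real_asymp+
  have lim': "(\<lambda>k. 3 * (real m)\<^sup>2 * ?f k) \<longlonglongrightarrow> 0" "(\<lambda>k. 64 * real m * ?g k) \<longlonglongrightarrow> 0" "(\<lambda>k. 4 * real m * ?h k) \<longlonglongrightarrow> 0"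
    by (rule tendsto_mult_right_zero, rule lim)+
  have pos: "0 < \<epsilon> / 2" "(0 :: real) < 1" using assms(2) by simp_all
  have "eventually (\<lambda>k. 3 * (real m)\<^sup>2 * ?f k < \<epsilon> / 2 \<and> 64 * real m * ?g k < \<epsilon> / 2 \<and> 4 * real m * ?h k < 1) sequentially"
    by (intro eventually_conj order_tendstoD(2)[OF lim'(1) pos(1)] order_tendstoD(2)[OF lim'(2) pos(1)]
      order_tendstoD(2)[OF lim'(3) pos(2)])
  then obtain K where K: "\<And>k. k \<ge> K \<Longrightarrow> 3 * (real m)\<^sup>2 * ?f k < \<epsilon> / 2 \<and> 64 * real m * ?g k < \<epsilon> / 2 \<and> 4 * real m * ?h k < 1"
    unfolding eventually_sequentially by blast
  \<comment> \<open>For \<open>n = 2 * k\<close> the constant \<open>L = 1 / 16\<close> gives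
    \<open>L * n = k / 8\<close>, the threshold of \<open>compressible_fraction\<close>.\<close>
  have main: "real (growth (2 * k) (incompressible_tuples m (1 / 16))) / real (growth (2 * k) (tuples m)) \<ge> 1 - \<epsilon>"
    if k: "k \<ge> K" "k \<ge> 100" for k
  proof -
    let ?D = "k div 100" and ?C = "real (card (Ps m k))"
    let ?I = "{ps \<in> Ps m k. map cw ps \<in> incompressible_tuples m (1 / 16)}"
    let ?N = "{ps \<in> Ps m k. \<not> generic k ?D ps}"
    let ?B = "{ps \<in> Ps m k. generic k ?D ps \<and> complexity (map cw ps) < real k / 8}"
    have k0: "k > 0" using k by simp
    have tup: "map cw ps \<in> tuples m \<and> tuple_length (map cw ps) = 2 * k" if "ps \<in> Ps m k" for ps
      using tuples_growth(1)[OF assms(1) k0] that by blast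
    have "{ps \<in> Ps m k. map cw ps \<in> tuples m} = Ps m k" using tup by blast
    then have gT: "growth (2 * k) (tuples m) = card (Ps m k)" using growth_Ps[OF assms(1) k0 subset_refl] by simp
    have gI: "growth (2 * k) (incompressible_tuples m (1 / 16)) = card ?I"
      by (rule growth_Ps[OF assms(1) k0]) (auto simp: incompressible_tuples_def)
    have "Ps m k \<subseteq> ?I \<union> (?N \<union> ?B)"
    proof
      fix ps assume ps: "ps \<in> Ps m k"
      have "map cw ps \<in> incompressible_tuples m (1 / 16)" if "\<not> complexity (map cw ps) < real k / 8"
        using tup[OF ps] that by (simp add: incompressible_tuples_def)
      then show "ps \<in> ?I \<union> (?N \<union> ?B)" using ps by blast
    qed
    then have "card (Ps m k) \<le> card (?I \<union> (?N \<union> ?B))" by (intro card_mono) auto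
    also have "\<dots> \<le> card ?I + card (?N \<union> ?B)" by (rule card_Un_le)
    also have "\<dots> \<le> card ?I + (card ?N + card ?B)" by (intro add_left_mono card_Un_le)
    finally have "?C \<le> real (card ?I) + real (card ?N) + real (card ?B)" by linarith
    moreover have "real (card ?N) \<le> \<epsilon> / 2 * ?C"
      using nongeneric_fraction[OF assms(1) k(2)] mult_right_mono[of "3 * (real m)\<^sup>2 * ?f k" "\<epsilon> / 2" ?C] K[OF k(1)] by linarith
    moreover have "real (card ?B) \<le> \<epsilon> / 2 * ?C"
      using compressible_fraction[OF assms(1) k(2)] mult_right_mono[of "64 * real m * ?g k" "\<epsilon> / 2" ?C] K[OF k(1)] by linarith
    ultimately have "(1 - \<epsilon>) * ?C \<le> real (card ?I)" by (simp add: algebra_simps)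
    moreover have "?C > 0" by (simp add: card_Ps)
    ultimately show ?thesis unfolding gT gI by (simp add: le_divide_eq)
  qed
  show ?thesis
  \<comment> \<open>Beyond \<open>K\<close> the three limits are small enough;
    \<open>k \<ge> 100\<close> makes \<open>k div 100\<close> positive and also gives
    \<open>40 * D + 40 \<le> k\<close>.\<close>
  proof (intro exI[of _ "2 * (K + 100)"] conjI exI[of _ "1 / 16"] allI impI)
    fix n :: nat assume n: "even n \<and> n \<ge> 2 * (K + 100)"
    then obtain k where "n = 2 * k" by (auto elim: evenE)
    then show "1 - \<epsilon> \<le> real (growth n (incompressible_tuples m (1 / 16))) / real (growth n (tuples m))"
      using main[of k] n by simp
  qed simp_all
qed

end
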